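(* Let $E=\{\zeta_j\}_{j=1}^n$ be a finite subset of the unit circle $\mathbb{T}$, let $F\subset\mathbb{T}$ be an arbitrary closed set, and assume $E\cap F=\emptyset$. Let $f$ be analytic on the unit disk $\mathbb{D}$ with $|f(0)|=1$, and suppose that for some constant $K>0$ and exponents $p,q,r\ge 0$, $$\log|f(z)|\le\frac{K}{(1-|z|)^p}\,\frac{\operatorname{dist}^r(z,E)}{\operatorname{dist}^q(z,F)}, \qquad z\in\mathbb{D}.$$ Then for every $\varepsilon>0$ there is a positive number $C_4=C_4(E,F,p,q,r,\varepsilon)$ such that $$\sum_{\zeta\in Z(f)} (1-|\zeta|)^{p+1+\varepsilon}\,\frac{\operatorname{dist}^{(q-\alpha(F)+\varepsilon)_+}(\zeta,F)}{\operatorname{dist}^{\min(p,r)}(\zeta,E)}\le C_4\cdot K.$$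
   Context: $Z(f)$ denotes the zero set of $f$ in $\mathbb{D}$, counted with multiplicities; $\operatorname{dist}$ is Euclidean distance; $a_+:=\max(a,0)$. The Ahern–Clark type of a closed set $F\subset\mathbb{T}$ is $$\alpha(F):=\sup\{\alpha\in\mathbb{R}: |\{t\in\mathbb{T}:\operatorname{dist}(t,F)<x\}|=O(x^\alpha),\ x\to+0\},$$ where $|\cdot|$ denotes Lebesgue (arc length) measure on $\mathbb{T}$. *)

theory Defs
  imports "HOL-Complex_Analysis.Complex_Analysis" "HOL-Library.Landau_Symbols"
begin

definition circle_nbhd_measure :: "complex set \<Rightarrow> real \<Rightarrow> real" where
  "circle_nbhd_measure F x =
     measure lborel {\<theta> \<in> {0..<2*pi}. infdist (cis \<theta>) F < x}"

definition ahern_clark_type :: "complex set \<Rightarrow> real" where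
  "ahern_clark_type F =
     Sup {\<alpha>::real. circle_nbhd_measure F \<in> O[at_right 0](\<lambda>x. x powr \<alpha>)}"

end

theory Submission
  imports Defs
begin

text \<open>If \<open>\<Psi>\<close> maps the disc into itself and fixes 0, Jensen's inequality for \<open>f \<circ> \<Psi>\<close> bounds
  the sum of \<open>1 - |w|\<close> over preimages \<open>w\<close> of zeros of \<open>f\<close> by the mean of the majorant of
  \<open>log |f|\<close> along the image of the circle.  It suffices to treat the zeros with \<open>1 - |\<zeta>|\<close> of order
  \<open>\<tau>\<close>, and \<open>dist \<zeta> F\<close> of order \<open>\<delta>\<close> or \<open>|\<zeta> - e|\<close> of order \<open>l\<close> for some \<open>e \<in> E\<close>, and to sum over
  dyadic scales; the exponent \<open>\<epsilon>\<close> pays for logarithms.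

  Away from \<open>E\<close> one takes for \<open>\<Psi>\<close> the dilation by \<open>1 - \<tau>\<close> of a map that is nearly the identity at
  distance at least \<open>\<delta>\<close> from \<open>F\<close> and whose image keeps a distance of about \<open>\<delta>\<close> from \<open>F\<close>; the mean of
  \<open>max (dist t F) \<delta>\<close> to the power \<open>- q\<close> is controlled by the Ahern-Clark type.  Near \<open>e \<in> E\<close> this
  map, with a fixed \<open>\<delta>\<close>, is followed by \<open>v \<mapsto> 1 - (1 - v)\<^sup>1\<^sup>-\<^sup>d\<close> with vertex moved to \<open>e\<close> and \<open>d\<close> of
  order \<open>\<tau> / l\<close>.  Its image lies in the region where the height is at least \<open>d\<close> times the distance to
  \<open>e\<close>, and there the majorant is uniformly bounded.\<close>

section \<open>A discrete form of Jensen's inequality\<close>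

text \<open>In the weight \<open>(1 - norm b) powr (p + 1 + \<epsilon>)\<close> one factor
  \<open>1 - norm b\<close> belongs to Jensen, so at height \<tau> the mean of the majorant may be
  of order \<open>K * \<tau> powr (- p)\<close>, up to small powers of \<tau>; the dilation provides
  this. Dilation alone would come within \<tau> of F and charge the singularity there at scale
  \<tau>; the push truncates it at \<delta>, the distance from F of the zeros in question. Near e
  the obstacle is different: the bound must gain \<open>l powr r\<close>, while the mean of
  \<open>norm (z - e) powr r\<close> over a whole circle is not small for small l. Averaging cannot
  help, so the majorant has to be small on the whole image. Where the height is at least d times the
  distance x from e, it is at most \<open>x powr r / (d * x) powr p\<close>. For
  \<open>r \<le> p\<close> this decreases in x, hence l is the critical distance, and d of order
  \<tau> / l makes the value there \<open>\<tau> powr (- p) * l powr r\<close>. For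
  \<open>r > p\<close> the surplus power of the distance is bounded and dropped, which is the origin
  of \<open>min p r\<close>. The corner costs the height a factor
  \<open>norm (1 - z) powr (2 * d)\<close>, acceptable because d stays below a multiple of
  \<epsilon>.\<close>

lemma holomorphic_factor_zeros:
  fixes f :: "complex \<Rightarrow> complex"
  assumes hol: "f holomorphic_on S" and S: "open S" "connected S"
    and nz: "\<exists>w\<in>S. f w \<noteq> 0" and B: "finite B" "B \<subseteq> S"
  shows "\<exists>g. g holomorphic_on S \<and> (\<forall>z\<in>S. f z = (\<Prod>b\<in>B. (z - b) ^ nat (zorder f b)) * g z)"
  using B
proof (induction B rule: finite_induct)
  case empty
  then show ?case using hol by auto
next
  case (insert c B)
  then obtain g where g: "g holomorphic_on S"
    "\<forall>z\<in>S. f z = (\<Prod>b\<in>B. (z - b) ^ nat (zorder f b)) * g z" by auto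
  define n where "n = nat (zorder f c)"
  define P where "P z = (\<Prod>b\<in>B. (z - b) ^ nat (zorder f b))" for z
  define h where "h = zor_poly f c"
  have c: "c \<in> S" using insert by auto
  obtain r where r: "r > 0" "cball c r \<subseteq> S" "h holomorphic_on cball c r"
    "\<forall>w\<in>cball c r. f w = h w * (w - c) ^ n \<and> h w \<noteq> 0"
    using zorder_exist_zero[OF hol S c nz] unfolding n_def h_def by auto
  have Pc: "P c \<noteq> 0" unfolding P_def using insert by auto
  have Phol: "P holomorphic_on S" unfolding P_def by (intro holomorphic_intros)
  then have "continuous_on S P" by (rule holomorphic_on_imp_continuous_on)
  then have "open (S \<inter> P -` (- {0}))" using S by (intro continuous_open_preimage) auto
  moreover have "c \<in> S \<inter> P -` (- {0})" using Pc c by auto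
  ultimately obtain e where e: "e > 0" "ball c e \<subseteq> S \<inter> P -` (- {0})"
    by (meson open_contains_ball)
  define V where "V = ball c (min e r)"
  have V: "open V" "V \<subseteq> S" "c \<in> V" "\<And>z. z \<in> V \<Longrightarrow> P z \<noteq> 0" "V \<subseteq> cball c r"
    using e r unfolding V_def by (auto)
  \<comment> \<open>Near \<open>c\<close> the two factorisations give
    \<open>P z * g z = h z * (z - c) ^ n\<close> with \<open>P\<close> free of zeros, so dividing
    \<open>g\<close> by the power leaves the holomorphic quotient \<open>h / P\<close>; this forces
    the value at \<open>c\<close>.\<close>
  define k where "k z = (if z = c then h c / P c else g z / (z - c) ^ n)" for z
  have kV: "k z = h z / P z" if "z \<in> V" for z
  proof (cases "z = c")
    case False
    have "P z * g z = h z * (z - c) ^ n"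
      using g(2) r(4) V that by (metis P_def subsetD)
    then show ?thesis using False V(4)[OF that] by (simp add: k_def field_simps)
  qed (simp add: k_def)
  have "(\<lambda>z. h z / P z) holomorphic_on V"
    using V r(3) Phol by (intro holomorphic_on_divide) (auto intro: holomorphic_on_subset)
  then have "k holomorphic_on V" using kV by (simp cong: holomorphic_cong)
  moreover have "k holomorphic_on (S - {c})"
  proof -
    have "(\<lambda>z. g z / (z - c) ^ n) holomorphic_on (S - {c})"
      by (intro holomorphic_intros holomorphic_on_subset[OF g(1)]) auto
    then show ?thesis by (rule holomorphic_transform) (auto simp: k_def)
  qed
  ultimately have "k holomorphic_on (V \<union> (S - {c}))"
    using V S by (intro holomorphic_on_Un) auto
  moreover have "V \<union> (S - {c}) = S" using V c by auto
  ultimately have "k holomorphic_on S" by simp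
  moreover have "f z = (\<Prod>b\<in>insert c B. (z - b) ^ nat (zorder f b)) * k z" if "z \<in> S" for z
  proof -
    have 1: "(\<Prod>b\<in>insert c B. (z - b) ^ nat (zorder f b)) = (z - c) ^ n * P z"
      using insert unfolding P_def n_def by simp
    show ?thesis
    proof (cases "z = c")
      case True
      then show ?thesis using 1 kV[of c] r V Pc by (simp add: field_simps)
    next
      case False
      then show ?thesis using 1 g(2) that by (simp add: k_def P_def)
    qed
  qed
  ultimately show ?case by blast
qed

lemma norm_diff_eq_norm_one_minus_cnj:
  fixes w a :: complex
  assumes "norm w = 1"
  shows "norm (1 - cnj a * w) = norm (w - a)"
proof -
  have "cnj w * w = 1" using assms by (metis complex_norm_square mult.commute of_real_1 one_power2)
  then have "1 - cnj a * w = cnj (w - a) * w" by (simp add: algebra_simps)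
  then show ?thesis using assms by (metis complex_mod_cnj mult.right_neutral norm_mult)
qed

text \<open>Taking the product of the function over rotations replaces the integral in Jensen's
  formula by a finite mean, and the mean value property by the maximum principle.\<close>

lemma jensen_inequality_discrete:
  fixes G :: "complex \<Rightarrow> complex" and a :: "'b \<Rightarrow> complex" and m :: "'b \<Rightarrow> nat" and M :: real
  assumes S: "open S" "cball 0 1 \<subseteq> S" and hol: "G holomorphic_on S"
    and B: "finite B" "\<And>b. b \<in> B \<Longrightarrow> norm (a b) < 1"
    and U: "finite U" "U \<noteq> {}" "U \<subseteq> sphere 0 1"
    and G0: "\<And>w. w \<in> S \<Longrightarrow> G0 w = (\<Prod>b\<in>B. (w - a b) ^ m b) * G w"
    and norm0: "norm (G0 0) = 1"
    and bound: "\<And>w. norm w = 1 \<Longrightarrow> (\<Prod>u\<in>U. norm (G0 (w * u))) \<le> exp (real (card U) * M)"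
  shows "(\<Sum>b\<in>B. m b * (1 - norm (a b))) \<le> M"
proof -
  \<comment> \<open>\<open>Gs\<close> is \<open>G0\<close> divided by the Blaschke product of the
    points \<open>a b\<close>: these zeros are divided out and the modulus on the unit circle is
    unchanged.\<close>
  define Gs where "Gs w = (\<Prod>b\<in>B. (1 - cnj (a b) * w) ^ m b) * G w" for w
  define Q where "Q w = (\<Prod>u\<in>U. Gs (w * u))" for w
  have Gs: "Gs holomorphic_on S" unfolding Gs_def by (intro holomorphic_intros hol)
  have mul: "(\<lambda>w. w * u) ` cball 0 1 \<subseteq> S" if "u \<in> U" for u
    using that U S by (auto simp: norm_mult subset_eq)
  have Qhol: "Q holomorphic_on cball 0 1"
    unfolding Q_def
  proof (rule holomorphic_on_prod)
    fix u assume u: "u \<in> U"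
    have "(Gs \<circ> (\<lambda>w. w * u)) holomorphic_on cball 0 1"
      by (intro holomorphic_on_compose holomorphic_intros holomorphic_on_subset[OF Gs mul[OF u]])
    then show "(\<lambda>w. Gs (w * u)) holomorphic_on cball 0 1" by (simp add: o_def)
  qed
  have eq: "norm (Gs w) = norm (G0 w)" if "norm w = 1" for w
  proof -
    have "w \<in> S" using that S by auto
    then show ?thesis using that
      by (simp add: Gs_def G0 norm_mult prod_norm[symmetric] norm_power norm_diff_eq_norm_one_minus_cnj)
  qed
  have "norm (Q 0) \<le> exp (real (card U) * M)"
  proof (rule maximum_modulus_frontier[of Q "ball 0 1"])
    show "Q holomorphic_on interior (ball 0 1)"
      using Qhol by (auto intro: holomorphic_on_subset)
    show "continuous_on (closure (ball 0 1)) Q"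
      using Qhol by (simp add: holomorphic_on_imp_continuous_on)
    fix z :: complex assume "z \<in> frontier (ball 0 1)"
    then have z: "norm z = 1" by simp
    have "norm (Q z) = (\<Prod>u\<in>U. norm (Gs (z * u)))" unfolding Q_def by (simp add: prod_norm)
    also have "\<dots> = (\<Prod>u\<in>U. norm (G0 (z * u)))"
      using U z by (intro prod.cong refl eq) (auto simp: norm_mult)
    finally show "norm (Q z) \<le> exp (real (card U) * M)" using bound[OF z] by simp
  qed auto
  moreover have "norm (Q 0) = norm (G 0) ^ card U"
    by (simp add: Q_def Gs_def norm_power)
  ultimately have "norm (G 0) ^ card U \<le> exp M ^ card U"
    by (simp add: exp_of_nat_mult)
  moreover have "card U > 0" using U by (simp add: card_gt_0_iff)
  ultimately have G0le: "norm (G 0) \<le> exp M"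
    by (meson exp_ge_zero power_mono_iff norm_ge_zero)
  have zero_in: "0 \<in> S" using S by auto
  \<comment> \<open>Jensen's sum of \<open>- ln (norm (a b))\<close> is weakened to the sum of
    \<open>1 - norm (a b)\<close>; in this form points \<open>a b = 0\<close> cause no
    trouble.\<close>
  have "1 = (\<Prod>b\<in>B. norm (a b) ^ m b) * norm (G 0)"
    using norm0 G0[of 0] zero_in by (simp add: norm_mult prod_norm[symmetric] norm_power)
  also have "\<dots> \<le> (\<Prod>b\<in>B. exp (- (m b * (1 - norm (a b))))) * exp M"
  proof (intro mult_mono prod_mono conjI G0le)
    fix b assume "b \<in> B"
    have "norm (a b) \<le> exp (- (1 - norm (a b)))"
      using exp_ge_add_one_self[of "norm (a b) - 1"] by simp
    then have "norm (a b) ^ m b \<le> exp (- (1 - norm (a b))) ^ m b" by (intro power_mono) auto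
    then show "norm (a b) ^ m b \<le> exp (- (m b * (1 - norm (a b))))"
      by (simp add: exp_of_nat_mult[symmetric] algebra_simps)
  qed (auto intro: prod_nonneg)
  also have "\<dots> = exp (M - (\<Sum>b\<in>B. m b * (1 - norm (a b))))"
    using B(1) by (simp add: exp_sum[symmetric] sum_negf exp_add[symmetric])
  finally show ?thesis by simp
qed

text \<open>A zero \<open>b\<close> of \<open>f\<close> pulls back to a zero of
  \<open>f \<circ> Psi\<close> at \<open>a b\<close> of at least the same order, so one chosen
  preimage per zero suffices. Holomorphy on a neighbourhood of the closed disc gives
  \<open>Psi\<close> genuine boundary values. The set \<open>U\<close> fixes the resolution at which
  the majorant is averaged.\<close>

lemma zeros_sum_le_of_subordination:
  fixes f Psi :: "complex \<Rightarrow> complex" and h :: "complex \<Rightarrow> real" and M :: real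
  assumes f: "f holomorphic_on ball 0 1" "norm (f 0) = 1"
    and S: "open S" "cball 0 1 \<subseteq> S" and Psi: "Psi holomorphic_on S" "Psi ` S \<subseteq> ball 0 1" "Psi 0 = 0"
    and B: "finite B" "B \<subseteq> ball 0 1" "\<And>b. b \<in> B \<Longrightarrow> norm (a b) < 1 \<and> Psi (a b) = b"
    and U: "finite U" "U \<noteq> {}" "U \<subseteq> sphere 0 1"
    and h: "\<And>w. norm w = 1 \<Longrightarrow> f (Psi w) \<noteq> 0 \<Longrightarrow> ln (norm (f (Psi w))) \<le> h w"
    and bound: "\<And>w. norm w = 1 \<Longrightarrow> (\<Sum>u\<in>U. h (w * u)) \<le> real (card U) * M"
  shows "(\<Sum>b\<in>B. of_int (zorder f b) * (1 - norm (a b))) \<le> M"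
proof -
  have nz: "\<exists>w\<in>ball 0 1. f w \<noteq> 0" using f(2) by (intro bexI[of _ 0]) auto
  obtain g where g: "g holomorphic_on ball 0 1"
    "\<And>z. z \<in> ball 0 1 \<Longrightarrow> f z = (\<Prod>b\<in>B. (z - b) ^ nat (zorder f b)) * g z"
    using holomorphic_factor_zeros[OF f(1) open_ball connected_ball nz B(1,2)] by blast
  \<comment> \<open>The divided difference of \<open>Psi\<close> at \<open>a b\<close>, completed by
    the derivative: as \<open>Psi (a b) = b\<close>, it is the cofactor of \<open>w - a b\<close> in
    \<open>Psi w - b\<close>.\<close>
  define k where "k b z = (if z = a b then deriv Psi (a b) else (Psi z - Psi (a b)) / (z - a b))" for b z
  have aS: "a b \<in> S" if "b \<in> B" for b using B(3)[OF that] S by auto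
  have k: "k b holomorphic_on S" if "b \<in> B" for b
    unfolding k_def using aS[OF that] S by (intro pole_lemma Psi(1)) (simp add: interior_open)
  have kf: "Psi z - b = (z - a b) * k b z" if "b \<in> B" for b z
    using B(3)[OF that] by (simp add: k_def)
  define G where "G w = (\<Prod>b\<in>B. k b w ^ nat (zorder f b)) * g (Psi w)" for w
  have gPsi: "(\<lambda>w. g (Psi w)) holomorphic_on S"
    using holomorphic_on_compose[OF Psi(1) holomorphic_on_subset[OF g(1) Psi(2)]] by (simp add: o_def)
  have zo: "zorder f b \<ge> 0" if "b \<in> B" for b
    using zorder_exist_zero[OF f(1) open_ball connected_ball _ nz, of b] that B(2)
    by (auto split: if_splits)
  have "(\<Sum>b\<in>B. real (nat (zorder f b)) * (1 - norm (a b))) \<le> M"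
  proof (rule jensen_inequality_discrete[OF S _ B(1) _ U])
    show "G holomorphic_on S" unfolding G_def
      by (intro holomorphic_on_mult gPsi holomorphic_on_prod holomorphic_on_power k)
    show "norm (a b) < 1" if "b \<in> B" for b using B that by auto
    show "f (Psi w) = (\<Prod>b\<in>B. (w - a b) ^ nat (zorder f b)) * G w" if "w \<in> S" for w
    proof -
      have "f (Psi w) = (\<Prod>b\<in>B. (Psi w - b) ^ nat (zorder f b)) * g (Psi w)"
        using g(2) Psi(2) that by blast
      also have "\<dots> = (\<Prod>b\<in>B. ((w - a b) * k b w) ^ nat (zorder f b)) * g (Psi w)"
        using kf by simp
      finally show ?thesis by (simp add: G_def power_mult_distrib prod.distrib)
    qed
    show "norm (f (Psi 0)) = 1" using f Psi by simp
    show "(\<Prod>u\<in>U. norm (f (Psi (w * u)))) \<le> exp (real (card U) * M)" if w: "norm w = 1" for w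
    proof (cases "\<exists>u\<in>U. f (Psi (w * u)) = 0")
      case True
      then have "(\<Prod>u\<in>U. norm (f (Psi (w * u)))) = 0" using U by auto
      then show ?thesis by simp
    next
      case False
      have "(\<Prod>u\<in>U. norm (f (Psi (w * u)))) \<le> (\<Prod>u\<in>U. exp (h (w * u)))"
      proof (intro prod_mono conjI)
        fix u assume u: "u \<in> U"
        then have "norm (w * u) = 1" using U w by (auto simp: norm_mult)
        then have "ln (norm (f (Psi (w * u)))) \<le> h (w * u)" using h False u by blast
        then show "norm (f (Psi (w * u))) \<le> exp (h (w * u))"
          using False u by (metis exp_le_cancel_iff exp_ln zero_less_norm_iff)
      qed auto
      also have "\<dots> = exp (\<Sum>u\<in>U. h (w * u))" using U by (simp add: exp_sum)
      finally show ?thesis using bound[OF w] by (meson exp_le_cancel_iff order_trans)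
    qed
  qed
  then show ?thesis using zo by simp
qed

section \<open>Sums over roots of unity\<close>

text \<open>The maximum principle asks for the mean bound at every point \<open>w\<close> of the
  circle, hence for grids with an arbitrary offset. Multiplication by a root of unity permutes the
  grid, so only the part \<open>t\<close> of the angle below one mesh width matters.\<close>

lemma sum_roots_unity_rotate:
  fixes w :: complex and N :: nat
  assumes N: "N > 0" and w: "norm w = 1"
  obtains t where "0 \<le> t" "t < 2 * pi / N"
    "\<And>g :: complex \<Rightarrow> real. (\<Sum>u\<in>{z. z ^ N = 1}. g (w * u)) = (\<Sum>j<N. g (cis (2 * pi * real j / real N + t)))"
proof -
  define \<phi> where "\<phi> = Arg2pi w"
  define m where "m = \<lfloor>\<phi> * N / (2 * pi)\<rfloor>"
  define t where "t = \<phi> - 2 * pi * m / N"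
  have \<phi>: "w = cis \<phi>" "0 \<le> \<phi>"
    using w Arg2pi[of w] by (auto simp: is_Arg_def \<phi>_def cis_conv_exp)
  have m1: "of_int m \<le> \<phi> * N / (2 * pi)" "\<phi> * N / (2 * pi) < of_int m + 1" unfolding m_def by linarith+
  have t0: "0 \<le> t" using m1(1) N by (simp add: t_def field_simps)
  have t1: "t < 2 * pi / N" 
  proof -
    have "\<phi> < (of_int m + 1) * (2 * pi) / N" using m1(2) N by (simp add: field_simps)
    also have "\<dots> = 2 * pi * m / N + 2 * pi / N" by (simp add: add_divide_distrib distrib_right)
    finally show ?thesis by (simp add: t_def)
  qed
  define v where "v = cis (2 * pi * m / N)"
  have "\<phi> = 2 * pi * m / N + t" by (simp add: t_def)
  then have wv: "w = v * cis t" using \<phi>(1) by (simp add: v_def cis_mult)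
  have vN: "v ^ N = 1"
  proof -
    have "v ^ N = cis (N * (2 * pi * m / N))" unfolding v_def by (rule Complex.DeMoivre)
    also have "N * (2 * pi * m / N) = 2 * pi * m" using N by simp
    finally show ?thesis by (simp add: complex_eq_iff sin_int_2pin cos_int_2pin)
  qed
  then have v0: "v \<noteq> 0" using N by (auto simp: power_0_left)
  have bij: "bij_betw (\<lambda>u. v * u) {z. z ^ N = 1} {z. z ^ N = 1}"
    by (rule bij_betwI[of _ _ _ "\<lambda>u. u / v"]) (use v0 vN in \<open>auto simp: power_mult_distrib power_divide\<close>)
  have "(\<Sum>u\<in>{z. z ^ N = 1}. g (w * u)) = (\<Sum>j<N. g (cis (2 * pi * real j / real N + t)))" for g :: "complex \<Rightarrow> real"
  proof -
    have "(\<Sum>u\<in>{z. z ^ N = 1}. g (w * u)) = (\<Sum>u\<in>{z. z ^ N = 1}. g (cis t * (v * u)))"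
      unfolding wv by (simp only: mult.assoc mult.left_commute)
    also have "\<dots> = (\<Sum>u\<in>{z. z ^ N = 1}. g (cis t * u))"
      by (rule sum.reindex_bij_betw[OF bij])
    also have "\<dots> = (\<Sum>j<N. g (cis t * cis (2 * pi * j / N)))"
      by (rule sum.reindex_bij_betw[OF Complex.bij_betw_roots_unity[OF N], symmetric])
    finally show ?thesis by (simp add: cis_mult add.commute)
  qed
  with t0 t1 show ?thesis by (rule that)
qed

lemma norm_cis_minus_one: "norm (cis x - 1) = 2 * \<bar>sin (x / 2)\<bar>"
proof -
  have "norm (cis x - 1) ^ 2 = (cos x - 1) ^ 2 + sin x ^ 2"
    by (simp add: cmod_power2)
  also have "\<dots> = 2 - 2 * cos x"
    using sin_cos_squared_add[of x] by (simp add: power2_eq_square algebra_simps)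
  also have "\<dots> = (2 * \<bar>sin (x / 2)\<bar>) ^ 2"
    using cos_double_sin[of "x / 2"] by (simp add: power_mult_distrib)
  finally show ?thesis by (rule power2_eq_imp_eq) auto
qed

lemma sin_ge_two_over_pi:
  assumes "0 \<le> x" "x \<le> pi / 2"
  shows "2 * x / pi \<le> sin x"
proof -
  have "concave_on {0..pi} sin"
    unfolding concave_on_def
    by (rule f''_ge0_imp_convex[where f' = "\<lambda>x. - cos x" and f'' = sin])
       (auto intro!: derivative_eq_intros sin_ge_zero)
  then have "sin ((1 - 2 * x / pi) *\<^sub>R 0 + (2 * x / pi) *\<^sub>R (pi / 2))
      \<ge> (1 - 2 * x / pi) * sin 0 + (2 * x / pi) * sin (pi / 2)"
    using assms by (intro concave_onD) (auto simp: field_simps)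
  then show ?thesis by simp
qed

text \<open>A discrete form of the logarithmic growth of the integral of 1 / |u - w| over the
  circle. Grid points are about 1 / N apart and the radius 1 + 1 / N keeps each at least 1 / N from
  the closed disc, so the two sides of the direction of \<open>w\<close> contribute one harmonic sum
  each.\<close>

lemma roots_unity_dist_sum:
  fixes w :: complex and N :: nat
  assumes N: "N > 0" and w: "norm w \<le> 1"
  shows "(\<Sum>u\<in>{z. z ^ N = 1}. 1 / norm ((1 + 1 / of_nat N) * u - w)) \<le> N * (2 * (1 + ln N))"
proof -
  obtain v where v: "norm v = 1" "w = complex_of_real (norm w) * v"
  proof (cases "w = 0")
    case True then show ?thesis using that[of 1] by simp
  next
    case False then show ?thesis using that[of "w / complex_of_real (norm w)"] by (simp add: norm_divide)
  qed
  define T :: real where "T = 1 + 1 / N"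
  define k :: "complex \<Rightarrow> real" where "k z = 1 / max (1 / N) (norm (z - 1) / 2)" for z
  have U1: "norm u = 1" if "u ^ N = 1" for u :: complex
    using power_eq_1_iff[OF that] N by simp
  \<comment> \<open>The path from \<open>u\<close> radially to \<open>T * u\<close>, on to
    \<open>w\<close> and radially to \<open>v\<close> has length
    \<open>1 / N + norm (T * u - w) + (1 - norm w)\<close>. The two radial pieces together do not
    exceed the middle one, which explains the 2 in \<open>k\<close>.\<close>
  have pt: "1 / norm (T * u - w) \<le> k (cnj v * u)" if u: "u ^ N = 1" for u :: complex
  proof -
    have nu: "norm u = 1" by (rule U1[OF u])
    have T0: "T \<ge> 0" by (simp add: T_def)
    have "T - norm w \<le> norm (T * u - w)"
      using norm_triangle_ineq2[of "T * u" w] nu T0 by (simp add: norm_mult)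
    then have 1: "1 / N + (1 - norm w) \<le> norm (T * u - w)" by (simp add: T_def)
    have "u - v = (u - T * u) + (T * u - w) + (w - v)" by simp
    then have "norm (u - v) \<le> norm (u - T * u) + norm (T * u - w) + norm (w - v)"
      by (metis add_mono_thms_linordered_semiring(3) norm_triangle_ineq order_trans)
    moreover have "norm (u - T * u) = 1 / N"
    proof -
      have "u - T * u = - (of_real (1 / N) * u)" by (simp add: T_def algebra_simps)
      then show ?thesis using nu by (simp add: norm_mult norm_divide)
    qed
    moreover have "norm (w - v) = 1 - norm w"
    proof -
      have "w - v = - (of_real (1 - norm w) * v)" using v(2) by (simp add: algebra_simps)
      then show ?thesis using v(1) w by (simp only: norm_minus_cancel norm_mult norm_of_real) simp
    qed
    ultimately have "norm (u - v) / 2 \<le> norm (T * u - w)" using 1 by simp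
    moreover have "norm (u - v) = norm (cnj v * u - 1)"
    proof -
      have "cnj v * v = 1" using v(1) by (metis complex_norm_square mult.commute of_real_1 one_power2)
      then have "cnj v * u - 1 = cnj v * (u - v)" by (simp add: algebra_simps)
      then show ?thesis using v(1) by (simp add: norm_mult)
    qed
    ultimately have "max (1 / N) (norm (cnj v * u - 1) / 2) \<le> norm (T * u - w)"
      using 1 w by simp
    moreover have "0 < max (1 / N) (norm (cnj v * u - 1) / 2)" using N by (simp add: less_max_iff_disj)
    ultimately show ?thesis unfolding k_def by (intro divide_left_mono mult_pos_pos) auto
  qed
  obtain t where t: "0 \<le> t" "t < 2 * pi / N"
    "\<And>g :: complex \<Rightarrow> real. (\<Sum>u\<in>{z. z ^ N = 1}. g (cnj v * u)) = (\<Sum>j<N. g (cis (2 * pi * real j / real N + t)))"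
    using sum_roots_unity_rotate[OF N, of "cnj v"] v(1) by auto
  have kj: "k (cis (2 * pi * j / N + t)) \<le> N * (1 / (j + 1) + 1 / (real N - j))" if j: "j < N" for j
  proof -
    define y where "y = (2 * pi * j / N + t) / 2"
    have y: "pi * j / N \<le> y" "y < pi * (j + 1) / N" using t N by (auto simp: y_def field_simps)
    have "pi * (real j + 1) \<le> pi * N" using j by (intro mult_left_mono) auto
    then have jN: "pi * (real j + 1) / N \<le> pi" using N by (simp add: pos_divide_le_eq)
    have y0: "0 \<le> y" "y \<le> pi" 
    proof -
      show "0 \<le> y" using t(1) by (simp add: y_def)
      show "y \<le> pi" using y(2) jN by (simp add: add.commute)
    qed
    have "norm (cis (2 * pi * j / N + t) - 1) / 2 = sin y"
      using y0 sin_ge_zero[of y] by (simp add: norm_cis_minus_one y_def)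
    then have k: "k (cis (2 * pi * j / N + t)) = 1 / max (1 / N) (sin y)" by (simp add: k_def)
    \<comment> \<open>Which bound applies depends on the half circle containing the point. The
      truncation at 1 / N covers the off-by-one at both ends: \<open>j = 0\<close> on one side and
      \<open>j + 1 = N\<close> on the other.\<close>
    have "1 / max (1 / N) (sin y) \<le> N / (j + 1) \<or> 1 / max (1 / N) (sin y) \<le> N / (real N - j)"
    proof (cases "y \<le> pi / 2")
      case True
      have "2 * j / N \<le> 2 * y / pi" using y(1) N by (simp add: field_simps)
      also have "\<dots> \<le> sin y" using sin_ge_two_over_pi y0 True by blast
      finally have "max (1 / N) (sin y) \<ge> (j + 1) / N"
        using N by (cases "j = 0") (auto simp: le_max_iff_disj field_simps)
      then have "1 / max (1 / N) (sin y) \<le> 1 / ((j + 1) / N)"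
        using N by (intro divide_left_mono) (auto simp: less_max_iff_disj)
      then show ?thesis by simp
    next
      case False
      have "2 * (real N - (j + 1)) / N \<le> 2 * (pi - y) / pi" using y(2) N by (simp add: field_simps)
      also have "\<dots> \<le> sin (pi - y)" using sin_ge_two_over_pi[of "pi - y"] y0 False by simp
      finally have s: "2 * (real N - (j + 1)) / N \<le> sin y" by simp
      have "max (1 / N) (sin y) \<ge> (real N - j) / N"
      proof (cases "j + 1 = N")
        case True then have "real N - j = 1" by auto
        then show ?thesis by simp
      next
        case False
        then have "real (j + 2) \<le> real N" using j by (intro of_nat_mono) linarith
        then have "(real N - j) / N \<le> 2 * (real N - (j + 1)) / N"
          using N by (intro divide_right_mono) auto
        then show ?thesis using s by linarith
      qed
      then have "1 / max (1 / N) (sin y) \<le> 1 / ((real N - j) / N)"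
        using N j by (intro divide_left_mono) (auto simp: less_max_iff_disj)
      then show ?thesis by simp
    qed
    moreover have "N / (j + 1) \<ge> 0" "N / (real N - j) \<ge> 0" using j by auto
    ultimately have "1 / max (1 / N) (sin y) \<le> N / (j + 1) + N / (real N - j)" by linarith
    then show ?thesis unfolding k by (simp add: distrib_left add.commute)
  qed
  have h1: "(\<Sum>j<N. 1 / (real j + 1)) = harm N"
    unfolding harm_def by (rule sum.reindex_bij_witness[of _ "\<lambda>j. j - 1" Suc]) (auto simp: field_simps)
  have h2: "(\<Sum>j<N. 1 / (real N - j)) = harm N"
    unfolding harm_def
    by (rule sum.reindex_bij_witness[of _ "\<lambda>j. N - j" "\<lambda>j. N - j"]) (auto simp: of_nat_diff field_simps)
  have "(\<Sum>u\<in>{z. z ^ N = 1}. 1 / norm ((1 + 1 / of_nat N) * u - w)) \<le> (\<Sum>u\<in>{z. z ^ N = 1}. k (cnj v * u))"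
    using pt by (intro sum_mono) (auto simp: T_def)
  also have "\<dots> = (\<Sum>j<N. k (cis (2 * pi * j / N + t)))" by (rule t(3))
  also have "\<dots> \<le> (\<Sum>j<N. N * (1 / (j + 1) + 1 / (real N - j)))"
    using kj by (intro sum_mono) (auto simp: add.commute)
  also have "\<dots> = N * ((\<Sum>j<N. 1 / (real j + 1)) + (\<Sum>j<N. 1 / (real N - j)))"
    by (simp only: sum_distrib_left[symmetric] sum.distrib of_nat_add of_nat_1)
  also have "\<dots> = N * (harm N + harm N)" by (simp only: h1 h2)
  also have "\<dots> \<le> N * (2 * (1 + ln N))"
    using euler_mascheroni_sequence_decreasing[of 1 N] N by (intro mult_left_mono) (auto simp: harm_def)
  finally show ?thesis .
qed

lemma root_unity_near:
  fixes w :: complex and N :: nat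
  assumes N: "N > 0" and w: "norm w = 1"
  obtains u where "u ^ N = 1" "norm (w - u) \<le> 2 * pi / N"
proof -
  obtain t where t: "0 \<le> t" "t < 2 * pi / N"
    "\<And>g :: complex \<Rightarrow> real. (\<Sum>u\<in>{z. z ^ N = 1}. g (cnj w * u)) = (\<Sum>j<N. g (cis (2 * pi * real j / real N + t)))"
    using sum_roots_unity_rotate[OF N, of "cnj w"] w by auto
  have fin: "finite {z::complex. z ^ N = 1}" using N by (intro finite_roots_unity) auto
  \<comment> \<open>An indicator function turns the identity of sums into existence: the term
    \<open>j = 0\<close> on the right is 1, so some term on the left is not 0.\<close>
  define g :: "complex \<Rightarrow> real" where "g z = (if norm (z - 1) \<le> 2 * pi / N then 1 else 0)" for z
  have "g (cis t) = 1"
  proof -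
    have "norm (cis t - 1) = 2 * \<bar>sin (t / 2)\<bar>" by (rule norm_cis_minus_one)
    also have "\<dots> \<le> 2 * (t / 2)" using abs_sin_x_le_abs_x[of "t/2"] t by simp
    finally show ?thesis using t by (simp add: g_def)
  qed
  then have "0 < (\<Sum>j<N. g (cis (2 * pi * real j / real N + t)))"
    using N by (intro sum_pos2[of _ 0]) (auto simp: g_def)
  then have "0 < (\<Sum>u\<in>{z. z ^ N = 1}. g (cnj w * u))" using t(3) by simp
  then obtain u where u: "u ^ N = 1" "g (cnj w * u) \<noteq> 0"
    by (metis (mono_tags, lifting) less_irrefl mem_Collect_eq sum.neutral)
  have "norm (w - u) = norm (cnj w * u - 1)"
  proof -
    have "cnj w * w = 1" using w by (metis complex_norm_square mult.commute of_real_1 one_power2)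
    then have "cnj w * u - 1 = cnj w * (u - w)" by (simp add: algebra_simps)
    then show ?thesis using w by (simp add: norm_mult norm_minus_commute)
  qed
  then show ?thesis using that u by (auto simp: g_def split: if_splits)
qed

section \<open>Pushing the disc away from a boundary set\<close>

lemma Re_cayley: "Re ((a + w) / (a - w)) = ((norm a)\<^sup>2 - (norm w)\<^sup>2) / (norm (a - w))\<^sup>2"
  unfolding Re_divide cmod_power2 by (simp add: power2_eq_square algebra_simps)

lemma norm_exp_diff_le:
  fixes x y :: complex
  assumes "norm x \<le> 1/8" "norm y \<le> 1/8"
  shows "norm (exp x - exp y) \<le> 3 * norm (x - y)"
proof -
  have "norm (x - y) \<le> 1/2" using norm_triangle_ineq4[of x y] assms by simp
  then have 1: "norm (exp (x - y) - 1) \<le> 3 / 2 * norm (x - y)" by (rule norm_exp_bounds)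
  have "norm (exp y) \<le> exp (1/8)" using assms(2) norm_exp[of y] by (meson exp_le_cancel_iff order_trans)
  also have "\<dots> \<le> 2" using exp_bound_half[of "1/8::real"] by simp
  finally have 2: "norm (exp y) \<le> 2" .
  have "exp x - exp y = exp y * (exp (x - y) - 1)" by (simp add: exp_diff algebra_simps)
  then have "norm (exp x - exp y) \<le> 2 * (3 / 2 * norm (x - y))"
    using 1 2 by (simp only: norm_mult) (intro mult_mono, auto)
  then show ?thesis by simp
qed

lemma infdist_triangle_norm: "infdist x F \<le> infdist y F + norm (x - y)"
  using infdist_triangle[of x F y] by (simp add: dist_norm)

text \<open>The map \<open>w exp (- \<kappa> H w)\<close>, with \<open>H\<close> a sum of Herglotz kernels of atoms placed just outside the
  \<open>\<delta>\<close>-neighbourhood of \<open>F\<close>, pushes that neighbourhood into the disc by about \<open>\<delta>\<close>.  The conjugate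
  of the Poisson sum grows logarithmically in \<open>N\<close>, hence the loss of the factor \<open>1 + ln N\<close>.\<close>

lemma push_away_map:
  fixes F :: "complex set" and \<delta> :: real and N :: nat
  assumes F: "F \<noteq> {}" "F \<subseteq> sphere 0 1" and \<delta>: "0 < \<delta>" "\<delta> \<le> 1" and N: "16 / \<delta> \<le> N"
  obtains \<psi> S where "open S" "cball 0 1 \<subseteq> S" "\<psi> holomorphic_on S" "\<psi> ` S \<subseteq> ball 0 1" "\<psi> 0 = 0"
    "\<And>w. norm w = 1 \<Longrightarrow> infdist w F < \<delta> / 2 \<Longrightarrow> norm (\<psi> w) \<le> 1 - \<delta> / (3072 * (1 + ln N))"
    "\<And>w. norm w = 1 \<Longrightarrow> norm (\<psi> w - w) \<le> \<delta> / 4"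
    "\<And>v. norm v < 1 \<Longrightarrow> 1 / N \<le> 1 - norm v \<Longrightarrow> 7 * \<delta> \<le> infdist v F \<Longrightarrow>
      \<exists>w. norm w < 1 \<and> \<psi> w = v \<and> (1 - norm v) / 2 \<le> 1 - norm w"
proof -
  have "16 \<le> 16 / \<delta>" using \<delta> by (simp add: le_divide_eq)
  then have N16: "16 \<le> N" using N by linarith
  then have N0: "N > 0" by simp
  have N\<delta>: "16 / N \<le> \<delta>" using N N0 \<delta> by (simp add: field_simps)
  define L where "L = 2 * (1 + ln N)"
  have L: "L \<ge> 2" using N0 by (simp add: L_def)
  \<comment> \<open>The factor 24 serves three estimates:
    \<open>norm (\<kappa> * H w) \<le> \<delta> / 8\<close> on the closed disc,
    \<open>\<kappa> * Re (H w) \<le> \<eta> / 8\<close> at height about \<eta> far from F, and the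
    Lipschitz constant 1/12 of \<open>\<kappa> * H\<close> there.\<close>
  define \<kappa> where "\<kappa> = \<delta> / (24 * L)"
  have \<kappa>: "\<kappa> > 0" using \<delta> L by (simp add: \<kappa>_def)
  \<comment> \<open>Atoms at height 1 / N outside the disc make \<open>H\<close> holomorphic across
    the circle, while this height is still of the order of their spacing, so no gaps open between
    them.\<close>
  define T :: real where "T = 1 + 1 / N"
  have T: "1 < T" "T \<le> 2" using N0 by (auto simp: T_def)
  define A where "A = {u::complex. u ^ N = 1 \<and> infdist u F < \<delta>}"
  define H where "H w = (1 / of_nat N) * (\<Sum>u\<in>A. (of_real T * u + w) / (of_real T * u - w))" for w :: complex
  define \<psi> where "\<psi> w = w * exp (- \<kappa> * H w)" for w
  have finU: "finite {z::complex. z ^ N = 1}" using N0 by (intro finite_roots_unity) auto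
  have finA: "finite A" by (rule finite_subset[OF _ finU]) (auto simp: A_def)
  have A1: "norm u = 1" if "u \<in> A" for u using that power_eq_1_iff[of u N] N0 by (auto simp: A_def)
  have nTu: "norm (of_real T * u) = T" if "u \<in> A" for u using A1[OF that] T by (simp add: norm_mult)
  have pi7: "2 * pi / N \<le> 7 / N" using pi_less_4 pi_approx by (intro divide_right_mono) auto
  have "7 / N \<le> 8 / N" by (intro divide_right_mono) auto
  then have pi2: "2 * pi / N \<le> \<delta> / 2" using pi7 N\<delta> by linarith
  have nz: "of_real T * u - w \<noteq> 0" if "u \<in> A" "norm w < T" for u w
    using nTu[OF that(1)] that(2) by auto
  have nearA: "u \<in> A" if "u ^ N = 1" "norm (w - u) \<le> 2 * pi / N" "infdist w F < \<delta> / 2" for u w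
  proof -
    have "infdist u F \<le> infdist w F + norm (u - w)" by (rule infdist_triangle_norm)
    also have "\<dots> < \<delta> / 2 + \<delta> / 2" using that(2,3) pi2 norm_minus_commute[of u w] by linarith
    finally show ?thesis using that by (simp add: A_def)
  qed
  \<comment> \<open>With at least one atom, \<open>Re (H w)\<close> is strictly positive; this is
    what sends the closed disc into the open one.\<close>
  have Ane: "A \<noteq> {}"
  proof -
    obtain x where x: "x \<in> F" using F by auto
    then have "norm x = 1" using F by auto
    then obtain u where "u ^ N = 1" "norm (x - u) \<le> 2 * pi / N" using root_unity_near[OF N0] by blast
    then have "u \<in> A" using x \<delta> by (intro nearA[of u x]) auto
    then show ?thesis by auto
  qed
  have Lsum: "(\<Sum>u\<in>A. 1 / norm (of_real T * u - w)) \<le> N * L" if "norm w \<le> 1" for w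
  proof -
    have "(\<Sum>u\<in>A. 1 / norm (of_real T * u - w)) \<le> (\<Sum>u\<in>{z. z ^ N = 1}. 1 / norm (of_real T * u - w))"
      using finU by (intro sum_mono2) (auto simp: A_def)
    also have "\<dots> \<le> N * L"
      using roots_unity_dist_sum[OF N0 that] by (simp add: T_def L_def)
    finally show ?thesis .
  qed
  have ReH: "Re (H w) = (1 / N) * (\<Sum>u\<in>A. (T\<^sup>2 - (norm w)\<^sup>2) / (norm (of_real T * u - w))\<^sup>2)" for w
  proof -
    have "H w = of_real (1 / N) * (\<Sum>u\<in>A. (of_real T * u + w) / (of_real T * u - w))" by (simp add: H_def)
    then have "Re (H w) = (1 / N) * (\<Sum>u\<in>A. Re ((of_real T * u + w) / (of_real T * u - w)))"
      by (simp only: Re_complex_of_real Im_complex_of_real times_complex.sel Re_sum)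
    also have "(\<Sum>u\<in>A. Re ((of_real T * u + w) / (of_real T * u - w))) = (\<Sum>u\<in>A. (T\<^sup>2 - (norm w)\<^sup>2) / (norm (of_real T * u - w))\<^sup>2)"
      by (intro sum.cong refl) (simp add: Re_cayley nTu)
    finally show ?thesis .
  qed
  have ReH_pos: "Re (H w) > 0" if "norm w \<le> 1" for w
  proof -
    have "norm w < T" using that T by simp
    then have "(norm w)\<^sup>2 < T\<^sup>2" by (intro power_strict_mono) auto
    then have "(\<Sum>u\<in>A. (T\<^sup>2 - (norm w)\<^sup>2) / (norm (of_real T * u - w))\<^sup>2) > 0"
      using nz[OF _ \<open>norm w < T\<close>] by (intro sum_pos finA Ane) auto
    then show ?thesis using N0 by (simp add: ReH)
  qed
  have normH: "norm (H w) \<le> 3 * L" if "norm w \<le> 1" for w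
  proof -
    have "norm (H w) \<le> (1 / N) * (\<Sum>u\<in>A. norm ((of_real T * u + w) / (of_real T * u - w)))"
      unfolding H_def norm_mult[of "1 / of_nat N"] by (intro mult_mono norm_sum) (auto simp: norm_divide)
    also have "\<dots> \<le> (1 / N) * (\<Sum>u\<in>A. 3 * (1 / norm (of_real T * u - w)))"
    proof (intro mult_left_mono sum_mono)
      fix u assume u: "u \<in> A"
      have "norm (of_real T * u + w) \<le> 3" using norm_triangle_ineq[of "of_real T * u" w] nTu[OF u] T that by simp
      then show "norm ((of_real T * u + w) / (of_real T * u - w)) \<le> 3 * (1 / norm (of_real T * u - w))"
        by (simp add: norm_divide divide_right_mono)
    qed auto
    also have "\<dots> \<le> (1 / N) * (3 * (N * L))"
      unfolding sum_distrib_left[symmetric] using Lsum[OF that] by (intro mult_left_mono) auto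
    finally show ?thesis using N0 by simp
  qed
  have \<kappa>H: "norm (\<kappa> * H w) \<le> \<delta> / 8" if "norm w \<le> 1" for w
  proof -
    have "norm (\<kappa> * H w) \<le> \<kappa> * (3 * L)" using normH[OF that] \<kappa> by (simp add: norm_mult)
    also have "\<dots> = \<delta> / 8" using L by (simp add: \<kappa>_def field_simps)
    finally show ?thesis .
  qed
  have norm\<psi>: "norm (\<psi> w) = norm w * exp (- \<kappa> * Re (H w))" for w
    by (simp add: \<psi>_def norm_mult norm_exp_eq_Re)
  have Hhol: "H holomorphic_on ball 0 T"
    unfolding H_def using nz by (intro holomorphic_intros) auto
  then have \<psi>hol: "\<psi> holomorphic_on ball 0 T" unfolding \<psi>_def by (intro holomorphic_intros)
  \<comment> \<open>Because \<psi> maps the closed disc into the open disc, the preimage of the open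
    disc is an admissible neighbourhood of the closed disc.\<close>
  define S where "S = ball 0 T \<inter> \<psi> -` ball 0 1"
  have S: "open S" unfolding S_def
    by (intro continuous_open_preimage holomorphic_on_imp_continuous_on[OF \<psi>hol]) auto
  have \<psi>lt: "norm (\<psi> w) < 1" if "norm w \<le> 1" for w
  proof -
    have "exp (- \<kappa> * Re (H w)) < 1" using ReH_pos[OF that] \<kappa> by simp
    then have "norm w * exp (- \<kappa> * Re (H w)) \<le> 1 * exp (- \<kappa> * Re (H w))"
      using that by (intro mult_right_mono) auto
    then show ?thesis using \<open>exp (- \<kappa> * Re (H w)) < 1\<close> unfolding norm\<psi> by linarith
  qed
  have P1: "norm (\<psi> w) \<le> 1 - \<delta> / (3072 * (1 + ln N))" if w: "norm w = 1" "infdist w F < \<delta> / 2" for w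
  proof -
    obtain u where u: "u ^ N = 1" "norm (w - u) \<le> 2 * pi / N" using root_unity_near[OF N0 w(1)] by blast
    have uA: "u \<in> A" by (rule nearA[OF u w(2)])
    have "of_real T * u - w = of_real (1 / N) * u - (w - u)" by (simp add: T_def algebra_simps)
    then have "norm (of_real T * u - w) \<le> norm (of_real (1 / N) * u) + norm (w - u)"
      by (metis norm_triangle_ineq4)
    also have "\<dots> \<le> 1 / N + 7 / N"
      using u pi7 A1[OF uA] by (intro add_mono) (auto simp: norm_mult norm_divide)
    finally have d: "norm (of_real T * u - w) \<le> 8 / N" by (simp add: add_divide_distrib[symmetric])
    have "T\<^sup>2 - 1 \<ge> 2 / N" by (simp add: T_def power2_eq_square algebra_simps)
    \<comment> \<open>The single atom within 8 / N of \<open>w\<close> already yields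
      \<open>Re (H w) \<ge> 1 / 32\<close>. The resulting factor
      \<open>exp (- \<kappa> / 32)\<close> is at most \<open>1 - \<kappa> / 64\<close>, and
      inserting \<kappa> produces 3072 = 64 * 24 * 2.\<close>
    have "N / 32 = (2 / N) / (8 / N)\<^sup>2" using N0 by (simp add: power2_eq_square)
    also have "\<dots> \<le> (T\<^sup>2 - (norm w)\<^sup>2) / (norm (of_real T * u - w))\<^sup>2"
      using d w \<open>T\<^sup>2 - 1 \<ge> 2 / N\<close> nz[OF uA, of w] T N0
      by (intro frac_le power_mono) auto
    also have "\<dots> \<le> (\<Sum>u\<in>A. (T\<^sup>2 - (norm w)\<^sup>2) / (norm (of_real T * u - w))\<^sup>2)"
      using w T uA by (intro member_le_sum finA) (auto simp: abs_square_le_1 one_le_power)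
    finally have "Re (H w) \<ge> 1 / 32" using N0 by (simp add: ReH field_simps)
    then have "- \<kappa> * Re (H w) \<le> - \<kappa> * (1 / 32)" using \<kappa> by (intro mult_left_mono_neg) auto
    then have "norm (\<psi> w) \<le> exp (- \<kappa> * (1 / 32))" using w by (simp add: norm\<psi>)
    also have "\<dots> = 1 / exp (\<kappa> / 32)" by (simp add: exp_minus inverse_eq_divide)
    also have "\<dots> \<le> 1 / (1 + \<kappa> / 32)" using \<kappa> by (intro divide_left_mono exp_ge_add_one_self) auto
    also have "\<dots> \<le> 1 - \<kappa> / 64"
    proof -
      have "\<kappa> \<le> 1"
      proof -
        have "\<kappa> \<le> 1 / 48" unfolding \<kappa>_def using \<delta> L by (intro frac_le) auto
        then show ?thesis by simp
      qed
      then have "\<kappa> * \<kappa> \<le> \<kappa> * 1" using \<kappa> by (intro mult_left_mono) auto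
      then have "1 \<le> (1 - \<kappa> / 64) * (1 + \<kappa> / 32)" using \<kappa> by (simp add: algebra_simps)
      then show ?thesis using \<kappa> by (simp add: pos_divide_le_eq)
    qed
    also have "\<kappa> / 64 = \<delta> / (3072 * (1 + ln N))" by (simp add: \<kappa>_def L_def)
    finally show ?thesis .
  qed
  have P2: "norm (\<psi> w - w) \<le> \<delta> / 4" if w: "norm w = 1" for w
  proof -
    have k: "norm (- \<kappa> * H w) \<le> \<delta> / 8" using \<kappa>H[of w] w by (simp add: norm_mult)
    then have "norm (- \<kappa> * H w) \<le> 1 / 2" using \<delta> by linarith
    then have "norm (exp (- \<kappa> * H w) - 1) \<le> 3 / 2 * norm (- \<kappa> * H w)" by (rule norm_exp_bounds)
    then have "norm (exp (- \<kappa> * H w) - 1) \<le> \<delta> / 4" using k \<delta> by linarith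
    moreover have "\<psi> w - w = w * (exp (- \<kappa> * H w) - 1)" by (simp add: \<psi>_def algebra_simps)
    ultimately show ?thesis using w by (simp only: norm_mult mult_1)
  qed
  have P3: "\<exists>w. norm w < 1 \<and> \<psi> w = v \<and> (1 - norm v) / 2 \<le> 1 - norm w"
    if v: "norm v < 1" "1 / N \<le> 1 - norm v" "7 * \<delta> \<le> infdist v F" for v
  proof -
    \<comment> \<open>A fixed point of \<Phi> solves \<open>\<psi> w = v\<close>. The region
      \<open>R\<close> below keeps \<open>w\<close> within \<delta> of \<open>v\<close>, hence away
      from the atoms, and lets the height drop at most to one half; there \<Phi> is a
      contraction.\<close>
    define \<Phi> where "\<Phi> w = v * exp (\<kappa> * H w)" for w
    define \<eta> where "\<eta> = 1 - norm v"
    have \<eta>: "\<eta> > 0" "1 / N \<le> \<eta>" "\<eta> \<le> 1" using v by (auto simp: \<eta>_def)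
    define R where "R = {w. norm (w - v) \<le> \<delta> \<and> norm v \<le> norm w \<and> norm w \<le> 1 - \<eta> / 2}"
    have R: "norm w \<le> 1" "norm w < 1" if "w \<in> R" for w using that \<eta> by (auto simp: R_def)
    have far: "2 * \<delta> \<le> norm (of_real T * u - w)" if "u \<in> A" "w \<in> R" for u w
    proof -
      have "infdist v F \<le> infdist u F + norm (v - u)" by (rule infdist_triangle_norm)
      then have 6: "6 * \<delta> \<le> norm (v - u)" using that v by (simp add: A_def)
      have "v - u = (v - w) + ((w - of_real T * u) + of_real (1 / N) * u)" by (simp add: T_def algebra_simps)
      then have "norm (v - u) \<le> norm (v - w) + (norm (w - of_real T * u) + norm (of_real (1 / N) * u))"
        by (metis add_left_mono norm_triangle_ineq order_trans)
      also have "norm (of_real (1 / N) * u) = 1 / N" using A1[OF that(1)] by (simp add: norm_mult norm_divide)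
      also have "1 / N \<le> \<delta>" using N\<delta> N0 by (smt (verit) divide_right_mono of_nat_0_le_iff)
      also have "norm (v - w) \<le> \<delta>" using that by (simp add: R_def norm_minus_commute)
      finally show ?thesis using 6 \<delta> by (simp add: norm_minus_commute)
    qed
    have nzR: "of_real T * u - w \<noteq> 0" if "u \<in> A" "w \<in> R" for u w using far[OF that] \<delta> by auto
    \<comment> \<open>One factor of the squared denominator is bounded below by
      \<open>2 * \<delta>\<close>, and the other is summed logarithmically. The numerator supplies
      \<eta>, so the radial shift is a fraction of the height and not merely of \<delta>.\<close>
    have up: "\<kappa> * Re (H w) \<le> \<eta> / 8" if w: "w \<in> R" for w
    proof -
      have "T\<^sup>2 - (norm w)\<^sup>2 = (T - norm w) * (T + norm w)" by (simp add: power2_eq_square algebra_simps)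
      also have "\<dots> \<le> (2 * \<eta>) * 3"
      proof (intro mult_mono)
        show "T - norm w \<le> 2 * \<eta>" using w \<eta>(2) by (auto simp: R_def \<eta>_def T_def)
      qed (use R[OF w] T \<eta>(1) in auto)
      finally have TT: "T\<^sup>2 - (norm w)\<^sup>2 \<le> 6 * \<eta>" by simp
      have "(\<Sum>u\<in>A. (T\<^sup>2 - (norm w)\<^sup>2) / (norm (of_real T * u - w))\<^sup>2)
          \<le> (\<Sum>u\<in>A. (3 * \<eta> / \<delta>) * (1 / norm (of_real T * u - w)))"
      proof (intro sum_mono)
        fix u assume u: "u \<in> A"
        have n0: "norm (of_real T * u - w) > 0" using nzR[OF u w] by simp
        have "(T\<^sup>2 - (norm w)\<^sup>2) / (norm (of_real T * u - w))\<^sup>2 \<le> (6 * \<eta>) / (2 * \<delta> * norm (of_real T * u - w))"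
          using TT far[OF u w] \<delta> \<eta> n0 by (intro frac_le) (auto simp: power2_eq_square)
        then show "(T\<^sup>2 - (norm w)\<^sup>2) / (norm (of_real T * u - w))\<^sup>2 \<le> (3 * \<eta> / \<delta>) * (1 / norm (of_real T * u - w))" by simp
      qed
      also have "\<dots> \<le> (3 * \<eta> / \<delta>) * (N * L)"
        unfolding sum_distrib_left[symmetric] using Lsum[OF R(1)[OF w]] \<eta> \<delta> by (intro mult_left_mono) auto
      finally have "Re (H w) \<le> (1 / N) * ((3 * \<eta> / \<delta>) * (N * L))"
        unfolding ReH by (intro mult_left_mono) auto
      then have "\<kappa> * Re (H w) \<le> \<kappa> * ((1 / N) * ((3 * \<eta> / \<delta>) * (N * L)))"
        using \<kappa> by (intro mult_left_mono) auto
      also have "\<dots> = \<eta> / 8" using N0 L \<delta> by (simp add: \<kappa>_def field_simps)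
      finally show ?thesis .
    qed
    have ex: "\<exists>!w\<in>R. \<Phi> w = w"
    proof (rule Banach_fix)
      have "R = cball v \<delta> \<inter> {w. norm v \<le> norm w} \<inter> cball 0 (1 - \<eta> / 2)"
        by (auto simp: R_def dist_norm norm_minus_commute)
      moreover have "closed {w. norm v \<le> norm (w::complex)}"
        by (intro closed_Collect_le continuous_intros)
      ultimately show "complete R" by (simp add: complete_eq_closed closed_Int)
      have "v \<in> R" using \<delta> \<eta>(1) by (simp add: R_def \<eta>_def field_simps)
      then show "R \<noteq> {}" by auto
      show "\<Phi> ` R \<subseteq> R"
      proof
        fix z assume "z \<in> \<Phi> ` R"
        then obtain w where w: "w \<in> R" "z = \<Phi> w" by auto
        have k: "norm (\<kappa> * H w) \<le> \<delta> / 8" by (rule \<kappa>H[OF R(1)[OF w(1)]])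
        then have "norm (\<kappa> * H w) \<le> 1 / 2" using \<delta> by linarith
        then have "norm (exp (\<kappa> * H w) - 1) \<le> 3 / 2 * norm (\<kappa> * H w)" by (rule norm_exp_bounds)
        then have e: "norm (exp (\<kappa> * H w) - 1) \<le> \<delta>" using k \<delta> by linarith
        have "z - v = v * (exp (\<kappa> * H w) - 1)" using w by (simp add: \<Phi>_def algebra_simps)
        then have "norm (z - v) \<le> 1 * \<delta>" using e v(1) by (simp only: norm_mult) (intro mult_mono, auto)
        moreover have nz': "norm z = norm v * exp (\<kappa> * Re (H w))"
          using w by (simp add: \<Phi>_def norm_mult norm_exp_eq_Re)
        have "exp (\<kappa> * Re (H w)) \<ge> 1" using ReH_pos[OF R(1)[OF w(1)]] \<kappa> by simp
        then have "norm z \<ge> norm v * 1" unfolding nz' by (intro mult_left_mono) auto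
        moreover have "norm z \<le> 1 - \<eta> / 2"
        proof -
          have "exp (\<kappa> * Re (H w)) \<le> exp (\<eta> / 8)" using up[OF w(1)] by simp
          also have "\<dots> \<le> 1 + 2 * (\<eta> / 8)" using exp_bound_lemma[of "\<eta> / 8"] \<eta> by simp
          finally have "norm z \<le> (1 - \<eta>) * (1 + 2 * (\<eta> / 8))"
            unfolding nz' using v by (intro mult_mono) (auto simp: \<eta>_def)
          also have "\<dots> \<le> 1 - \<eta> / 2" using \<eta> by (simp add: algebra_simps)
          finally show ?thesis .
        qed
        ultimately show "z \<in> R" by (simp add: R_def)
      qed
      fix x y assume xy: "x \<in> R" "y \<in> R"
      have Hd: "H x - H y = (1 / of_nat N) * (\<Sum>u\<in>A. 2 * (of_real T * u) * (x - y) / ((of_real T * u - x) * (of_real T * u - y)))"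
        unfolding H_def right_diff_distrib[symmetric] sum_subtractf[symmetric]
        using nzR xy by (intro arg_cong2[where f="(*)"] refl sum.cong) (auto simp: field_simps)
      have "norm (H x - H y) \<le> (1 / N) * (\<Sum>u\<in>A. norm (2 * (of_real T * u) * (x - y) / ((of_real T * u - x) * (of_real T * u - y))))"
        unfolding Hd norm_mult[of "1 / of_nat N"] by (intro mult_mono norm_sum) (auto simp: norm_divide)
      also have "\<dots> \<le> (1 / N) * (\<Sum>u\<in>A. (2 * norm (x - y) / \<delta>) * (1 / norm (of_real T * u - x)))"
      proof (intro mult_left_mono sum_mono)
        fix u assume u: "u \<in> A"
        have n0: "norm (of_real T * u - x) > 0" using nzR[OF u xy(1)] by simp
        have "norm (2 * (of_real T * u) * (x - y) / ((of_real T * u - x) * (of_real T * u - y)))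
            = (2 * T * norm (x - y)) / (norm (of_real T * u - x) * norm (of_real T * u - y))"
          using nTu[OF u] by (simp add: norm_mult norm_divide)
        also have "\<dots> \<le> (4 * norm (x - y)) / (norm (of_real T * u - x) * (2 * \<delta>))"
          using far[OF u xy(2)] n0 \<delta> T by (intro frac_le mult_left_mono mult_right_mono) auto
        finally show "norm (2 * (of_real T * u) * (x - y) / ((of_real T * u - x) * (of_real T * u - y)))
            \<le> (2 * norm (x - y) / \<delta>) * (1 / norm (of_real T * u - x))" by (simp add: mult.commute)
      qed auto
      also have "\<dots> \<le> (1 / N) * ((2 * norm (x - y) / \<delta>) * (N * L))"
        unfolding sum_distrib_left[symmetric]
        using Lsum[OF R(1)[OF xy(1)]] \<delta> by (intro mult_left_mono) auto
      also have "\<dots> = 2 * norm (x - y) / \<delta> * L" using N0 by simp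
      finally have "\<kappa> * norm (H x - H y) \<le> \<kappa> * (2 * norm (x - y) / \<delta> * L)"
        using \<kappa> by (intro mult_left_mono) auto
      also have "\<dots> = norm (x - y) / 12" using \<delta> L by (simp add: \<kappa>_def)
      finally have Hd: "norm (\<kappa> * H x - \<kappa> * H y) \<le> norm (x - y) / 12"
        using \<kappa> by (simp add: norm_mult right_diff_distrib[symmetric])
      have "norm (exp (\<kappa> * H x) - exp (\<kappa> * H y)) \<le> 3 * norm (\<kappa> * H x - \<kappa> * H y)"
        using \<kappa>H[OF R(1)[OF xy(1)]] \<kappa>H[OF R(1)[OF xy(2)]] \<delta> by (intro norm_exp_diff_le) auto
      then have e: "norm (exp (\<kappa> * H x) - exp (\<kappa> * H y)) \<le> 1 / 4 * norm (x - y)" using Hd by simp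
      have "\<Phi> x - \<Phi> y = v * (exp (\<kappa> * H x) - exp (\<kappa> * H y))" by (simp add: \<Phi>_def algebra_simps)
      then have "norm (\<Phi> x - \<Phi> y) \<le> 1 * (1 / 4 * norm (x - y))"
        using e v(1) by (simp only: norm_mult) (intro mult_mono, auto)
      then show "dist (\<Phi> x) (\<Phi> y) \<le> 1 / 4 * dist x y" by (simp add: dist_norm)
    qed auto
    then obtain w where w: "w \<in> R" "\<Phi> w = w" by blast
    have "\<psi> w = \<Phi> w * exp (- \<kappa> * H w)" using w(2) by (simp add: \<psi>_def)
    also have "\<dots> = v" by (simp add: \<Phi>_def mult.assoc exp_add[symmetric])
    finally show ?thesis using w R(2)[OF w(1)] by (intro exI[of _ w]) (auto simp: R_def \<eta>_def field_simps)
  qed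
  have S': "cball 0 1 \<subseteq> S" using \<psi>lt T by (auto simp: S_def)
  have "\<psi> holomorphic_on S" by (rule holomorphic_on_subset[OF \<psi>hol]) (auto simp: S_def)
  moreover have "\<psi> ` S \<subseteq> ball 0 1" by (auto simp: S_def)
  moreover have "\<psi> 0 = 0" by (simp add: \<psi>_def)
  ultimately show ?thesis using P1 P2 P3 by (rule that[OF S S'])
qed

section \<open>The Ahern--Clark type and means over roots of unity\<close>

lemma circle_nbhd_sets:
  "{\<theta> \<in> {0..<2*pi}. infdist (cis \<theta>) F < x} \<in> sets lborel"
proof -
  have "open {\<theta>::real. infdist (cis \<theta>) F < x}"
    by (intro open_Collect_less continuous_intros)
  then have "{0..<2*pi} \<inter> {\<theta>::real. infdist (cis \<theta>) F < x} \<in> sets borel" by (intro sets.Int) auto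
  moreover have "{\<theta> \<in> {0..<2*pi}. infdist (cis \<theta>) F < x} = {0..<2*pi} \<inter> {\<theta>. infdist (cis \<theta>) F < x}" by auto
  ultimately show ?thesis by simp
qed

lemma fmeasurable_Ico: "{a..<b::real} \<in> fmeasurable lborel"
  by (rule fmeasurableI2[OF fmeasurable_cbox[of a b]]) auto

lemma circle_nbhd_fmeasurable:
  "{\<theta> \<in> {0..<2*pi}. infdist (cis \<theta>) F < x} \<in> fmeasurable lborel"
  by (rule fmeasurableI2[OF fmeasurable_Ico[of 0 "2*pi"] _ circle_nbhd_sets]) blast

lemma circle_nbhd_measure_ge:
  assumes "A \<subseteq> {\<theta> \<in> {0..<2*pi}. infdist (cis \<theta>) F < x}" "A \<in> sets lborel"
  shows "measure lborel A \<le> circle_nbhd_measure F x"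
  unfolding circle_nbhd_measure_def by (intro measure_mono_fmeasurable assms circle_nbhd_fmeasurable)

lemma circle_nbhd_measure_nonneg: "0 \<le> circle_nbhd_measure F x"
  by (simp add: circle_nbhd_measure_def)

lemma circle_nbhd_measure_le: "circle_nbhd_measure F x \<le> 2 * pi"
proof -
  have "circle_nbhd_measure F x \<le> measure lborel {0..<2*pi}"
    unfolding circle_nbhd_measure_def
    by (intro measure_mono_fmeasurable circle_nbhd_sets fmeasurable_Ico) auto
  then show ?thesis by simp
qed

lemma norm_cis_diff_le: "norm (cis x - cis y) \<le> \<bar>x - y\<bar>"
proof -
  have "cis x - cis y = cis y * (cis (x - y) - 1)" by (simp add: algebra_simps cis_mult)
  then have "norm (cis x - cis y) = 2 * \<bar>sin ((x - y) / 2)\<bar>"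
    by (simp add: norm_mult norm_cis_minus_one)
  also have "\<dots> \<le> 2 * \<bar>(x - y) / 2\<bar>" using abs_sin_x_le_abs_x[of "(x - y) / 2"] by linarith
  finally show ?thesis by simp
qed

text \<open>A one-sided arc at a point of F suffices, taken on the side where it does not leave [0,
  2 pi). The bound keeps admissible exponents at most 1, so the supremum defining the type is taken
  over a bounded set.\<close>

lemma circle_nbhd_measure_lower:
  assumes F: "F \<noteq> {}" "F \<subseteq> sphere 0 1" and x: "0 < x" "x \<le> 1"
  shows "x \<le> circle_nbhd_measure F x"
proof -
  obtain y where y: "y \<in> F" using F by auto
  then have "norm y = 1" using F by auto
  define \<phi> where "\<phi> = Arg2pi y"
  have \<phi>: "y = cis \<phi>" "0 \<le> \<phi>" "\<phi> < 2 * pi"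
    using \<open>norm y = 1\<close> Arg2pi[of y] by (auto simp: is_Arg_def \<phi>_def cis_conv_exp)
  have near: "infdist (cis \<theta>) F < x" if "\<bar>\<theta> - \<phi>\<bar> < x" for \<theta>
  proof -
    have "infdist (cis \<theta>) F \<le> dist (cis \<theta>) y" by (rule infdist_le[OF y])
    also have "\<dots> \<le> \<bar>\<theta> - \<phi>\<bar>" using norm_cis_diff_le[of \<theta> \<phi>] \<phi>(1) by (simp add: dist_norm)
    finally show ?thesis using that by simp
  qed
  have pi1: "1 < pi" using pi_gt3 by simp
  show ?thesis
  proof (cases "\<phi> < pi")
    case True
    have "measure lborel {\<phi>..<\<phi> + x} \<le> circle_nbhd_measure F x"
      using True \<phi> x pi1 by (intro circle_nbhd_measure_ge) (auto intro!: near)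
    then show ?thesis using x by simp
  next
    case False
    have "measure lborel {\<phi> - x<..\<phi>} \<le> circle_nbhd_measure F x"
      using False \<phi> x pi1 by (intro circle_nbhd_measure_ge) (auto intro!: near)
    then show ?thesis using x by simp
  qed
qed

text \<open>The supremum may fail to be attained, hence the loss of \<epsilon>. The asymptotic
  estimate extends to all positive \<open>x\<close> because the measure is at most 2 pi, at the
  price of a larger constant.\<close>

lemma ahern_clark_exponent:
  assumes F: "F \<noteq> {}" "F \<subseteq> sphere 0 1" and \<epsilon>: "\<epsilon> > 0"
  obtains a C where "a \<ge> 0" "ahern_clark_type F - \<epsilon> < a" "C > 0"
    "\<And>x. 0 < x \<Longrightarrow> circle_nbhd_measure F x \<le> C * x powr a"
proof -
  define S where "S = {\<alpha>::real. circle_nbhd_measure F \<in> O[at_right 0](\<lambda>x. x powr \<alpha>)}"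
  have 0: "0 \<in> S"
  proof -
    have "eventually (\<lambda>x::real. norm (circle_nbhd_measure F x) \<le> (2 * pi) * norm (x powr 0)) (at_right 0)"
      unfolding eventually_at_right[OF zero_less_one]
      using circle_nbhd_measure_le circle_nbhd_measure_nonneg by (intro exI[of _ 1]) auto
    then show ?thesis unfolding S_def by (auto intro: bigoI)
  qed
  have le1: "\<alpha> \<le> 1" if "\<alpha> \<in> S" for \<alpha>
  proof (rule ccontr)
    assume "\<not> \<alpha> \<le> 1"
    from that obtain c where c: "c > 0"
      "eventually (\<lambda>x. norm (circle_nbhd_measure F x) \<le> c * norm (x powr \<alpha>)) (at_right 0)"
      unfolding S_def by (auto elim: landau_o.bigE)
    have "((\<lambda>x::real. x powr (\<alpha> - 1)) \<longlongrightarrow> 0) (at_right 0)"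
      using \<open>\<not> \<alpha> \<le> 1\<close> by (intro tendsto_zero_powrI tendsto_intros)
        (auto simp: eventually_at_filter intro: tendsto_ident_at)
    then have "eventually (\<lambda>x::real. x powr (\<alpha> - 1) < 1 / c) (at_right 0)"
      using c by (intro order_tendstoD(2)) auto
    moreover have "eventually (\<lambda>x::real. 0 < x \<and> x < 1) (at_right 0)"
      unfolding eventually_at_right[OF zero_less_one] by (intro exI[of _ 1]) auto
    ultimately have "eventually (\<lambda>x::real. False) (at_right 0)"
      using c(2)
    proof eventually_elim
      case (elim x)
      have "x \<le> circle_nbhd_measure F x" using elim by (intro circle_nbhd_measure_lower F) auto
      also have "\<dots> \<le> c * x powr \<alpha>" using elim by simp
      also have "x powr \<alpha> = x powr (\<alpha> - 1) * x" using elim by (simp add: powr_diff)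
      also have "c * (x powr (\<alpha> - 1) * x) < x" using elim c by (simp add: field_simps)
      finally show False by simp
    qed
    then show False by simp
  qed
  then have "bdd_above S" by (intro bdd_aboveI[of _ 1]) auto
  moreover have "ahern_clark_type F = Sup S" by (simp add: ahern_clark_type_def S_def)
  ultimately obtain \<beta> where \<beta>: "\<beta> \<in> S" "ahern_clark_type F - \<epsilon> < \<beta>"
    using less_cSup_iff[of S "ahern_clark_type F - \<epsilon>"] 0 \<epsilon> by auto
  \<comment> \<open>Exponent 0 is admissible, so truncating at 0 stays within the set and makes
    \<open>x powr a\<close> monotone.\<close>
  define a where "a = max \<beta> 0"
  have "a \<in> S" using \<beta> 0 by (auto simp: a_def max_def)
  then obtain c where c: "c > 0"
      "eventually (\<lambda>x. norm (circle_nbhd_measure F x) \<le> c * norm (x powr a)) (at_right 0)"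
      unfolding S_def by (auto elim: landau_o.bigE)
  then obtain b where b: "b > 0" "\<And>x. 0 < x \<Longrightarrow> x < b \<Longrightarrow> circle_nbhd_measure F x \<le> c * x powr a"
    unfolding eventually_at_right[OF zero_less_one]
    by (auto simp: abs_of_nonneg circle_nbhd_measure_nonneg)
  have "circle_nbhd_measure F x \<le> (c + 2 * pi * b powr (- a)) * x powr a" if x: "0 < x" for x
  proof (cases "x < b")
    case True
    have "c * x powr a \<le> (c + 2 * pi * b powr (- a)) * x powr a" by (intro mult_right_mono) auto
    then show ?thesis using b(2)[OF x True] by simp
  next
    case False
    have "b powr a \<le> x powr a" using False b by (intro powr_mono2) (auto simp: a_def)
    then have "1 \<le> b powr (- a) * x powr a" using b by (simp add: powr_minus field_simps)
    then have "2 * pi * 1 \<le> 2 * pi * (b powr (- a) * x powr a)" by (rule mult_left_mono) simp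
    moreover have "0 \<le> c * x powr a" using c by simp
    ultimately show ?thesis using circle_nbhd_measure_le[of F x] unfolding distrib_right by (simp only: mult.assoc)
  qed
  moreover have "c + 2 * pi * b powr (- a) > 0" using c by (intro add_pos_nonneg) auto
  moreover have "a \<ge> 0" "ahern_clark_type F - \<epsilon> < a" using \<beta> by (auto simp: a_def)
  ultimately show ?thesis using that by blast
qed

text \<open>Each counted grid point owns the mesh arc containing it, and that arc lies in the
  neighbourhood enlarged by one mesh. Arcs starting at the unshifted angles tile [0, 2 pi) without
  wrapping around, whatever the offset \<open>t\<close>.\<close>

lemma card_grid_near_le:
  fixes N :: nat
  assumes N: "N > 0" and t: "0 \<le> t" "t < 2 * pi / N"
  shows "card {j \<in> {..<N}. infdist (cis (2 * pi * real j / real N + t)) F < x} * (2 * pi / N)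
      \<le> circle_nbhd_measure F (x + 2 * pi / N)"
proof -
  define J where "J = {j \<in> {..<N}. infdist (cis (2 * pi * real j / real N + t)) F < x}"
  define I where "I j = {2 * pi * real j / N ..< 2 * pi * (real j + 1) / N}" for j :: nat
  have fin: "finite J" by (simp add: J_def)
  have len: "2 * pi * (real j + 1) / N = 2 * pi * real j / N + 2 * pi / N" for j :: nat
    by (simp add: distrib_left add_divide_distrib)
  have disj: "disjoint_family_on I J"
  proof -
    have "I i \<inter> I j = {}" if "i < j" for i j
    proof -
      have "2 * pi * (real i + 1) / N \<le> 2 * pi * real j / N"
        using that by (intro divide_right_mono mult_left_mono) auto
      then show ?thesis by (auto simp: I_def)
    qed
    then show ?thesis unfolding disjoint_family_on_def by (metis Int_commute linorder_neqE_nat)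
  qed
  have mI: "measure lborel (I j) = 2 * pi / N" for j
    by (simp add: I_def len)
  have fI: "I j \<in> fmeasurable lborel" for j
    unfolding I_def by (rule fmeasurable_Ico)
  have "card J * (2 * pi / N) = (\<Sum>j\<in>J. measure lborel (I j))" by (simp add: mI)
  also have "\<dots> = measure lborel (\<Union>j\<in>J. I j)"
    using fI disj by (intro measure_finite_Union[symmetric] fin) (auto simp: fmeasurable_def less_top)
  also have "\<dots> \<le> circle_nbhd_measure F (x + 2 * pi / N)"
  proof (rule circle_nbhd_measure_ge)
    show "(\<Union>j\<in>J. I j) \<in> sets lborel" using fin by (auto simp: I_def)
    show "(\<Union>j\<in>J. I j) \<subseteq> {\<theta> \<in> {0..<2 * pi}. infdist (cis \<theta>) F < x + 2 * pi / N}"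
    proof safe
      fix j \<theta> assume j: "j \<in> J" and \<theta>: "\<theta> \<in> I j"
      have "2 * pi * (real j + 1) / N \<le> 2 * pi * real N / N"
        using j by (intro divide_right_mono mult_left_mono) (auto simp: J_def)
      also have "\<dots> = 2 * pi" using N by simp
      finally have u: "2 * pi * (real j + 1) / N \<le> 2 * pi" .
      have l: "0 \<le> 2 * pi * real j / N" by simp
      show "\<theta> \<in> {0..<2 * pi}"
        using \<theta> unfolding I_def atLeastLessThan_iff
        by (intro conjI order_trans[OF l] less_le_trans[OF _ u]) auto
      have "infdist (cis \<theta>) F \<le> infdist (cis (2 * pi * real j / real N + t)) F
          + norm (cis \<theta> - cis (2 * pi * real j / real N + t))" by (rule infdist_triangle_norm)
      also have "norm (cis \<theta> - cis (2 * pi * real j / real N + t)) \<le> \<bar>\<theta> - (2 * pi * real j / real N + t)\<bar>"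
        by (rule norm_cis_diff_le)
      also have "\<dots> \<le> 2 * pi / N" using \<theta> t unfolding I_def len by auto
      finally show "infdist (cis \<theta>) F < x + 2 * pi / N" using j by (simp add: J_def)
    qed
  qed
  finally show ?thesis by (simp add: J_def)
qed

text \<open>Dyadic layers around F: at distance about x, at most a multiple of
  \<open>N * x powr a\<close> grid points occur, each weighted by at most a multiple of
  \<open>\<delta> powr (- max (q - a) 0) * x powr (- a)\<close>. The powers of x cancel, so all
  layers count alike, and \<open>\<delta> powr (- e)\<close> pays for their number, which is of
  order log (1 / \<delta>).\<close>

lemma mean_dist_powr_le:
  assumes F: "F \<noteq> {}" "F \<subseteq> sphere 0 1" and a: "a \<ge> 0" and C: "C > 0"
    and bd: "\<And>x. 0 < x \<Longrightarrow> circle_nbhd_measure F x \<le> C * x powr a"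
    and q: "q \<ge> 0" and e: "e > 0"
  obtains D where "D > 0" "\<And>k N w. 16 * 2 ^ k \<le> real N \<Longrightarrow> norm w = 1 \<Longrightarrow>
     (\<Sum>u\<in>{z. z ^ N = 1}. max (infdist (w * u) F) ((1/2) ^ k) powr (- q))
       \<le> N * (D * ((1/2) ^ k) powr (- (max (q - a) 0 + e)))"
proof -
  define c where "c = 2 powr max (a - q) 0"
  define D where "D = c * C * 4 powr a * (2 + 1 / (e * ln 2))"
  have c0: "c > 0" by (simp add: c_def)
  have D: "D > 0" unfolding D_def using c0 C e by (intro mult_pos_pos add_pos_pos) auto
  have "(\<Sum>u\<in>{z. z ^ N = 1}. max (infdist (w * u) F) ((1/2) ^ k) powr (- q))
       \<le> N * (D * ((1/2) ^ k) powr (- (max (q - a) 0 + e)))"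
    if N: "16 * 2 ^ k \<le> real N" and w: "norm w = 1" for k N w
  proof -
    define \<delta> :: real where "\<delta> = (1/2) ^ k"
    define s where "s = max (q - a) 0"
    have \<delta>: "0 < \<delta>" "\<delta> \<le> 1" by (auto simp: \<delta>_def power_le_one)
    have N\<delta>: "16 / \<delta> \<le> N" using N by (simp add: \<delta>_def power_divide)
    have "0 < real N" by (rule less_le_trans[OF _ N]) simp
    then have N0: "N > 0" by simp
    have "2 * pi / N \<le> 16 / N" using pi_less_4 by (intro divide_right_mono) auto
    also have "16 / N \<le> \<delta>" using N\<delta> \<delta> N0 by (simp add: field_simps)
    finally have piN: "2 * pi / N \<le> \<delta>" .
    obtain t where t: "0 \<le> t" "t < 2 * pi / N"
      "\<And>g :: complex \<Rightarrow> real. (\<Sum>u\<in>{z. z ^ N = 1}. g (w * u)) = (\<Sum>j<N. g (cis (2 * pi * real j / real N + t)))"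
      using sum_roots_unity_rotate[OF N0 w] by blast
    define d where "d j = infdist (cis (2 * pi * real j / real N + t)) F" for j :: nat
    define x where "x i = 2 ^ i * \<delta>" for i :: nat
    have x0: "x i > 0" for i using \<delta> by (simp add: x_def)
    have x_Suc: "x (Suc i) = 2 * x i" for i by (simp add: x_def)
    have d2: "d j \<le> 2" for j
    proof -
      obtain y where y: "y \<in> F" using F by auto
      have "d j \<le> dist (cis (2 * pi * real j / real N + t)) y" unfolding d_def by (rule infdist_le[OF y])
      also have "\<dots> \<le> norm (cis (2 * pi * real j / real N + t)) + norm y"
        unfolding dist_norm by (rule norm_triangle_ineq4)
      finally show ?thesis using y F by auto
    qed
    define P where "P i j = (if d j < x (Suc i) then c * \<delta> powr (- s) * x i powr (- a) else 0)" for i j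
    have P0: "P i j \<ge> 0" for i j using c0 by (simp add: P_def)
    have pt: "max (d j) \<delta> powr (- q) \<le> (\<Sum>i\<le>k+1. P i j)" for j
    proof -
      define M where "M = max (d j) \<delta>"
      have M: "\<delta> \<le> M" "M \<le> 2" "M > 0" "d j \<le> M" using d2[of j] \<delta> by (auto simp: M_def)
      \<comment> \<open>The range ends at k + 1 because \<open>x (k + 2) = 4\<close> exceeds the
        largest possible distance 2.\<close>
      have "\<exists>i\<le>k+1. x i \<le> M \<and> M < x (Suc i)"
      proof -
        define i where "i = (GREATEST i. i \<le> k + 1 \<and> x i \<le> M)"
        have ex: "0 \<le> k + 1 \<and> x 0 \<le> M" using M by (simp add: x_def)
        have g: "i \<le> k + 1 \<and> x i \<le> M" unfolding i_def 
          by (rule GreatestI_nat[where P = "\<lambda>i. i \<le> k + 1 \<and> x i \<le> M" and k = 0 and b = "k + 1"]) (use ex in auto)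
        have "M < x (Suc i)"
        proof (rule ccontr)
          assume n: "\<not> M < x (Suc i)"
          show False
          proof (cases "i = k + 1")
            case True
            have "x (Suc i) = 4" unfolding True x_def \<delta>_def by (simp add: power_divide)
            then show False using n M by simp
          next
            case False
            then have "Suc i \<le> k + 1 \<and> x (Suc i) \<le> M" using g n by auto
            then have "Suc i \<le> i" unfolding i_def 
              by (rule Greatest_le_nat[where P = "\<lambda>i. i \<le> k + 1 \<and> x i \<le> M" and b = "k + 1"]) auto
            then show False by simp
          qed
        qed
        then show ?thesis using g by blast
      qed
      then obtain i where i: "i \<le> k + 1" "x i \<le> M" "M < x (Suc i)" by blast
      \<comment> \<open>Splitting q as (q - a) + a isolates the part that the layer count cancels.
        The remaining power is largest at \<open>M = \<delta>\<close> if \<open>q \<ge> a\<close>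
        and at \<open>M = 2\<close> otherwise; the latter is the constant \<open>c\<close>.\<close>
      have "M powr (- (q - a)) \<le> c * \<delta> powr (- s)"
      proof (cases "q \<ge> a")
        case True
        have "M powr (- (q - a)) \<le> \<delta> powr (- (q - a))" using M \<delta> True by (intro powr_mono2') auto
        then show ?thesis using True by (simp add: c_def s_def)
      next
        case False
        have "M powr (a - q) \<le> 2 powr (a - q)" using M False by (intro powr_mono2) auto
        then show ?thesis using False \<delta> by (simp add: c_def s_def)
      qed
      moreover have "M powr (- a) \<le> x i powr (- a)" using i x0[of i] a by (intro powr_mono2') auto
      ultimately have "M powr (- (q - a)) * M powr (- a) \<le> c * \<delta> powr (- s) * x i powr (- a)"
        by (intro mult_mono) (use c0 in auto)
      moreover have "M powr (- q) = M powr (- (q - a)) * M powr (- a)"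
        by (simp add: powr_add[symmetric])
      moreover have "P i j = c * \<delta> powr (- s) * x i powr (- a)" using i M by (simp add: P_def)
      ultimately have "M powr (- q) \<le> P i j" by simp
      also have "\<dots> \<le> (\<Sum>i\<le>k+1. P i j)" using i by (intro member_le_sum P0) auto
      finally show ?thesis by (simp add: M_def)
    qed
    have col: "(\<Sum>j<N. P i j) \<le> N * (c * \<delta> powr (- s) * C * 4 powr a)" for i
    proof -
      define n where "n = card {j \<in> {..<N}. d j < x (Suc i)}"
      have "(\<Sum>j<N. P i j) = (\<Sum>j\<in>{j \<in> {..<N}. d j < x (Suc i)}. c * \<delta> powr (- s) * x i powr (- a))"
        unfolding P_def by (simp only: sum.inter_filter[OF finite_lessThan])
      also have "\<dots> = n * (c * \<delta> powr (- s) * x i powr (- a))" by (simp add: n_def)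
      finally have 1: "(\<Sum>j<N. P i j) = n * (c * \<delta> powr (- s) * x i powr (- a))" .
      have "n * (2 * pi / N) \<le> circle_nbhd_measure F (x (Suc i) + 2 * pi / N)"
        unfolding n_def d_def by (rule card_grid_near_le[OF N0 t(1,2)])
      also have "\<dots> \<le> C * (x (Suc i) + 2 * pi / N) powr a"
        using x0[of "Suc i"] by (intro bd add_pos_nonneg) auto
      also have "\<dots> \<le> C * (4 * x i) powr a"
      proof (intro mult_left_mono powr_mono2)
        have "\<delta> \<le> x i" using \<delta> by (simp add: x_def)
        then show "x (Suc i) + 2 * pi / N \<le> 4 * x i" using piN x0[of i] x_Suc[of i] by linarith
      qed (use C a x0[of "Suc i"] in auto)
      also have "\<dots> = C * 4 powr a * x i powr a" using x0[of i] by (simp add: powr_mult)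
      finally have "n * (2 * pi) \<le> N * (C * 4 powr a * x i powr a)" using N0 by (simp add: field_simps)
      moreover have "real n * 1 \<le> real n * (2 * pi)" using pi_gt3 by (intro mult_left_mono) auto
      ultimately have "real n \<le> N * (C * 4 powr a * x i powr a)" by linarith
      then have "n * (c * \<delta> powr (- s) * x i powr (- a))
          \<le> N * (C * 4 powr a * x i powr a) * (c * \<delta> powr (- s) * x i powr (- a))"
        using c0 by (intro mult_right_mono) auto
      also have "\<dots> = N * (c * \<delta> powr (- s) * C * 4 powr a) * (x i powr a * x i powr (- a))" by simp
      also have "x i powr a * x i powr (- a) = 1" using x0[of i] by (simp add: powr_minus)
      finally show ?thesis using 1 by simp
    qed
    have "(\<Sum>u\<in>{z. z ^ N = 1}. max (infdist (w * u) F) ((1/2) ^ k) powr (- q))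
        = (\<Sum>j<N. max (d j) \<delta> powr (- q))"
      using t(3)[of "\<lambda>z. max (infdist z F) \<delta> powr (- q)"] by (simp add: d_def \<delta>_def)
    also have "\<dots> \<le> (\<Sum>j<N. \<Sum>i\<le>k+1. P i j)" by (intro sum_mono pt)
    also have "\<dots> = (\<Sum>i\<le>k+1. \<Sum>j<N. P i j)" by (rule sum.swap)
    also have "\<dots> \<le> (\<Sum>i\<le>k+1. N * (c * \<delta> powr (- s) * C * 4 powr a))" by (intro sum_mono col)
    also have "\<dots> = (k + 2) * (N * (c * \<delta> powr (- s) * C * 4 powr a))" by simp
    also have "\<dots> \<le> (2 + 1 / (e * ln 2)) * \<delta> powr (- e) * (N * (c * \<delta> powr (- s) * C * 4 powr a))"
    proof (intro mult_right_mono)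
      have "\<delta> powr (- e) = exp (k * (e * ln 2))"
        using \<delta> by (simp add: powr_def \<delta>_def ln_realpow ln_div)
      then have 1: "1 + k * (e * ln 2) \<le> \<delta> powr (- e)" using exp_ge_add_one_self by metis
      have "0 \<le> k * (e * ln 2)" using e by simp
      then have "1 \<le> \<delta> powr (- e)" using 1 by linarith
      moreover have "k \<le> 1 / (e * ln 2) * \<delta> powr (- e)" using 1 e by (simp add: field_simps)
      ultimately show "real (k + 2) \<le> (2 + 1 / (e * ln 2)) * \<delta> powr (- e)" by (simp add: distrib_right)
    qed (use c0 C in auto)
    also have "\<dots> = N * (D * (\<delta> powr (- s) * \<delta> powr (- e)))" by (simp add: D_def)
    also have "\<delta> powr (- s) * \<delta> powr (- e) = \<delta> powr (- (s + e))" by (simp add: powr_add[symmetric])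
    finally show ?thesis by (simp add: \<delta>_def s_def)
  qed
  with D show ?thesis by (rule that)
qed

section \<open>Maps onto regions with a corner\<close>

lemma powr_of_real_polar:
  fixes W :: complex
  assumes "W \<noteq> 0"
  shows "W powr of_real b = of_real (norm W powr b) * cis (b * Arg W)"
proof -
  have "Re (of_real b * Ln W) = b * ln (norm W)" "Im (of_real b * Ln W) = b * Arg W"
    using assms by (simp_all add: Arg_eq_Im_Ln)
  then show ?thesis using assms by (simp add: powr_def exp_eq_polar Arg_eq_Im_Ln)
qed

lemma norm_one_minus_polar: "(norm (1 - of_real R * cis g))\<^sup>2 = 1 - R * (2 * cos g - R)"
proof -
  have "(norm (1 - of_real R * cis g))\<^sup>2 = (1 - R * cos g)\<^sup>2 + (R * sin g)\<^sup>2"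
    by (simp add: cmod_power2)
  also have "\<dots> = 1 - 2 * R * cos g + R\<^sup>2 * ((sin g)\<^sup>2 + (cos g)\<^sup>2)"
    by algebra
  finally show ?thesis by (simp add: power2_eq_square algebra_simps)
qed

text \<open>In polar coordinates about the boundary point 1, \<open>1 - v = R * cis g\<close>, the
  disc is the region \<open>R < 2 * cos g\<close>. Powers of \<open>1 - v\<close> act on R and g
  separately, so heights are measured in this form from here on.\<close>

lemma one_minus_norm_polar:
  fixes v :: complex
  assumes "v \<noteq> 1"
  shows "1 - (norm v)\<^sup>2 = norm (1 - v) * (2 * cos (Arg (1 - v)) - norm (1 - v))"
proof -
  have "1 - v = of_real (norm (1 - v)) * cis (Arg (1 - v))"
    using assms Arg_eq[of "1 - v"] by (simp add: cis_conv_exp)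
  then have "v = 1 - of_real (norm (1 - v)) * cis (Arg (1 - v))" by (simp add: algebra_simps)
  then have "(norm v)\<^sup>2 = (norm (1 - of_real (norm (1 - v)) * cis (Arg (1 - v))))\<^sup>2" by simp
  also have "\<dots> = 1 - norm (1 - v) * (2 * cos (Arg (1 - v)) - norm (1 - v))" by (rule norm_one_minus_polar)
  finally show ?thesis by simp
qed

lemma Arg_less_pi_half_of_cos_pos:
  assumes "cos (Arg z) > 0"
  shows "\<bar>Arg z\<bar> < pi / 2"
proof (rule ccontr)
  assume n: "\<not> \<bar>Arg z\<bar> < pi / 2"
  have "cos \<bar>Arg z\<bar> \<le> cos (pi / 2)"
    using n Arg_bounded[of z] by (intro cos_monotone_0_pi_le) (auto simp: abs_le_iff)
  then show False using assms by simp
qed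

lemma powr_le_affine:
  fixes x b :: real
  assumes "x > 0" "0 \<le> b" "b \<le> 1"
  shows "x powr b \<le> b * x + (1 - b)"
  using Youngs_inequality_0[of b "1 - b" x 1] assms by simp

lemma cos_mult_ge:
  assumes "\<bar>g\<bar> \<le> pi / 2" "0 \<le> b" "b \<le> 1"
  shows "cos (b * g) \<ge> (1 - b) + b * cos g"
proof -
  have "convex_on {- (pi/2)..pi/2} (\<lambda>x::real. - cos x)"
    by (rule f''_ge0_imp_convex[where f' = "\<lambda>x. sin x" and f'' = cos])
       (auto intro!: derivative_eq_intros cos_ge_zero)
  then have "- cos ((1 - b) *\<^sub>R 0 + b *\<^sub>R g) \<le> (1 - b) * (- cos 0) + b * (- cos g)"
    using assms by (intro convex_onD) (auto simp: abs_le_iff)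
  then show ?thesis by simp
qed

text \<open>The power narrows the angle of the disc at 1 from pi to (1 - d) * pi, and the
  normalisation keeps 0 fixed, as subordination requires.\<close>

definition corner :: "real \<Rightarrow> complex \<Rightarrow> complex" where
  "corner d v = 1 - (1 - v) powr of_real (1 - d)"

lemma corner_0 [simp]: "corner d 0 = 0"
  by (simp add: corner_def)

lemma holomorphic_corner: "corner d holomorphic_on ball 0 1"
  unfolding corner_def
proof (intro holomorphic_intros)
  fix z :: complex assume "z \<in> ball 0 1"
  then have "Re (1 - z) > 0" using complex_Re_le_cmod[of z] by simp
  then show "1 - z \<notin> \<real>\<^sub>\<le>\<^sub>0" by (auto simp: complex_nonpos_Reals_iff)
qed

lemma corner_polar:
  assumes v: "norm v < 1" and d: "0 < d" "d \<le> 1/2"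
  defines "R \<equiv> norm (1 - v) powr (1 - d)" and "g \<equiv> Arg (1 - v)"
  shows "1 - corner d v = of_real R * cis ((1 - d) * g)" "R > 0" "\<bar>g\<bar> < pi / 2"
    "norm (1 - v) < 2 * cos g"
proof -
  have v1: "v \<noteq> 1" using v by auto
  then show "1 - corner d v = of_real R * cis ((1 - d) * g)"
    unfolding corner_def R_def g_def using powr_of_real_polar[of "1 - v" "1 - d"] by simp
  show "R > 0" using v1 by (simp add: R_def)
  have "(norm v)\<^sup>2 < 1" using v by (simp add: power_less_one_iff abs_square_less_1)
  then have "norm (1 - v) * (2 * cos g - norm (1 - v)) > 0"
    using one_minus_norm_polar[OF v1] unfolding g_def by linarith
  then show c: "norm (1 - v) < 2 * cos g" using v1 by (simp add: zero_less_mult_iff)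
  then have "cos g > 0" using norm_ge_zero[of "1 - v"] by linarith
  then show "\<bar>g\<bar> < pi / 2" unfolding g_def by (rule Arg_less_pi_half_of_cos_pos)
qed

text \<open>Young's inequality gives \<open>R \<le> (1 - d) * (2 * cos g) + d\<close>, concavity of
  the cosine gives \<open>cos ((1 - d) * g) \<ge> d + (1 - d) * cos g\<close>. On subtraction the
  terms in \<open>cos g\<close> cancel and the margin \<open>d\<close> is left.\<close>

lemma corner_stolz:
  assumes v: "norm v < 1" and d: "0 < d" "d \<le> 1/2"
  shows "(norm (corner d v))\<^sup>2 \<le> 1 - d * norm (1 - corner d v)" "norm (corner d v) < 1"
proof -
  define R where "R = norm (1 - v) powr (1 - d)"
  define g where "g = Arg (1 - v)"
  note P = corner_polar[OF v d, folded R_def g_def]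
  have cg: "0 < 2 * cos g" using P(4) norm_ge_zero[of "1 - v"] by linarith
  have "R \<le> (2 * cos g) powr (1 - d)" unfolding R_def using P(4) d by (intro powr_mono2) auto
  also have "\<dots> \<le> (1 - d) * (2 * cos g) + d" using powr_le_affine[OF cg, of "1 - d"] d by simp
  finally have R: "R \<le> (1 - d) * (2 * cos g) + d" .
  have "cos ((1 - d) * g) \<ge> d + (1 - d) * cos g" using cos_mult_ge[of g "1 - d"] P(3) d by simp
  then have "d \<le> 2 * cos ((1 - d) * g) - R" using R by (simp add: algebra_simps)
  then have "R * d \<le> R * (2 * cos ((1 - d) * g) - R)" using P(2) by (intro mult_left_mono) auto
  moreover have "corner d v = 1 - of_real R * cis ((1 - d) * g)" using P(1) by (simp add: algebra_simps)
  then have "(norm (corner d v))\<^sup>2 = 1 - R * (2 * cos ((1 - d) * g) - R)"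
    by (simp only: norm_one_minus_polar)
  moreover have n: "norm (1 - corner d v) = R" using P(1,2) by (simp add: norm_mult)
  ultimately show *: "(norm (corner d v))\<^sup>2 \<le> 1 - d * norm (1 - corner d v)" by (simp add: mult.commute)
  have "d * norm (1 - corner d v) > 0" using P(2) d n by simp
  then have "(norm (corner d v))\<^sup>2 < 1\<^sup>2" using * by simp
  then show "norm (corner d v) < 1" by (rule power2_less_imp_less) simp
qed

text \<open>The angle turns by at most \<open>2 * d\<close> at radius at most 2, and the radius
  changes by at most \<open>2 * d\<close>. Uniform closeness to the identity guarantees that
  inserting the corner does not undo the separation from F.\<close>

lemma corner_near_id:
  assumes v: "norm v < 1" and d: "0 < d" "d \<le> 1/2"
  shows "norm (corner d v - v) \<le> 6 * d"
proof -
  define r where "r = norm (1 - v)"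
  define R where "R = r powr (1 - d)"
  define g where "g = Arg (1 - v)"
  note P = corner_polar[OF v d, folded r_def, folded R_def g_def]
  have v1: "v \<noteq> 1" using v by auto
  have r: "0 < r" "r \<le> 2" using v1 norm_triangle_ineq4[of 1 v] v by (auto simp: r_def)
  have W: "1 - v = of_real r * cis g"
    using v1 Arg_eq[of "1 - v"] by (simp add: cis_conv_exp r_def g_def)
  have "corner d v - v = (1 - v) - (1 - corner d v)" by simp
  also have "\<dots> = of_real r * (cis g - cis ((1 - d) * g)) + of_real (r - R) * cis ((1 - d) * g)"
    unfolding W P(1) by (simp add: algebra_simps)
  finally have "norm (corner d v - v)
      \<le> norm (of_real r * (cis g - cis ((1 - d) * g))) + norm (of_real (r - R) * cis ((1 - d) * g))"
    by (metis norm_triangle_ineq)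
  also have "norm (of_real r * (cis g - cis ((1 - d) * g))) \<le> 2 * (2 * d)"
  proof -
    have "norm (cis g - cis ((1 - d) * g)) \<le> \<bar>g - (1 - d) * g\<bar>" by (rule norm_cis_diff_le)
    also have "\<dots> = d * \<bar>g\<bar>" using d by (simp add: algebra_simps abs_mult)
    also have "\<dots> \<le> d * 2" using P(3) pi_less_4 d by (intro mult_left_mono) auto
    finally show ?thesis using r unfolding norm_mult by (intro mult_mono) auto
  qed
  also have "norm (of_real (r - R) * cis ((1 - d) * g)) \<le> 2 * d"
  proof -
    have "R - r \<le> 2 * d"
    proof -
      have "R \<le> (1 - d) * r + d" using powr_le_affine[OF r(1), of "1 - d"] d by (simp add: R_def)
      moreover have "0 \<le> d * r" using d r by simp
      ultimately show ?thesis using d by (simp add: algebra_simps)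
    qed
    moreover have "r - R \<le> 2 * d"
    proof (cases "r \<le> 1")
      case True
      have "r powr 1 \<le> r powr (1 - d)" using r True d by (intro powr_mono') auto
      then show ?thesis using d r by (simp add: R_def)
    next
      case False
      have "r powr d \<le> d * r + (1 - d)" using powr_le_affine[OF r(1), of d] d by simp
      also have "\<dots> \<le> 1 + d" using mult_left_mono[OF r(2), of d] d by simp
      finally have 1: "r powr d - 1 \<le> d" by simp
      have "R \<le> r powr 1" unfolding R_def using False d by (intro powr_mono) auto
      then have R2: "R \<le> 2" using r by simp
      have "r = R * r powr d" using r by (simp add: R_def powr_add[symmetric])
      then have "r - R = R * (r powr d - 1)" by (simp add: algebra_simps)
      also have "\<dots> \<le> R * d" using 1 P(2) by (intro mult_left_mono) auto
      also have "\<dots> \<le> 2 * d" using R2 d by (intro mult_right_mono) auto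
      finally show ?thesis .
    qed
    ultimately show ?thesis by (simp add: norm_mult del: of_real_diff)
  qed
  finally show ?thesis by simp
qed

lemma abs_cos_diff_le: "\<bar>cos x - cos y\<bar> \<le> \<bar>x - y\<bar>" for x y :: real
  using norm_cis_diff_le[of x y] abs_Re_le_cmod[of "cis x - cis y"] by simp

text \<open>The condition on \<open>z\<close> is an angular margin
  \<open>2 * cos g - norm Q \<ge> 16 * d\<close>. The inverse power b = 1 / (1 - d) turns the angle
  by at most \<open>4 * d\<close>, which changes \<open>2 * cos g\<close> by at most
  \<open>8 * d\<close>, so half of the margin survives. The radius contributes the factor
  \<open>norm Q powr (b - 1)\<close>, with \<open>b - 1 \<le> 2 * d\<close>.\<close>

lemma corner_inverse:
  assumes z: "norm z < 1" "norm (1 - z) \<le> 1" and d: "0 < d" "d \<le> 1/2"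
    and st: "16 * d * norm (1 - z) \<le> 1 - (norm z)\<^sup>2"
  obtains v where "norm v < 1" "corner d v = z"
    "norm (1 - z) powr (2 * d) * (1 - (norm z)\<^sup>2) / 2 \<le> 1 - (norm v)\<^sup>2"
proof -
  define b where "b = 1 / (1 - d)"
  have b: "1 \<le> b" "b \<le> 1 + 2 * d" "b \<le> 2" "(1 - d) * b = 1"
  proof -
    have "1 \<le> (1 + 2 * d) * (1 - d)"
      using d mult_right_mono[OF d(2), of d] by (simp add: algebra_simps)
    then show "b \<le> 1 + 2 * d" using d by (simp add: b_def pos_divide_le_eq)
  qed (use d in \<open>auto simp: b_def field_simps\<close>)
  define Q where "Q = 1 - z"
  have z1: "z \<noteq> 1" using z by auto
  have Q: "Q \<noteq> 0" "norm Q \<le> 1" "norm Q > 0" using z z1 by (auto simp: Q_def)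
  define g where "g = Arg Q"
  have zz: "1 - (norm z)\<^sup>2 = norm Q * (2 * cos g - norm Q)"
    unfolding Q_def g_def by (rule one_minus_norm_polar[OF z1])
  then have "norm Q * (16 * d) \<le> norm Q * (2 * cos g - norm Q)" using st by (simp add: Q_def mult_ac)
  then have c16: "16 * d \<le> 2 * cos g - norm Q" using Q by simp
  then have "cos g > 0" using Q d by linarith
  then have g: "\<bar>g\<bar> < pi / 2" unfolding g_def by (rule Arg_less_pi_half_of_cos_pos)
  define Y where "Y = Q powr of_real b"
  define v where "v = 1 - Y"
  have Y: "Y = of_real (norm Q powr b) * cis (b * g)" using Q by (simp add: Y_def powr_of_real_polar g_def)
  \<comment> \<open>Since \<open>b \<le> 2\<close> and \<open>\<bar>g\<bar> < pi / 2\<close>, the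
    enlarged angle stays below pi and the two powers compose on the principal branch.\<close>
  have LnY: "Ln Y = of_real b * Ln Q"
  proof -
    have "\<bar>b * g\<bar> < pi"
    proof -
      have "\<bar>b * g\<bar> = b * \<bar>g\<bar>" using b by (simp add: abs_mult)
      also have "\<dots> \<le> 2 * \<bar>g\<bar>" using b by (intro mult_right_mono) auto
      finally show ?thesis using g by simp
    qed
    moreover have "Im (of_real b * Ln Q) = b * g" using Q by (simp add: g_def Arg_eq_Im_Ln)
    ultimately have "Ln (exp (of_real b * Ln Q)) = of_real b * Ln Q" by (intro Ln_exp) auto
    then show ?thesis using Q by (simp add: Y_def powr_def)
  qed
  have Y0: "Y \<noteq> 0" using Q by (simp add: Y_def)
  have "(1 - v) powr of_real (1 - d) = Q"
  proof -
    have "(1 - v) powr of_real (1 - d) = exp (of_real (1 - d) * (of_real b * Ln Q))"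
      using Y0 LnY by (simp add: v_def powr_def)
    also have "of_real (1 - d) * (of_real b * Ln Q) = of_real ((1 - d) * b) * Ln Q"
      by (simp only: of_real_mult mult.assoc)
    also have "exp \<dots> = Q" using b(4) Q by simp
    finally show ?thesis .
  qed
  then have cv: "corner d v = z" by (simp add: corner_def Q_def)
  have "(norm v)\<^sup>2 = 1 - norm Q powr b * (2 * cos (b * g) - norm Q powr b)"
    unfolding v_def Y by (rule norm_one_minus_polar)
  moreover have "(2 * cos g - norm Q) / 2 \<le> 2 * cos (b * g) - norm Q powr b"
  proof -
    have "\<bar>cos (b * g) - cos g\<bar> \<le> \<bar>b * g - g\<bar>" by (rule abs_cos_diff_le)
    also have "\<dots> = (b - 1) * \<bar>g\<bar>" using b by (metis abs_mult abs_of_nonneg diff_ge_0_iff_ge left_diff_distrib mult_1)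
    also have "\<dots> \<le> (2 * d) * 2" using b g pi_less_4 by (intro mult_mono) auto
    finally have "cos (b * g) \<ge> cos g - 4 * d" by linarith
    moreover have "norm Q powr b \<le> norm Q powr 1" using Q b by (intro powr_mono') auto
    ultimately show ?thesis using c16 Q by simp
  qed
  ultimately have 1: "1 - (norm v)\<^sup>2 \<ge> norm Q powr b * ((2 * cos g - norm Q) / 2)"
    using Q by (simp add: mult_left_mono)
  have "norm Q powr b = norm Q * norm Q powr (b - 1)" using Q by (simp add: powr_diff)
  also have "\<dots> \<ge> norm Q * norm Q powr (2 * d)" using Q b by (intro mult_left_mono powr_mono') auto
  finally have "norm Q * norm Q powr (2 * d) * ((2 * cos g - norm Q) / 2)
      \<le> norm Q powr b * ((2 * cos g - norm Q) / 2)"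
    using c16 d by (intro mult_right_mono) auto
  then have 2: "norm Q powr (2 * d) * (1 - (norm z)\<^sup>2) / 2 \<le> 1 - (norm v)\<^sup>2"
    using 1 unfolding zz by (simp add: mult_ac)
  moreover have "0 < norm Q powr (2 * d) * (1 - (norm z)\<^sup>2) / 2"
  proof -
    have "(norm z)\<^sup>2 < 1" using z by (simp add: abs_square_less_1)
    then show ?thesis using Q by simp
  qed
  ultimately have "(norm v)\<^sup>2 < 1\<^sup>2" by simp
  then have "norm v < 1" by (rule power2_less_imp_less) simp
  then show ?thesis using that cv 2 by (simp add: Q_def)
qed

section \<open>Dyadic scales\<close>

lemma dyadic_scale:
  fixes y :: real
  assumes "0 < y" "y \<le> 1"
  shows "\<exists>m::nat. (1/2) ^ m \<le> y \<and> y < 2 * (1/2) ^ m"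
proof -
  obtain n where n: "(1/2::real) ^ n < y" using real_arch_pow_inv[of y "1/2"] assms by auto
  define m where "m = (LEAST m. (1/2::real) ^ m \<le> y)"
  have m: "(1/2::real) ^ m \<le> y" unfolding m_def by (rule LeastI[of _ n]) (use n in simp)
  have "y < 2 * (1/2) ^ m"
  proof (cases m)
    case 0
    then show ?thesis using assms by simp
  next
    case (Suc k)
    then have "\<not> (1/2::real) ^ k \<le> y" using not_less_Least[of k "\<lambda>m. (1/2::real) ^ m \<le> y"] by (simp add: m_def)
    then show ?thesis using Suc by simp
  qed
  then show ?thesis using m by blast
qed

lemma half_power_powr: "((1/2::real) ^ m) powr e = ((1/2) powr e) ^ m"
  by (simp add: powr_power powr_realpow[symmetric] powr_powr mult.commute)

lemma sum_over_classes_le: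
  fixes wt :: "'a \<Rightarrow> real" and mm kk :: "'a \<Rightarrow> nat"
  assumes B: "finite B" and x: "0 \<le> x" "x < 1" and M: "M \<ge> 0"
    and cl: "\<And>m k. sum wt {b \<in> B. (mm b, kk b) = (m, k)} \<le> M * (x ^ m * x ^ k)"
  shows "sum wt B \<le> M * (1 / (1 - x))\<^sup>2"
proof -
  define n where "n = Max (insert 0 (mm ` B \<union> kk ` B))"
  have le: "mm b \<le> n" "kk b \<le> n" if "b \<in> B" for b
    unfolding n_def using that B by (auto intro!: Max_ge)
  have geo: "(\<Sum>m\<le>n. x ^ m) \<le> 1 / (1 - x)"
  proof -
    have "(\<Sum>m\<le>n. x ^ m) \<le> (\<Sum>m. x ^ m)" using x by (intro sum_le_suminf summable_geometric) auto
    then show ?thesis using x by (simp add: suminf_geometric)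
  qed
  have "sum wt B = (\<Sum>y\<in>{..n} \<times> {..n}. sum wt {b \<in> B. (mm b, kk b) = y})"
    using le by (intro sum.group[symmetric] B) auto
  also have "\<dots> \<le> (\<Sum>(m, k)\<in>{..n} \<times> {..n}. M * (x ^ m * x ^ k))"
  proof (rule sum_mono)
    fix y assume "y \<in> {..n} \<times> {..n}"
    obtain m k where y: "y = (m, k)" by fastforce
    show "sum wt {b \<in> B. (mm b, kk b) = y} \<le> (case y of (m, k) \<Rightarrow> M * (x ^ m * x ^ k))"
      unfolding y prod.case by (rule cl)
  qed
  also have "\<dots> = (\<Sum>m\<le>n. \<Sum>k\<le>n. M * (x ^ m * x ^ k))" by (rule sum.cartesian_product[symmetric])
  also have "\<dots> = M * ((\<Sum>m\<le>n. x ^ m) * (\<Sum>k\<le>n. x ^ k))"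
    by (simp only: sum_distrib_left[symmetric] sum_distrib_right[symmetric])
  also have "\<dots> \<le> M * ((1 / (1 - x)) * (1 / (1 - x)))"
    using geo x M by (intro mult_left_mono mult_mono sum_nonneg) auto
  finally show ?thesis by (simp add: power2_eq_square)
qed

text \<open>A positive power of both scales makes the sum over classes a product of two geometric
  series. The 2 in \<open>2 * \<eta> b \<le> D b\<close> absorbs the dyadic rounding of
  \<open>D\<close>, so in a nonempty class the height scale does not exceed the distance
  scale.\<close>

lemma sum_over_dyadic_scales_le:
  fixes wt \<eta> D :: "'a \<Rightarrow> real"
  assumes B: "finite B" "\<And>b. b \<in> B \<Longrightarrow> 0 < \<eta> b \<and> 2 * \<eta> b \<le> D b \<and> D b \<le> 1" and e: "e > 0" and M: "M \<ge> 0"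
    and cl: "\<And>m k B'. B' \<subseteq> B \<Longrightarrow> (1/2) ^ m \<le> ((1/2) ^ k :: real) \<Longrightarrow>
      (\<And>b. b \<in> B' \<Longrightarrow> (1/2) ^ m \<le> \<eta> b \<and> \<eta> b < 2 * (1/2) ^ m \<and> (1/2) ^ k \<le> D b \<and> D b < 2 * (1/2) ^ k) \<Longrightarrow>
      sum wt B' \<le> M * (((1/2) ^ m) powr e * ((1/2) ^ k) powr e)"
  shows "sum wt B \<le> M * (1 / (1 - (1/2) powr e))\<^sup>2"
proof -
  define P where "P y m \<longleftrightarrow> (1/2) ^ m \<le> y \<and> y < 2 * (1/2) ^ m" for y :: real and m :: nat
  define mm where "mm b = (SOME m. P (\<eta> b) m)" for b
  define kk where "kk b = (SOME k. P (D b) k)" for b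
  have mm: "P (\<eta> b) (mm b)" and kk: "P (D b) (kk b)" if "b \<in> B" for b
  proof -
    have "\<exists>m. P (\<eta> b) m" unfolding P_def using B(2)[OF that] by (intro dyadic_scale) auto
    then show "P (\<eta> b) (mm b)" unfolding mm_def by (rule someI_ex)
    have "\<exists>m. P (D b) m" unfolding P_def using B(2)[OF that] by (intro dyadic_scale) auto
    then show "P (D b) (kk b)" unfolding kk_def by (rule someI_ex)
  qed
  show ?thesis
  proof (rule sum_over_classes_le[where mm = mm and kk = kk, OF B(1) _ _ M])
    show "(1/2) powr e < (1::real)" using e powr_less_mono2_neg[of "- e" "1" "2::real"]
      by (simp add: powr_divide powr_minus field_simps)
    fix m k
    define B' where "B' = {b \<in> B. (mm b, kk b) = (m, k)}"
    show "sum wt {b \<in> B. (mm b, kk b) = (m, k)} \<le> M * (((1/2) powr e) ^ m * ((1/2) powr e) ^ k)"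
    proof (cases "B' = {}")
      case True
      then have "sum wt {b \<in> B. (mm b, kk b) = (m, k)} = 0" by (simp only: B'_def sum.empty)
      then show ?thesis using M by (simp only:) simp
    next
      case False
      then obtain b where b: "b \<in> B" "mm b = m" "kk b = k" by (auto simp: B'_def)
      have "(1/2) ^ m \<le> ((1/2) ^ k :: real)"
        using mm[OF b(1)] kk[OF b(1)] B(2)[OF b(1)] unfolding P_def b by linarith
      then have "sum wt B' \<le> M * (((1/2) ^ m) powr e * ((1/2) ^ k) powr e)"
      proof (rule cl[rotated])
        show "B' \<subseteq> B" by (auto simp: B'_def)
        fix b assume "b \<in> B'"
        then have "b \<in> B" "mm b = m" "kk b = k" by (auto simp: B'_def)
        then show "(1/2) ^ m \<le> \<eta> b \<and> \<eta> b < 2 * (1/2) ^ m \<and> (1/2) ^ k \<le> D b \<and> D b < 2 * (1/2) ^ k"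
          using mm[of b] kk[of b] by (auto simp: P_def)
      qed
      then show ?thesis by (simp only: B'_def half_power_powr)
    qed
  qed auto
qed

lemma log_powr_le:
  fixes N0 :: nat and q e :: real
  assumes "N0 > 0" "q \<ge> 0" "e > 0"
  obtains C where "C > 0" "\<And>m. (1 + ln (N0 * 4 ^ m)) powr q \<le> C * ((1/2) ^ m) powr (- e)"
proof -
  \<comment> \<open>The q-th power multiplies the loss by q; dividing by q + 1 keeps it below
    \<open>e\<close> and also makes sense for \<open>q = 0\<close>.\<close>
  define e' where "e' = e / (q + 1)"
  have e': "e' > 0" "e' * q \<le> e" using assms by (auto simp: e'_def field_simps)
  define A where "A = 1 + ln N0 + 2 / e'"
  have A: "A \<ge> 1" using assms e' by (simp add: A_def)
  have "(1 + ln (N0 * 4 ^ m)) powr q \<le> (A powr q) * ((1/2) ^ m) powr (- e)" for m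
  proof -
    define t :: real where "t = (1/2) ^ m"
    have t: "0 < t" "t \<le> 1" by (auto simp: t_def power_le_one)
    have ln4: "ln (4::real) = 2 * ln 2" using ln_realpow[of "2::real" 2] by simp
    have ln_N: "ln (N0 * 4 ^ m) = ln N0 + 2 * (m * ln 2)"
      using assms by (simp add: ln_mult ln_realpow ln4)
    have le1: "1 + e' * (m * ln 2) \<le> t powr (- e')"
    proof -
      have "t powr (- e') = exp (e' * (m * ln 2))"
        using t by (simp add: powr_def t_def ln_realpow ln_div)
      then show ?thesis using exp_ge_add_one_self[of "e' * (m * ln 2)"] by simp
    qed
    have "0 \<le> e' * (m * ln 2)" using e' by simp
    then have 1: "1 \<le> t powr (- e')" using le1 by linarith
    have "m * ln 2 * e' \<le> t powr (- e')" using le1 by (simp add: mult_ac)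
    then have 2: "m * ln 2 \<le> t powr (- e') / e'" using e' by (simp add: pos_le_divide_eq)
    have "1 + ln (N0 * 4 ^ m) = (1 + ln N0) + 2 * (m * ln 2)"
      using ln_N by simp
    also have "\<dots> \<le> (1 + ln N0) * t powr (- e') + 2 * (t powr (- e') / e')"
      using 1 2 assms mult_left_mono[OF 1, of "1 + ln N0"] by (intro add_mono) auto
    also have "\<dots> = A * t powr (- e')" by (simp add: A_def algebra_simps)
    finally have le: "1 + ln (N0 * 4 ^ m) \<le> A * t powr (- e')" .
    have "(1::real) \<le> N0 * 4 ^ m"
    proof -
      have "1 * 1 \<le> real N0 * 4 ^ m" using assms by (intro mult_mono) auto
      then show ?thesis by simp
    qed
    then have "0 \<le> ln (N0 * 4 ^ m)" by simp
    then have "(1 + ln (N0 * 4 ^ m)) powr q \<le> (A * t powr (- e')) powr q"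
      using le assms by (intro powr_mono2) auto
    also have "\<dots> = A powr q * t powr (- (e' * q))" using A by (simp add: powr_mult powr_powr)
    also have "\<dots> \<le> A powr q * t powr (- e)"
      using e' t by (intro mult_left_mono powr_mono') auto
    finally show ?thesis by (simp add: t_def)
  qed
  moreover have "A powr q > 0" using A by simp
  ultimately show ?thesis using that by blast
qed

section \<open>Distances to boundary sets and nonnegativity of zero orders\<close>

lemma infdist_ge_one_minus_norm:
  fixes F :: "complex set"
  assumes "F \<noteq> {}" "F \<subseteq> sphere 0 1"
  shows "1 - norm z \<le> infdist z F"
proof -
  have "1 - norm z \<le> dist z y" if "y \<in> F" for y
    using that assms norm_triangle_ineq3[of y z] by (auto simp: dist_norm norm_minus_commute)
  then show ?thesis using assms by (auto simp: infdist_def intro!: cINF_greatest)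
qed

lemma infdist_le_2:
  fixes F :: "complex set"
  assumes "F \<noteq> {}" "F \<subseteq> sphere 0 1" "norm z \<le> 1"
  shows "infdist z F \<le> 2"
proof -
  obtain y where y: "y \<in> F" using assms by auto
  have "infdist z F \<le> dist z y" by (rule infdist_le[OF y])
  also have "\<dots> \<le> norm z + norm y" unfolding dist_norm by (rule norm_triangle_ineq4)
  finally show ?thesis using assms y by auto
qed

text \<open>The dilation moves \<open>z\<close> by no more than the height of the new point, and
  that height is itself a lower bound for the new distance to F.\<close>

lemma infdist_scale:
  fixes F :: "complex set"
  assumes F: "F \<noteq> {}" "F \<subseteq> sphere 0 1" and z: "norm z \<le> 1" and r: "0 \<le> r" "r \<le> 1"
  shows "infdist z F \<le> 2 * infdist (of_real r * z) F"
proof -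
  have "infdist z F \<le> infdist (of_real r * z) F + norm (z - of_real r * z)" by (rule infdist_triangle_norm)
  also have "z - of_real r * z = of_real (1 - r) * z" by (simp add: algebra_simps)
  also have "norm (of_real (1 - r) * z) = (1 - r) * norm z" using r by (simp add: norm_mult del: of_real_diff)
  also have "(1 - r) * norm z \<le> 1 - norm (of_real r * z)"
    using r z by (simp add: norm_mult algebra_simps)
  also have "\<dots> \<le> infdist (of_real r * z) F" by (rule infdist_ge_one_minus_norm[OF F])
  finally show ?thesis by simp
qed

lemma zorder_nonneg_ball:
  assumes "f holomorphic_on ball 0 1" "norm (f 0) = 1" "b \<in> ball 0 1"
  shows "zorder f b \<ge> 0"
proof -
  have "\<exists>w\<in>ball 0 1. f w \<noteq> 0" using assms by (intro bexI[of _ 0]) auto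
  from zorder_exist_zero[OF assms(1) open_ball connected_ball assms(3) this]
  show ?thesis by (auto split: if_splits)
qed

section \<open>Zeros measured against F\<close>

text \<open>On the circle the dilation keeps the height of the image at least \<tau>, and the push
  keeps its distance from F at least \<open>max (infdist w F) \<delta>\<close> up to a logarithm.
  The majorant thus becomes a constant times the function whose grid mean is assumed to be
  bounded.\<close>

lemma zeros_sum_at_scale_F:
  fixes F :: "complex set" and f :: "complex \<Rightarrow> complex"
  assumes F: "F \<noteq> {}" "F \<subseteq> sphere 0 1" and pq: "p \<ge> 0" "q \<ge> 0"
    and f: "f holomorphic_on ball 0 1" "norm (f 0) = 1" and K: "K > 0"
    and bd: "\<And>z. z \<in> ball 0 1 \<Longrightarrow> f z \<noteq> 0 \<Longrightarrow> ln (norm (f z)) \<le> K / (1 - norm z) powr p / infdist z F powr q"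
    and \<tau>: "0 < \<tau>" "\<tau> \<le> \<delta>" and \<delta>: "\<delta> \<le> 1" and N: "16 / \<tau> \<le> real N"
    and mean: "\<And>w. norm w = 1 \<Longrightarrow> (\<Sum>u\<in>{z. z ^ N = 1}. max (infdist (w * u) F) \<delta> powr (- q)) \<le> N * A"
    and B: "finite B" "B \<subseteq> ball 0 1" "\<And>b. b \<in> B \<Longrightarrow> 16 * \<tau> \<le> 1 - norm b \<and> 8 * \<delta> \<le> infdist b F"
  shows "(\<Sum>b\<in>B. of_int (zorder f b) * (1 - norm b))
    \<le> 4 * (K * \<tau> powr (- p) * (3072 * (1 + ln N)) powr q * A)"
proof -
  have \<delta>0: "\<delta> > 0" using \<tau> by simp
  have N\<delta>: "16 / \<delta> \<le> N"
  proof -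
    have "16 / \<delta> \<le> 16 / \<tau>" using \<tau> by (intro divide_left_mono) auto
    then show ?thesis using N by simp
  qed
  have N0: "N > 0" using N \<tau> by (intro gr0I) (auto simp: field_simps)
  define \<Lambda> where "\<Lambda> = 1 + ln N"
  have \<Lambda>: "\<Lambda> \<ge> 1" using N0 by (simp add: \<Lambda>_def)
  obtain \<psi> S where \<psi>: "open S" "cball 0 1 \<subseteq> S" "\<psi> holomorphic_on S" "\<psi> ` S \<subseteq> ball 0 1" "\<psi> 0 = 0"
    and \<psi>1: "\<And>w. norm w = 1 \<Longrightarrow> infdist w F < \<delta> / 2 \<Longrightarrow> norm (\<psi> w) \<le> 1 - \<delta> / (3072 * \<Lambda>)"
    and \<psi>2: "\<And>w. norm w = 1 \<Longrightarrow> norm (\<psi> w - w) \<le> \<delta> / 4"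
    and \<psi>3: "\<And>v. norm v < 1 \<Longrightarrow> 1 / N \<le> 1 - norm v \<Longrightarrow> 7 * \<delta> \<le> infdist v F \<Longrightarrow>
      \<exists>w. norm w < 1 \<and> \<psi> w = v \<and> (1 - norm v) / 2 \<le> 1 - norm w"
    unfolding \<Lambda>_def by (rule push_away_map[OF F \<delta>0 \<delta> N\<delta>]) blast
  define Psi where "Psi w = of_real (1 - \<tau>) * \<psi> w" for w
  have \<tau>1: "\<tau> \<le> 1" using \<tau> \<delta> by simp
  have \<psi>lt: "norm (\<psi> w) < 1" if "w \<in> S" for w using \<psi>(4) that by auto
  have nPsi: "norm (Psi w) = (1 - \<tau>) * norm (\<psi> w)" for w
    using \<tau>1 by (simp add: Psi_def norm_mult del: of_real_diff)
  have nPsi_le: "norm (Psi w) \<le> norm (\<psi> w)" for w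
    unfolding nPsi using \<tau> \<tau>1 by (intro mult_left_le_one_le) auto
  have Psi_tau: "norm (Psi w) \<le> 1 - \<tau>" if "w \<in> S" for w
  proof -
    have "(1 - \<tau>) * norm (\<psi> w) \<le> (1 - \<tau>) * 1" using \<psi>lt[OF that] \<tau>1 by (intro mult_left_mono) auto
    then show ?thesis by (simp add: nPsi)
  qed
  have "\<exists>w. norm w < 1 \<and> Psi w = b \<and> (1 - norm b) / 4 \<le> 1 - norm w" if b: "b \<in> B" for b
  proof -
    define \<eta> where "\<eta> = 1 - norm b"
    have \<eta>: "16 * \<tau> \<le> \<eta>" "8 * \<delta> \<le> infdist b F" "\<eta> \<le> 1" using B(3)[OF b] by (auto simp: \<eta>_def)
    \<comment> \<open>\<open>v\<close> undoes the dilation. Because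
      \<open>16 * \<tau> \<le> \<eta>\<close>, this costs at most one sixteenth of the height, so
      together with the halving by \<psi> a quarter of the height remains.\<close>
    define v where "v = b / of_real (1 - \<tau>)"
    have t1: "\<tau> < 1" using \<eta> \<tau> by simp
    have nv: "norm v = (1 - \<eta>) / (1 - \<tau>)" using t1 by (simp add: v_def \<eta>_def norm_divide del: of_real_diff)
    have vb: "b = of_real (1 - \<tau>) * v" using t1 by (simp add: v_def del: of_real_diff)
    have "1 - norm v = (\<eta> - \<tau>) / (1 - \<tau>)" unfolding nv using t1 by (simp add: field_simps)
    also have "\<dots> \<ge> (\<eta> - \<tau>) / 1" using t1 \<tau> \<eta> by (intro divide_left_mono) auto
    finally have v1: "\<eta> - \<tau> \<le> 1 - norm v" by simp
    then have v2: "norm v < 1" using \<eta> \<tau> by simp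
    have "1 / N \<le> \<tau>" using N N0 \<tau> by (simp add: field_simps)
    then have v3: "1 / N \<le> 1 - norm v" using v1 \<eta> \<tau> by simp
    have "infdist b F \<le> infdist v F + norm (b - v)" by (rule infdist_triangle_norm)
    also have "b - v = - (of_real \<tau> * v)" unfolding vb by (simp add: algebra_simps)
    also have "norm (- (of_real \<tau> * v)) \<le> \<tau> * 1"
      unfolding norm_minus_cancel norm_mult using v2 \<tau> by (intro mult_mono) auto
    finally have "7 * \<delta> \<le> infdist v F" using \<eta> \<tau> by simp
    from \<psi>3[OF v2 v3 this] obtain w where "norm w < 1" "\<psi> w = v" "(1 - norm v) / 2 \<le> 1 - norm w" by blast
    moreover have "(1 - norm b) / 4 \<le> (1 - norm v) / 2" using v1 \<eta> \<tau> unfolding \<eta>_def by simp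
    ultimately show ?thesis using vb by (intro exI[of _ w]) (auto simp: Psi_def)
  qed
  then obtain a where a: "\<And>b. b \<in> B \<Longrightarrow> norm (a b) < 1 \<and> Psi (a b) = b \<and> (1 - norm b) / 4 \<le> 1 - norm (a b)"
    by metis
  define M where "M = K * \<tau> powr (- p) * (3072 * \<Lambda>) powr q"
  \<comment> \<open>Close to F the height gained by the push is the bound. Elsewhere the
    displacement \<open>\<delta> / 4\<close> is at most half the distance to F, and the dilation
    loses another factor 2.\<close>
  have dF: "max (infdist w F) \<delta> / (3072 * \<Lambda>) \<le> infdist (Psi w) F" if w: "norm w = 1" for w
  proof (cases "infdist w F < \<delta> / 2")
    case True
    have "max (infdist w F) \<delta> = \<delta>" using True \<delta>0 by simp
    moreover have "\<delta> / (3072 * \<Lambda>) \<le> 1 - norm (\<psi> w)" using \<psi>1[OF w True] by simp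
    ultimately show ?thesis using infdist_ge_one_minus_norm[OF F, of "Psi w"] nPsi_le[of w] by simp
  next
    case False
    have wS: "w \<in> S" using \<psi>(2) w by auto
    have "infdist w F \<le> infdist (\<psi> w) F + norm (w - \<psi> w)" by (rule infdist_triangle_norm)
    then have "infdist w F / 2 \<le> infdist (\<psi> w) F" using \<psi>2[OF w] False by (simp add: norm_minus_commute)
    also have "\<dots> \<le> 2 * infdist (Psi w) F" unfolding Psi_def
      using \<psi>lt[OF wS] \<tau> \<tau>1 by (intro infdist_scale F) auto
    finally have "infdist w F / 4 \<le> infdist (Psi w) F" by simp
    moreover have "max (infdist w F) \<delta> \<le> 2 * infdist w F" using False \<delta>0 by simp
    ultimately have "max (infdist w F) \<delta> / 8 \<le> infdist (Psi w) F" by simp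
    moreover have "max (infdist w F) \<delta> / (3072 * \<Lambda>) \<le> max (infdist w F) \<delta> / 8"
      using \<Lambda> \<delta>0 by (intro divide_left_mono) (auto simp: less_max_iff_disj)
    ultimately show ?thesis by linarith
  qed
  have "(\<Sum>b\<in>B. of_int (zorder f b) * (1 - norm (a b))) \<le> M * A"
  proof (rule zeros_sum_le_of_subordination[OF f \<psi>(1,2), where Psi = Psi and U = "{z. z ^ N = 1}"
        and h = "\<lambda>w. M * max (infdist w F) \<delta> powr (- q)"])
    show "Psi holomorphic_on S" unfolding Psi_def by (intro holomorphic_intros \<psi>(3))
    show "Psi ` S \<subseteq> ball 0 1" using \<psi>lt by (auto intro!: le_less_trans[OF nPsi_le])
    show "Psi 0 = 0" using \<psi>(5) by (simp add: Psi_def)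
    show "finite B" "B \<subseteq> ball 0 1" by (rule B)+
    show "norm (a b) < 1 \<and> Psi (a b) = b" if "b \<in> B" for b using a[OF that] by simp
    show "finite {z::complex. z ^ N = 1}" using N0 by (intro finite_roots_unity) auto
    show "{z::complex. z ^ N = 1} \<noteq> {}" by (auto intro: exI[of _ 1])
    show "{z::complex. z ^ N = 1} \<subseteq> sphere 0 1" using power_eq_1_iff[of _ N] N0 by auto
    fix w :: complex assume w: "norm w = 1"
    have wS: "w \<in> S" using \<psi>(2) w by auto
    show "ln (norm (f (Psi w))) \<le> M * max (infdist w F) \<delta> powr (- q)" if nz: "f (Psi w) \<noteq> 0"
    proof -
      define m where "m = max (infdist w F) \<delta>"
      have m: "m > 0" using \<delta>0 by (simp add: m_def less_max_iff_disj)
      have "Psi w \<in> ball 0 1" using nPsi_le[of w] \<psi>lt[OF wS] by simp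
      then have "ln (norm (f (Psi w))) \<le> K / (1 - norm (Psi w)) powr p / infdist (Psi w) F powr q"
        using bd nz by blast
      also have "\<dots> \<le> K / \<tau> powr p / (m / (3072 * \<Lambda>)) powr q"
        using Psi_tau[OF wS] dF[OF w] \<tau> K \<Lambda> m pq unfolding m_def[symmetric]
        by (intro frac_le powr_mono2 divide_nonneg_pos) auto
      also have "\<dots> = M * m powr (- q)"
        using \<Lambda> m by (simp add: M_def powr_minus powr_divide field_simps)
      finally show ?thesis by (simp add: m_def)
    qed
    have "(\<Sum>u\<in>{z. z ^ N = 1}. M * max (infdist (w * u) F) \<delta> powr (- q)) \<le> M * (N * A)"
      unfolding sum_distrib_left[symmetric] using mean[OF w] K by (intro mult_left_mono) (auto simp: M_def)
    then show "(\<Sum>u\<in>{z. z ^ N = 1}. M * max (infdist (w * u) F) \<delta> powr (- q))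
        \<le> real (card {z::complex. z ^ N = 1}) * (M * A)"
      using card_roots_unity_eq[OF N0] by (simp add: mult_ac)
  qed
  moreover have "(\<Sum>b\<in>B. of_int (zorder f b) * (1 - norm b))
      \<le> (\<Sum>b\<in>B. 4 * (of_int (zorder f b) * (1 - norm (a b))))"
  proof (rule sum_mono)
    fix b assume b: "b \<in> B"
    have "of_int (zorder f b) * (1 - norm b) \<le> of_int (zorder f b) * (4 * (1 - norm (a b)))"
      using a[OF b] zorder_nonneg_ball[OF f, of b] B(2) b by (intro mult_left_mono) auto
    then show "of_int (zorder f b) * (1 - norm b) \<le> 4 * (of_int (zorder f b) * (1 - norm (a b)))"
      by (simp add: mult_ac)
  qed
  ultimately show ?thesis unfolding sum_distrib_left[symmetric] M_def \<Lambda>_def by linarith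
qed

text \<open>Budget for \<epsilon>: the exponent \<open>a\<close> lies within
  \<open>\<epsilon> / 2\<close> of the type, which the \<epsilon> inside \<open>s\<close> covers;
  the count of layers and the logarithm cost \<open>\<epsilon> / 4\<close> each. What remains of the
  \<epsilon> on the height still yields \<open>\<epsilon> / 4\<close> on each scale for the dyadic
  summation.\<close>

lemma zeros_sum_F:
  fixes F :: "complex set" and p q \<epsilon> :: real
  assumes F: "F \<noteq> {}" "F \<subseteq> sphere 0 1" and pq: "p \<ge> 0" "q \<ge> 0" and \<epsilon>: "\<epsilon> > 0"
  defines "s \<equiv> max (q - ahern_clark_type F + \<epsilon>) 0"
  obtains C where "C > 0"
    "\<And>f K B. K > 0 \<Longrightarrow> f holomorphic_on ball 0 1 \<Longrightarrow> norm (f 0) = 1 \<Longrightarrow>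
      (\<And>z. z \<in> ball 0 1 \<Longrightarrow> f z \<noteq> 0 \<Longrightarrow> ln (norm (f z)) \<le> K / (1 - norm z) powr p / infdist z F powr q) \<Longrightarrow>
      finite B \<Longrightarrow> B \<subseteq> ball 0 1 \<Longrightarrow>
      (\<Sum>b\<in>B. of_int (zorder f b) * (1 - norm b) powr (p + 1 + \<epsilon>) * infdist b F powr s) \<le> C * K"
proof -
  obtain a C0 where a: "a \<ge> 0" "ahern_clark_type F - \<epsilon> / 2 < a" "C0 > 0"
    "\<And>x. 0 < x \<Longrightarrow> circle_nbhd_measure F x \<le> C0 * x powr a"
    using ahern_clark_exponent[OF F, of "\<epsilon> / 2"] \<epsilon> by auto
  have \<epsilon>4: "\<epsilon> / 4 > 0" using \<epsilon> by simp
  define s' where "s' = max (q - a) 0 + \<epsilon> / 4"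
  obtain D where D: "D > 0" "\<And>k N w. 16 * 2 ^ k \<le> real N \<Longrightarrow> norm w = 1 \<Longrightarrow>
     (\<Sum>u\<in>{z. z ^ N = 1}. max (infdist (w * u) F) ((1/2) ^ k) powr (- q)) \<le> N * (D * ((1/2) ^ k) powr (- s'))"
    using mean_dist_powr_le[OF F a(1,3,4) pq(2) \<epsilon>4] unfolding s'_def by metis
  obtain Cl where Cl: "Cl > 0" "\<And>m. (1 + ln (real 16 * 4 ^ m)) powr q \<le> Cl * ((1/2) ^ m) powr (- (\<epsilon> / 4))"
    using log_powr_le[of 16 q "\<epsilon> / 4"] pq \<epsilon>4 by auto
  have s: "s \<ge> 0" "s' \<le> s + \<epsilon> / 4" using a \<epsilon> by (auto simp: s_def s'_def)
  define C1 where "C1 = 32 powr (p + \<epsilon>) * 16 powr s * 4 * 3072 powr q * Cl * D"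
  have C1: "C1 > 0" unfolding C1_def using Cl D by simp
  define C where "C = C1 * (1 / (1 - (1/2) powr (\<epsilon> / 4)))\<^sup>2"
  have half: "(1/2) powr (\<epsilon> / 4) < (1::real)"
    using \<epsilon> powr_less_mono2[of "\<epsilon> / 4" "1/2" "1::real"] by simp
  have C: "C > 0" unfolding C_def using C1 half by (intro mult_pos_pos zero_less_power divide_pos_pos) auto
  have "(\<Sum>b\<in>B. of_int (zorder f b) * (1 - norm b) powr (p + 1 + \<epsilon>) * infdist b F powr s) \<le> C * K"
    if K: "K > 0" and f: "f holomorphic_on ball 0 1" "norm (f 0) = 1"
      and bd: "\<And>z. z \<in> ball 0 1 \<Longrightarrow> f z \<noteq> 0 \<Longrightarrow> ln (norm (f z)) \<le> K / (1 - norm z) powr p / infdist z F powr q"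
      and B: "finite B" "B \<subseteq> ball 0 1" for f K B
  proof -
    define wt where "wt b = of_int (zorder f b) * (1 - norm b) powr (p + 1 + \<epsilon>) * infdist b F powr s" for b
    have "sum wt B \<le> (C1 * K) * (1 / (1 - (1/2) powr (\<epsilon> / 4)))\<^sup>2"
    proof (rule sum_over_dyadic_scales_le[where \<eta> = "\<lambda>b. (1 - norm b) / 16" and D = "\<lambda>b. infdist b F / 8",
          OF B(1) _ \<epsilon>4])
      show "0 < (1 - norm b) / 16 \<and> 2 * ((1 - norm b) / 16) \<le> infdist b F / 8 \<and> infdist b F / 8 \<le> 1"
        if "b \<in> B" for b
      proof -
        have "norm b < 1" using that B by auto
        then show ?thesis using infdist_ge_one_minus_norm[OF F, of b] infdist_le_2[OF F, of b] by auto
      qed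
      show "0 \<le> C1 * K" using C1 K by simp
      fix m k :: nat and B'
      assume B': "B' \<subseteq> B" and mk: "(1/2) ^ m \<le> ((1/2) ^ k :: real)"
        and cl: "\<And>b. b \<in> B' \<Longrightarrow> (1/2) ^ m \<le> (1 - norm b) / 16 \<and> (1 - norm b) / 16 < 2 * (1/2) ^ m \<and>
          (1/2) ^ k \<le> infdist b F / 8 \<and> infdist b F / 8 < 2 * (1/2) ^ k"
      define \<tau> :: real where "\<tau> = (1/2) ^ m"
      define \<delta> :: real where "\<delta> = (1/2) ^ k"
      \<comment> \<open>N enters the bound only through its logarithm, so any fixed power of 1 /
        \<tau> is affordable.\<close>
      define N :: nat where "N = 16 * 4 ^ m"
      have \<tau>: "0 < \<tau>" "\<tau> \<le> \<delta>" and \<delta>: "0 < \<delta>" "\<delta> \<le> 1" using mk by (auto simp: \<tau>_def \<delta>_def power_le_one)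
      have "(2::real) ^ m \<le> 4 ^ m" by (intro power_mono) auto
      then have N1: "16 / \<tau> \<le> real N" by (simp add: \<tau>_def N_def power_divide)
      have "16 / \<delta> \<le> 16 / \<tau>" using \<tau> \<delta> by (intro divide_left_mono) auto
      then have N2: "16 * 2 ^ k \<le> real N" using N1 by (simp add: \<delta>_def power_divide)
      have "(\<Sum>b\<in>B'. of_int (zorder f b) * (1 - norm b))
          \<le> 4 * (K * \<tau> powr (- p) * (3072 * (1 + ln N)) powr q * (D * \<delta> powr (- s')))"
      proof (rule zeros_sum_at_scale_F[OF F pq f K bd \<tau> \<delta>(2) N1])
        show "(\<Sum>u\<in>{z. z ^ N = 1}. max (infdist (w * u) F) \<delta> powr (- q)) \<le> N * (D * \<delta> powr (- s'))"
          if "norm w = 1" for w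
          unfolding \<delta>_def by (rule D(2)[OF N2 that])
        show "finite B'" "B' \<subseteq> ball 0 1" using B' B by (auto intro: finite_subset)
        show "16 * \<tau> \<le> 1 - norm b \<and> 8 * \<delta> \<le> infdist b F" if "b \<in> B'" for b
          using cl[OF that] by (simp add: \<tau>_def \<delta>_def)
      qed
      also have "\<dots> = 4 * 3072 powr q * D * K * \<tau> powr (- p) * \<delta> powr (- s') * (1 + ln N) powr q"
      proof -
        have "(3072 * (1 + ln (real N))) powr q = 3072 powr q * (1 + ln (real N)) powr q"
          by (rule powr_mult)
        then show ?thesis by (simp only: mult_ac)
      qed
      also have "\<dots> \<le> 4 * 3072 powr q * D * K * \<tau> powr (- p) * \<delta> powr (- s') * (Cl * \<tau> powr (- (\<epsilon> / 4)))"
        using Cl(2)[of m] D(1) K by (intro mult_left_mono) (auto simp: N_def \<tau>_def)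
      finally have sum: "(\<Sum>b\<in>B'. of_int (zorder f b) * (1 - norm b))
          \<le> 4 * 3072 powr q * D * K * \<tau> powr (- p) * \<delta> powr (- s') * (Cl * \<tau> powr (- (\<epsilon> / 4)))" .
      have "sum wt B' \<le> (\<Sum>b\<in>B'. ((32 * \<tau>) powr (p + \<epsilon>) * (16 * \<delta>) powr s) * (of_int (zorder f b) * (1 - norm b)))"
      proof (rule sum_mono)
        fix b assume b: "b \<in> B'"
        then have b1: "b \<in> ball 0 1" "norm b < 1" using B' B by auto
        have z: "0 \<le> zorder f b" by (rule zorder_nonneg_ball[OF f b1(1)])
        have "(1 - norm b) powr (p + 1 + \<epsilon>) = (1 - norm b) powr (p + \<epsilon>) * (1 - norm b)"
          using b1 powr_add[of "1 - norm b" "p + \<epsilon>" 1] by (simp add: add_ac)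
        then have "wt b = (of_int (zorder f b) * (1 - norm b)) * ((1 - norm b) powr (p + \<epsilon>) * infdist b F powr s)"
          by (simp add: wt_def)
        also have "\<dots> \<le> (of_int (zorder f b) * (1 - norm b)) * ((32 * \<tau>) powr (p + \<epsilon>) * (16 * \<delta>) powr s)"
          using cl[OF b] b1 z pq \<epsilon> s(1) infdist_nonneg[of b F]
          by (intro mult_left_mono mult_mono powr_mono2) (auto simp: \<tau>_def \<delta>_def)
        finally show "wt b \<le> ((32 * \<tau>) powr (p + \<epsilon>) * (16 * \<delta>) powr s) * (of_int (zorder f b) * (1 - norm b))"
          by (simp add: mult_ac)
      qed
      also have "\<dots> \<le> ((32 * \<tau>) powr (p + \<epsilon>) * (16 * \<delta>) powr s) *
          (4 * 3072 powr q * D * K * \<tau> powr (- p) * \<delta> powr (- s') * (Cl * \<tau> powr (- (\<epsilon> / 4))))"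
        unfolding sum_distrib_left[symmetric] using sum by (intro mult_left_mono) auto
      also have "\<dots> = C1 * K * ((\<tau> powr (p + \<epsilon>) * \<tau> powr (- p) * \<tau> powr (- (\<epsilon> / 4))) * (\<delta> powr s * \<delta> powr (- s')))"
        using \<tau> \<delta> by (simp add: C1_def powr_mult mult_ac)
      also have "\<dots> = C1 * K * (\<tau> powr (3 * \<epsilon> / 4) * \<delta> powr (s - s'))"
        by (simp add: powr_add[symmetric])
      also have "\<dots> \<le> C1 * K * (\<tau> powr (\<epsilon> / 4) * \<delta> powr (\<epsilon> / 4))"
      proof (rule mult_left_mono)
        \<comment> \<open>Since \<open>\<tau> \<le> \<delta>\<close>, half an \<epsilon> of height
          can be traded for distance, where it outweighs the possible deficit
          \<open>s - s' \<ge> - \<epsilon> / 4\<close>.\<close>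
        have "\<tau> powr (3 * \<epsilon> / 4) * \<delta> powr (s - s') = \<tau> powr (\<epsilon> / 4) * (\<tau> powr (\<epsilon> / 2) * \<delta> powr (s - s'))"
          by (simp add: powr_add[symmetric] mult.assoc[symmetric])
        also have "\<dots> \<le> \<tau> powr (\<epsilon> / 4) * (\<delta> powr (\<epsilon> / 2) * \<delta> powr (- (\<epsilon> / 4)))"
          using \<tau> \<delta> \<epsilon> s(2) by (intro mult_left_mono mult_mono powr_mono2 powr_mono') auto
        also have "\<delta> powr (\<epsilon> / 2) * \<delta> powr (- (\<epsilon> / 4)) = \<delta> powr (\<epsilon> / 4)"
          by (simp add: powr_add[symmetric])
        finally show "\<tau> powr (3 * \<epsilon> / 4) * \<delta> powr (s - s') \<le> \<tau> powr (\<epsilon> / 4) * \<delta> powr (\<epsilon> / 4)" .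
      qed (use C1 K in auto)
      finally show "sum wt B' \<le> C1 * K * (((1/2) ^ m) powr (\<epsilon> / 4) * ((1/2) ^ k) powr (\<epsilon> / 4))"
        by (simp add: \<tau>_def \<delta>_def)
    qed
    also have "\<dots> = C * K" by (simp add: C_def)
    finally show ?thesis by (simp add: wt_def)
  qed
  with C show ?thesis by (rule that) blast+
qed

section \<open>Zeros near a point of E\<close>

lemma norm_corner_le:
  assumes "norm v < 1" "0 < d" "d \<le> 1/2"
  shows "norm (corner d v) \<le> norm v"
  using Schwarz_Lemma(1)[OF holomorphic_corner corner_0 corner_stolz(2) assms(1)] assms by blast

text \<open>Here \<open>x\<close> is the distance to the vertex before dilation, \<open>y\<close>
  the distance to e after it, and \<open>h\<close> the height. The quotient is controlled by
  \<open>(x + l) powr (r - p)\<close>, which for \<open>r \<le> p\<close> is largest at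
  \<open>x = 0\<close>.\<close>

lemma stolz_bound:
  fixes x l d p r :: real
  assumes "0 \<le> x" "0 < l" "0 < d" "0 \<le> r" "r \<le> p"
    and y: "0 \<le> y" "y \<le> x + l" and h: "d / 4 * (x + l) \<le> h"
  shows "y powr r / h powr p \<le> (4 / d) powr p * l powr (r - p)"
proof -
  have xl: "0 < x + l" using assms by simp
  have "y powr r / h powr p \<le> (x + l) powr r / (d / 4 * (x + l)) powr p"
    using assms xl by (intro frac_le powr_mono2) auto
  also have "\<dots> = (4 / d) powr p * (x + l) powr (r - p)"
    using assms xl by (simp add: powr_mult powr_divide powr_diff)
  also have "\<dots> \<le> (4 / d) powr p * l powr (r - p)"
    using assms by (intro mult_left_mono powr_mono2') auto
  finally show ?thesis .
qed

text \<open>The zeros stay near e, so F is kept away at a fixed \<delta>. The smallness of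
  \<open>c\<close> passes to the corner parameter \<open>d\<close>:
  \<open>6 * d \<le> \<delta> / 8\<close>, so the corner does not lead back to F;
  \<open>272 * c \<le> 15\<close>, so the zeros are within reach of \<open>corner_inverse\<close>;
  and \<open>2 * d \<le> \<epsilon>\<close>, so inverting the corner costs the height at most a
  multiple of \<open>\<tau> powr \<epsilon>\<close>.\<close>

lemma zeros_sum_at_scale_E:
  fixes F :: "complex set" and f :: "complex \<Rightarrow> complex" and e :: complex
  assumes F: "F \<noteq> {}" "F \<subseteq> sphere 0 1" and pq: "0 \<le> r" "r \<le> p" "q \<ge> 0" and e: "norm e = 1"
    and f: "f holomorphic_on ball 0 1" "norm (f 0) = 1" and K: "K > 0"
    and bd: "\<And>z. z \<in> ball 0 1 \<Longrightarrow> f z \<noteq> 0 \<Longrightarrow>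
      ln (norm (f z)) \<le> K / (1 - norm z) powr p * norm (z - e) powr r / infdist z F powr q"
    and \<delta>: "0 < \<delta>" "\<delta> \<le> 1" "16 * \<delta> \<le> infdist e F"
    and \<tau>: "0 < \<tau>" "\<tau> \<le> l" "\<tau> \<le> 1" and c: "0 < c" "c \<le> \<delta> / 48" "c \<le> 1 / 32" "2 * c \<le> \<epsilon>"
    and N: "16 / \<delta> \<le> real N" "16 / \<tau>\<^sup>2 \<le> real N"
    and B: "finite B" "B \<subseteq> ball 0 1"
      "\<And>b. b \<in> B \<Longrightarrow> 16 * \<tau> \<le> 1 - norm b \<and> norm (b - e) < 16 * l \<and> norm (b - e) < \<delta> / 2"
  shows "(\<Sum>b\<in>B. of_int (zorder f b) * (1 - norm b))
    \<le> 16 * \<tau> powr (- \<epsilon>) * (K * (4 / c) powr p * \<tau> powr (- p) * l powr r * (3072 * (1 + ln N) / \<delta>) powr q)"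
proof -
  have N0: "N > 0" using N(1) \<delta> by (intro gr0I) (auto simp: field_simps)
  define \<Lambda> where "\<Lambda> = 1 + ln N"
  have \<Lambda>: "\<Lambda> \<ge> 1" using N0 by (simp add: \<Lambda>_def)
  have l: "l > 0" using \<tau> by simp
  \<comment> \<open>With this opening angle the height of the image is at least a multiple of \<open>d (X + l)\<close> at distance
    \<open>X\<close> from the vertex, so for \<open>r \<le> p\<close> the majorant is bounded by its value at distance \<open>l\<close>.\<close>
  define d where "d = c * \<tau> / l"
  have d0: "0 < d" using c \<tau> l by (simp add: d_def)
  have "c * \<tau> \<le> c * l" using \<tau> c by (intro mult_left_mono) auto
  then have dc: "d \<le> c" using l by (simp add: d_def pos_divide_le_eq)
  have d: "0 < d" "d \<le> 1/2" using d0 dc c by auto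
  have e': "cnj e * e = 1" using e by (metis complex_norm_square mult.commute of_real_1 one_power2)
  obtain \<psi> S where \<psi>: "open S" "cball 0 1 \<subseteq> S" "\<psi> holomorphic_on S" "\<psi> ` S \<subseteq> ball 0 1" "\<psi> 0 = 0"
    and \<psi>1: "\<And>w. norm w = 1 \<Longrightarrow> infdist w F < \<delta> / 2 \<Longrightarrow> norm (\<psi> w) \<le> 1 - \<delta> / (3072 * \<Lambda>)"
    and \<psi>2: "\<And>w. norm w = 1 \<Longrightarrow> norm (\<psi> w - w) \<le> \<delta> / 4"
    and \<psi>3: "\<And>v. norm v < 1 \<Longrightarrow> 1 / N \<le> 1 - norm v \<Longrightarrow> 7 * \<delta> \<le> infdist v F \<Longrightarrow>
      \<exists>w. norm w < 1 \<and> \<psi> w = v \<and> (1 - norm v) / 2 \<le> 1 - norm w"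
    unfolding \<Lambda>_def by (rule push_away_map[OF F \<delta>(1,2) N(1)]) blast
  define y where "y w = cnj e * \<psi> w" for w
  define Psi where "Psi w = of_real (1 - \<tau>) * (e * corner d (y w))" for w
  have ey: "e * y w = \<psi> w" for w using e' by (simp add: y_def mult.assoc[symmetric] mult.commute)
  have ny: "norm (y w) = norm (\<psi> w)" for w using e by (simp add: y_def norm_mult)
  have ylt: "norm (y w) < 1" if "w \<in> S" for w using \<psi>(4) that by (auto simp: ny)
  have nPsi: "norm (Psi w) = (1 - \<tau>) * norm (corner d (y w))" for w
    using \<tau> e by (simp add: Psi_def norm_mult del: of_real_diff)
  have nPsi_le: "norm (Psi w) \<le> norm (corner d (y w))" for w
    unfolding nPsi using \<tau> by (intro mult_left_le_one_le) auto
  have clt: "norm (corner d (y w)) < 1" if "w \<in> S" for w using corner_stolz(2)[OF ylt[OF that] d] .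
  have Psi_tau: "norm (Psi w) \<le> 1 - \<tau>" if "w \<in> S" for w
  proof -
    have "(1 - \<tau>) * norm (corner d (y w)) \<le> (1 - \<tau>) * 1" using clt[OF that] \<tau> by (intro mult_left_mono) auto
    then show ?thesis by (simp add: nPsi)
  qed
  have "\<exists>w. norm w < 1 \<and> Psi w = b \<and> \<tau> powr \<epsilon> * (1 - norm b) / 16 \<le> 1 - norm w" if b: "b \<in> B" for b
  proof -
    define \<eta> where "\<eta> = 1 - norm b"
    have \<eta>: "16 * \<tau> \<le> \<eta>" "norm (b - e) < 16 * l" "norm (b - e) < \<delta> / 2" "\<eta> \<le> 1"
      using B(3)[OF b] by (auto simp: \<eta>_def)
    \<comment> \<open>The maps are inverted in turn: \<open>z\<close> undoes the dilation and the
      rotation of the vertex, \<open>v\<close> undoes the corner, \<open>w\<close> undoes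
      \<psi>.\<close>
    define z where "z = cnj e * b / of_real (1 - \<tau>)"
    have t1: "\<tau> < 1" using \<eta> \<tau> by simp
    have nz: "norm z = (1 - \<eta>) / (1 - \<tau>)"
      using t1 e by (simp add: z_def \<eta>_def norm_divide norm_mult del: of_real_diff)
    have zb: "b = of_real (1 - \<tau>) * (e * z)"
    proof -
      have "of_real (1 - \<tau>) * (e * z) = (cnj e * e) * b" using t1 by (simp add: z_def del: of_real_diff)
      then show ?thesis using e' by simp
    qed
    have "1 - norm z = (\<eta> - \<tau>) / (1 - \<tau>)" unfolding nz using t1 by (simp add: field_simps)
    also have "\<dots> \<ge> (\<eta> - \<tau>) / 1" using t1 \<tau> \<eta> by (intro divide_left_mono) auto
    finally have z1: "\<eta> - \<tau> \<le> 1 - norm z" by simp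
    then have z2: "norm z < 1" using \<eta> \<tau> by simp
    have "b - e * z = - (of_real \<tau> * (e * z))" by (subst zb) (simp add: algebra_simps)
    then have "norm (b - e * z) = \<tau> * norm z" using e \<tau> by (simp add: norm_mult)
    also have "\<dots> \<le> \<tau> * 1" using z2 \<tau> by (intro mult_left_mono) auto
    finally have bz: "norm (b - e * z) \<le> \<tau>" by simp
    have "norm (1 - z) = norm (e * (1 - z))" using e by (simp add: norm_mult)
    also have "e * (1 - z) = (b - e * z) - (b - e)" by (simp add: algebra_simps)
    also have "norm \<dots> \<le> norm (b - e * z) + norm (b - e)" by (rule norm_triangle_ineq4)
    finally have Q: "norm (1 - z) \<le> \<tau> + norm (b - e)" using bz by simp
    have "norm e - norm b \<le> norm (b - e)" using norm_triangle_ineq3[of e b] by (simp add: norm_minus_commute)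
    then have \<eta>b: "\<eta> \<le> norm (b - e)" using e by (simp add: \<eta>_def)
    have Q1: "norm (1 - z) \<le> 1" using Q \<eta> \<eta>b \<delta> by simp
    have z3: "1 - norm z \<le> 1 - (norm z)\<^sup>2"
      using z2 by (simp add: power2_eq_square mult_left_le_one_le)
    \<comment> \<open>The zero lies within \<open>16 * l\<close> of e and the dilation adds at most
      \<open>\<tau> \<le> l\<close>. With \<open>d * l = c * \<tau>\<close> the required margin is a
      small multiple of \<tau>, while the height of \<open>z\<close> is at least
      \<open>15 * \<tau>\<close>.\<close>
    have st: "16 * d * norm (1 - z) \<le> 1 - (norm z)\<^sup>2"
    proof -
      have "16 * d * norm (1 - z) \<le> 16 * d * (17 * l)" using Q \<eta> \<tau> d0 by (intro mult_left_mono) auto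
      also have "\<dots> = 272 * c * \<tau>" using l by (simp add: d_def)
      also have "\<dots> \<le> 15 * \<tau>" using c \<tau> by (intro mult_right_mono) auto
      finally show ?thesis using z1 z3 \<eta> by simp
    qed
    obtain v where v: "norm v < 1" "corner d v = z"
      "norm (1 - z) powr (2 * d) * (1 - (norm z)\<^sup>2) / 2 \<le> 1 - (norm v)\<^sup>2"
      by (rule corner_inverse[OF z2 Q1 d st])
    have Qt: "\<tau> \<le> norm (1 - z)" using norm_triangle_ineq2[of 1 z] z1 \<eta> \<tau> by simp
    have pw: "\<tau> powr x \<le> norm (1 - z) powr (2 * d)" if "2 * d \<le> x" for x
    proof -
      have "\<tau> powr x \<le> \<tau> powr (2 * d)" using \<tau> that by (intro powr_mono') auto
      also have "\<dots> \<le> norm (1 - z) powr (2 * d)" using Qt \<tau> d by (intro powr_mono2) auto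
      finally show ?thesis .
    qed
    \<comment> \<open>Used with two exponents: \<open>x = 1\<close> gives height at least \<tau>
      squared, which is why N has to be of that order for inverting \<psi>;
      \<open>x = \<epsilon>\<close> gives the sharp loss in the final estimate.\<close>
    have v4: "\<tau> powr x * (15 / 16 * \<eta>) / 4 \<le> 1 - norm v" if "2 * d \<le> x" for x
    proof -
      have "\<tau> powr x * (15 / 16 * \<eta>) / 2 \<le> norm (1 - z) powr (2 * d) * (1 - (norm z)\<^sup>2) / 2"
        using pw[OF that] z1 z3 \<eta> \<tau> by (intro divide_right_mono mult_mono) auto
      also have "\<dots> \<le> 1 - (norm v)\<^sup>2" by (rule v(3))
      also have "\<dots> = (1 - norm v) * (1 + norm v)" by (simp add: power2_eq_square algebra_simps)
      also have "\<dots> \<le> (1 - norm v) * 2" using v(1) by (intro mult_left_mono) auto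
      finally show ?thesis by simp
    qed
    have "1 / N \<le> 1 - norm v"
    proof -
      have "1 / N \<le> \<tau>\<^sup>2" using N(2) N0 \<tau> by (simp add: field_simps)
      also have "\<dots> = \<tau> powr 1 * \<tau>" using \<tau> by (simp add: power2_eq_square)
      also have "\<dots> \<le> \<tau> powr 1 * (15 / 16 * \<eta> / 4)" using \<eta> \<tau> by (intro mult_left_mono) auto
      also have "\<dots> \<le> 1 - norm v" using v4[of 1] d by simp
      finally show ?thesis .
    qed
    moreover have "norm (e * v) = norm v" using e by (simp add: norm_mult)
    \<comment> \<open>From e to \<open>e * v\<close> via \<open>b\<close> and \<open>e * z\<close>
      the steps are shorter than \<open>\<delta> / 2\<close>, at most \<tau> and at most
      \<open>6 * d\<close>, far below the spare \<open>9 * \<delta>\<close>.\<close>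
    moreover have "7 * \<delta> \<le> infdist (e * v) F"
    proof -
      have "infdist e F \<le> infdist (e * v) F + norm (e - e * v)" by (rule infdist_triangle_norm)
      also have "e - e * v = - (b - e) + ((b - e * z) + e * (z - v))" by (simp add: algebra_simps)
      also have "norm \<dots> \<le> norm (b - e) + (norm (b - e * z) + norm (e * (z - v)))"
        using norm_triangle_ineq[of "- (b - e)" "(b - e * z) + e * (z - v)"]
          norm_triangle_ineq[of "b - e * z" "e * (z - v)"] by (simp only: norm_minus_cancel)
      also have "norm (e * (z - v)) \<le> 6 * d"
        using corner_near_id[OF v(1) d] v(2) e by (simp add: norm_mult)
      finally show ?thesis using bz \<eta> \<eta>b \<delta> dc c by simp
    qed
    ultimately obtain w where w: "norm w < 1" "\<psi> w = e * v" "(1 - norm v) / 2 \<le> 1 - norm w"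
      using \<psi>3[of "e * v"] v(1) by auto
    have "y w = v" using w(2) e' by (simp add: y_def mult.assoc[symmetric])
    then have "Psi w = b" using v(2) zb by (simp add: Psi_def)
    moreover have "\<tau> powr \<epsilon> * (1 - norm b) / 16 \<le> 1 - norm w"
    proof -
      define P where "P = \<tau> powr \<epsilon> * \<eta>"
      have "\<tau> powr \<epsilon> * (15 / 16 * \<eta>) / 4 \<le> 1 - norm v" using dc c by (intro v4) simp
      then have "15 / 64 * P \<le> 1 - norm v" by (simp add: P_def mult_ac)
      then have "15 / 128 * P \<le> 1 - norm w" using w(3) by simp
      moreover have "0 \<le> P" using \<eta> \<tau> by (simp add: P_def)
      then have "P / 16 \<le> 15 / 128 * P" by simp
      ultimately have "P / 16 \<le> 1 - norm w" by (rule order_trans[rotated])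
      then show ?thesis by (simp add: P_def \<eta>_def)
    qed
    ultimately show ?thesis using w(1) by blast
  qed
  then obtain a where a: "\<And>b. b \<in> B \<Longrightarrow> norm (a b) < 1 \<and> Psi (a b) = b \<and>
      \<tau> powr \<epsilon> * (1 - norm b) / 16 \<le> 1 - norm (a b)"
    by metis
  define M where "M = K * (4 / c) powr p * \<tau> powr (- p) * l powr r * (3072 * \<Lambda> / \<delta>) powr q"
  have dF: "\<delta> / (3072 * \<Lambda>) \<le> infdist (Psi w) F" if w: "norm w = 1" for w
  proof -
    have wS: "w \<in> S" using \<psi>(2) w by auto
    show ?thesis
    proof (cases "infdist w F < \<delta> / 2")
      case True
      have "norm (corner d (y w)) \<le> norm (\<psi> w)" using norm_corner_le[OF ylt[OF wS] d] by (simp add: ny)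
      then show ?thesis
        using \<psi>1[OF w True] infdist_ge_one_minus_norm[OF F, of "Psi w"] nPsi_le[of w] by simp
    next
      case False
      have "infdist w F \<le> infdist (\<psi> w) F + norm (w - \<psi> w)" by (rule infdist_triangle_norm)
      then have 1: "\<delta> / 4 \<le> infdist (\<psi> w) F" using \<psi>2[OF w] False by (simp add: norm_minus_commute)
      have "infdist (\<psi> w) F \<le> infdist (e * corner d (y w)) F + norm (\<psi> w - e * corner d (y w))"
        by (rule infdist_triangle_norm)
      also have "\<psi> w - e * corner d (y w) = e * (y w - corner d (y w))" by (simp add: right_diff_distrib ey)
      also have "norm \<dots> \<le> 6 * d"
        using corner_near_id[OF ylt[OF wS] d] e by (simp add: norm_mult norm_minus_commute)
      finally have "\<delta> / 8 \<le> infdist (e * corner d (y w)) F" using 1 dc c by simp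
      also have "\<dots> \<le> 2 * infdist (Psi w) F" unfolding Psi_def
        using clt[OF wS] \<tau> e by (intro infdist_scale F) (auto simp: norm_mult)
      finally have "\<delta> / 16 \<le> infdist (Psi w) F" by simp
      moreover have "\<delta> / (3072 * \<Lambda>) \<le> \<delta> / 16" using \<Lambda> \<delta> by (intro divide_left_mono) auto
      ultimately show ?thesis by linarith
    qed
  qed
  have "(\<Sum>b\<in>B. of_int (zorder f b) * (1 - norm (a b))) \<le> M"
  \<comment> \<open>The majorant is bounded by one constant along the whole image of the circle, so
    a single rotation replaces the mean.\<close>
  proof (rule zeros_sum_le_of_subordination[OF f \<psi>(1,2), where Psi = Psi and U = "{1}" and h = "\<lambda>w. M"])
    have "y holomorphic_on S" unfolding y_def by (intro holomorphic_intros \<psi>(3))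
    then have "(corner d \<circ> y) holomorphic_on S"
      using ylt by (intro holomorphic_on_compose holomorphic_on_subset[OF holomorphic_corner]) auto
    then show "Psi holomorphic_on S" unfolding Psi_def o_def by (intro holomorphic_intros)
    show "Psi ` S \<subseteq> ball 0 1" using clt by (auto intro!: le_less_trans[OF nPsi_le])
    show "Psi 0 = 0" using \<psi>(5) by (simp add: Psi_def y_def)
    show "finite B" "B \<subseteq> ball 0 1" by (rule B)+
    show "norm (a b) < 1 \<and> Psi (a b) = b" if "b \<in> B" for b using a[OF that] by simp
    fix w :: complex assume w: "norm w = 1"
    have wS: "w \<in> S" using \<psi>(2) w by auto
    show "ln (norm (f (Psi w))) \<le> M" if nz: "f (Psi w) \<noteq> 0"
    proof -
      define k where "k = corner d (y w)"
      define X where "X = norm (1 - k)"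
      have k: "norm k < 1" "(norm k)\<^sup>2 \<le> 1 - d * X"
        using clt[OF wS] corner_stolz(1)[OF ylt[OF wS] d] by (auto simp: k_def X_def)
      have "d * X \<le> (1 - norm k) * (1 + norm k)" using k(2) by (simp add: power2_eq_square algebra_simps)
      also have "\<dots> \<le> (1 - norm k) * 2" using k(1) by (intro mult_left_mono) auto
      finally have kX: "d * X / 2 \<le> 1 - norm (Psi w)" using nPsi_le[of w] by (simp add: k_def)
      \<comment> \<open>Two lower bounds for the height are averaged: the corner gives
        \<open>d * X / 2\<close>, decisive far from the vertex, and the dilation gives \<tau>, which
        dominates \<open>d * l\<close>.\<close>
      have "d * l \<le> \<tau>" using c \<tau> l by (simp add: d_def mult_left_le_one_le)
      then have h: "d / 4 * (X + l) \<le> 1 - norm (Psi w)"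
        using kX Psi_tau[OF wS] \<tau> by (simp add: distrib_left)
      have "Psi w - e = - (e * ((1 - k) + of_real \<tau> * k))" by (simp add: Psi_def k_def algebra_simps)
      then have "norm (Psi w - e) = norm ((1 - k) + of_real \<tau> * k)" using e by (simp only: norm_minus_cancel norm_mult mult_1)
      also have "\<dots> \<le> X + norm (of_real \<tau> * k)" unfolding X_def by (rule norm_triangle_ineq)
      also have "norm (of_real \<tau> * k) \<le> \<tau> * 1" unfolding norm_mult using k \<tau> by (intro mult_mono) auto
      finally have ye: "norm (Psi w - e) \<le> X + l" using \<tau> by simp
      have "Psi w \<in> ball 0 1" using nPsi_le[of w] clt[OF wS] by simp
      then have "ln (norm (f (Psi w)))
          \<le> K / (1 - norm (Psi w)) powr p * norm (Psi w - e) powr r / infdist (Psi w) F powr q"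
        using bd nz by blast
      also have "\<dots> = K * (norm (Psi w - e) powr r / (1 - norm (Psi w)) powr p) / infdist (Psi w) F powr q"
        by simp
      also have "\<dots> \<le> K * ((4 / d) powr p * l powr (r - p)) / (\<delta> / (3072 * \<Lambda>)) powr q"
        using stolz_bound[OF _ l d0 pq(1,2) _ ye h] dF[OF w] K \<Lambda> \<delta> pq(3)
        by (intro frac_le mult_left_mono powr_mono2) (auto simp: X_def)
      also have "\<dots> = M"
      proof -
        have "(4 / d) powr p = ((4 / c) * (l / \<tau>)) powr p" using c \<tau> l by (simp add: d_def)
        also have "\<dots> = (4 / c) powr p * (l powr p / \<tau> powr p)" using c \<tau> l by (simp add: powr_mult powr_divide)
        finally have "(4 / d) powr p * l powr (r - p) = (4 / c) powr p * \<tau> powr (- p) * l powr r"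
          using l by (simp add: powr_diff powr_minus field_simps)
        moreover have "1 / (\<delta> / (3072 * \<Lambda>)) powr q = (3072 * \<Lambda> / \<delta>) powr q"
          using \<delta> \<Lambda> by (simp add: powr_divide)
        ultimately show ?thesis unfolding M_def by (metis mult.assoc times_divide_eq_right mult_1_right)
      qed
      finally show ?thesis .
    qed
    show "(\<Sum>u\<in>{1}. M) \<le> real (card {1::complex}) * M" by simp
  qed auto
  moreover have "\<tau> powr \<epsilon> / 16 * (\<Sum>b\<in>B. of_int (zorder f b) * (1 - norm b))
      \<le> (\<Sum>b\<in>B. of_int (zorder f b) * (1 - norm (a b)))"
    unfolding sum_distrib_left
  proof (rule sum_mono)
    fix b assume b: "b \<in> B"
    have "of_int (zorder f b) * (\<tau> powr \<epsilon> * (1 - norm b) / 16) \<le> of_int (zorder f b) * (1 - norm (a b))"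
      using a[OF b] zorder_nonneg_ball[OF f, of b] B(2) b by (intro mult_left_mono) auto
    then show "\<tau> powr \<epsilon> / 16 * (of_int (zorder f b) * (1 - norm b)) \<le> of_int (zorder f b) * (1 - norm (a b))"
      by (simp add: mult_ac)
  qed
  ultimately have "\<tau> powr \<epsilon> / 16 * (\<Sum>b\<in>B. of_int (zorder f b) * (1 - norm b)) \<le> M" by linarith
  then have "(\<Sum>b\<in>B. of_int (zorder f b) * (1 - norm b)) \<le> 16 * \<tau> powr (- \<epsilon>) * M"
    using \<tau> by (simp add: powr_minus field_simps)
  then show ?thesis by (simp add: M_def \<Lambda>_def)
qed

text \<open>Budget for \<epsilon>: a quarter for inverting the corner, a quarter for the logarithm,
  and a quarter for each of the two dyadic scales, using \<open>\<tau> \<le> l\<close>. The powers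
  of \<open>l\<close> from the weight and from the majorant cancel exactly. The radius
  \<open>d0\<close> depends only on the distance from e to F.\<close>

lemma zeros_sum_E:
  fixes F :: "complex set" and e :: complex and p q r \<epsilon> :: real
  assumes F: "closed F" "F \<noteq> {}" "F \<subseteq> sphere 0 1" and pq: "0 \<le> r" "r \<le> p" "q \<ge> 0" and \<epsilon>: "\<epsilon> > 0"
    and e: "norm e = 1" "e \<notin> F"
  obtains C d0 where "C > 0" "d0 > 0"
    "\<And>f K B. K > 0 \<Longrightarrow> f holomorphic_on ball 0 1 \<Longrightarrow> norm (f 0) = 1 \<Longrightarrow>
      (\<And>z. z \<in> ball 0 1 \<Longrightarrow> f z \<noteq> 0 \<Longrightarrow>
        ln (norm (f z)) \<le> K / (1 - norm z) powr p * norm (z - e) powr r / infdist z F powr q) \<Longrightarrow>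
      finite B \<Longrightarrow> B \<subseteq> ball 0 1 \<inter> ball e d0 \<Longrightarrow>
      (\<Sum>b\<in>B. of_int (zorder f b) * (1 - norm b) powr (p + 1 + \<epsilon>) / norm (b - e) powr r) \<le> C * K"
proof -
  have \<epsilon>4: "\<epsilon> / 4 > 0" using \<epsilon> by simp
  have g: "infdist e F > 0" by (rule infdist_pos_not_in_closed[OF F(1,2) e(2)])
  define \<delta> where "\<delta> = min 1 (infdist e F / 16)"
  have \<delta>: "0 < \<delta>" "\<delta> \<le> 1" "16 * \<delta> \<le> infdist e F" using g by (auto simp: \<delta>_def)
  define c where "c = min (min (\<delta> / 48) (1 / 32)) (\<epsilon> / 8)"
  have c: "0 < c" "c \<le> \<delta> / 48" "c \<le> 1 / 32" "2 * c \<le> \<epsilon> / 4" using \<delta> \<epsilon> by (auto simp: c_def)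
  define N0 where "N0 = nat \<lceil>16 / \<delta>\<rceil>"
  have N0: "16 / \<delta> \<le> N0" unfolding N0_def by linarith
  have "16 \<le> 16 / \<delta>" using \<delta> by (simp add: le_divide_eq)
  then have N16: "16 \<le> N0" using N0 by linarith
  obtain Cl where Cl: "Cl > 0" "\<And>m. (1 + ln (real N0 * 4 ^ m)) powr q \<le> Cl * ((1/2) ^ m) powr (- (\<epsilon> / 4))"
    using log_powr_le[of N0 q "\<epsilon> / 4"] pq \<epsilon>4 N16 by auto
  define C1 where "C1 = 32 powr (p + \<epsilon>) * 8 powr (- r) * 16 * (4 / c) powr p * (3072 / \<delta>) powr q * Cl"
  have C1: "C1 > 0" unfolding C1_def using Cl c \<delta> by simp
  define C where "C = C1 * (1 / (1 - (1/2) powr (\<epsilon> / 4)))\<^sup>2"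
  have half: "(1/2) powr (\<epsilon> / 4) < (1::real)"
    using \<epsilon> powr_less_mono2[of "\<epsilon> / 4" "1/2" "1::real"] by simp
  have C: "C > 0" unfolding C_def using C1 half by (intro mult_pos_pos zero_less_power divide_pos_pos) auto
  have "(\<Sum>b\<in>B. of_int (zorder f b) * (1 - norm b) powr (p + 1 + \<epsilon>) / norm (b - e) powr r) \<le> C * K"
    if K: "K > 0" and f: "f holomorphic_on ball 0 1" "norm (f 0) = 1"
      and bd: "\<And>z. z \<in> ball 0 1 \<Longrightarrow> f z \<noteq> 0 \<Longrightarrow>
        ln (norm (f z)) \<le> K / (1 - norm z) powr p * norm (z - e) powr r / infdist z F powr q"
      and B: "finite B" "B \<subseteq> ball 0 1 \<inter> ball e (\<delta> / 2)" for f K B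
  proof -
    define wt where "wt b = of_int (zorder f b) * (1 - norm b) powr (p + 1 + \<epsilon>) / norm (b - e) powr r" for b
    have "sum wt B \<le> (C1 * K) * (1 / (1 - (1/2) powr (\<epsilon> / 4)))\<^sup>2"
    proof (rule sum_over_dyadic_scales_le[where \<eta> = "\<lambda>b. (1 - norm b) / 16" and D = "\<lambda>b. norm (b - e) / 8",
          OF B(1) _ \<epsilon>4])
      show "0 < (1 - norm b) / 16 \<and> 2 * ((1 - norm b) / 16) \<le> norm (b - e) / 8 \<and> norm (b - e) / 8 \<le> 1"
        if "b \<in> B" for b
      proof -
        have "norm b < 1" using that B by auto
        moreover have "norm e - norm b \<le> norm (b - e)"
          using norm_triangle_ineq3[of e b] by (simp add: norm_minus_commute)
        moreover have "norm (b - e) \<le> norm b + norm e" by (rule norm_triangle_ineq4)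
        ultimately show ?thesis using e by simp
      qed
      show "0 \<le> C1 * K" using C1 K by simp
      fix m k :: nat and B'
      assume B': "B' \<subseteq> B" and mk: "(1/2) ^ m \<le> ((1/2) ^ k :: real)"
        and cl: "\<And>b. b \<in> B' \<Longrightarrow> (1/2) ^ m \<le> (1 - norm b) / 16 \<and> (1 - norm b) / 16 < 2 * (1/2) ^ m \<and>
          (1/2) ^ k \<le> norm (b - e) / 8 \<and> norm (b - e) / 8 < 2 * (1/2) ^ k"
      define \<tau> :: real where "\<tau> = (1/2) ^ m"
      define l :: real where "l = (1/2) ^ k"
      define N :: nat where "N = N0 * 4 ^ m"
      have \<tau>: "0 < \<tau>" "\<tau> \<le> l" "\<tau> \<le> 1" and l: "0 < l" using mk by (auto simp: \<tau>_def l_def power_le_one)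
      have "real N0 * 1 \<le> real N0 * 4 ^ m" by (intro mult_left_mono) auto
      then have N1: "16 / \<delta> \<le> real N" using N0 by (simp add: N_def)
      have "(4::real) ^ m = 1 / \<tau>\<^sup>2" by (simp add: \<tau>_def power_divide power2_eq_square power_mult_distrib[symmetric])
      moreover have "16 * 4 ^ m \<le> real N0 * 4 ^ m" using N16 by (intro mult_right_mono) auto
      ultimately have N2: "16 / \<tau>\<^sup>2 \<le> real N" by (simp add: N_def)
      have "(\<Sum>b\<in>B'. of_int (zorder f b) * (1 - norm b))
        \<le> 16 * \<tau> powr (- (\<epsilon> / 4)) * (K * (4 / c) powr p * \<tau> powr (- p) * l powr r * (3072 * (1 + ln N) / \<delta>) powr q)"
      proof (rule zeros_sum_at_scale_E[OF F(2,3) pq e(1) f K bd \<delta> \<tau> c N1 N2])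
        show "finite B'" "B' \<subseteq> ball 0 1" using B' B by (auto intro: finite_subset)
        show "16 * \<tau> \<le> 1 - norm b \<and> norm (b - e) < 16 * l \<and> norm (b - e) < \<delta> / 2" if "b \<in> B'" for b
          using cl[OF that] B(2) B' that by (auto simp: \<tau>_def l_def dist_norm norm_minus_commute)
      qed
      also have "(3072 * (1 + ln N) / \<delta>) powr q = (3072 / \<delta>) powr q * (1 + ln N) powr q"
        by (simp add: powr_mult[symmetric])
      also have "16 * \<tau> powr (- (\<epsilon> / 4)) * (K * (4 / c) powr p * \<tau> powr (- p) * l powr r *
          ((3072 / \<delta>) powr q * (1 + ln N) powr q))
        \<le> 16 * \<tau> powr (- (\<epsilon> / 4)) * (K * (4 / c) powr p * \<tau> powr (- p) * l powr r *
          ((3072 / \<delta>) powr q * (Cl * \<tau> powr (- (\<epsilon> / 4)))))"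
        using Cl(2)[of m] K by (intro mult_left_mono) (auto simp: N_def \<tau>_def)
      finally have sum: "(\<Sum>b\<in>B'. of_int (zorder f b) * (1 - norm b))
          \<le> 16 * \<tau> powr (- (\<epsilon> / 4)) * (K * (4 / c) powr p * \<tau> powr (- p) * l powr r *
          ((3072 / \<delta>) powr q * (Cl * \<tau> powr (- (\<epsilon> / 4)))))" .
      have "sum wt B' \<le> (\<Sum>b\<in>B'. ((32 * \<tau>) powr (p + \<epsilon>) * (8 * l) powr (- r)) * (of_int (zorder f b) * (1 - norm b)))"
      proof (rule sum_mono)
        fix b assume b: "b \<in> B'"
        then have b1: "b \<in> ball 0 1" "norm b < 1" using B' B by auto
        have z: "0 \<le> zorder f b" by (rule zorder_nonneg_ball[OF f b1(1)])
        have "(1 - norm b) powr (p + 1 + \<epsilon>) = (1 - norm b) powr (p + \<epsilon>) * (1 - norm b)"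
          using b1 powr_add[of "1 - norm b" "p + \<epsilon>" 1] by (simp add: add_ac)
        then have "wt b = (of_int (zorder f b) * (1 - norm b)) * ((1 - norm b) powr (p + \<epsilon>) * norm (b - e) powr (- r))"
          by (simp add: wt_def powr_minus divide_inverse mult_ac)
        also have "\<dots> \<le> (of_int (zorder f b) * (1 - norm b)) * ((32 * \<tau>) powr (p + \<epsilon>) * (8 * l) powr (- r))"
        proof (intro mult_left_mono mult_mono)
          show "(1 - norm b) powr (p + \<epsilon>) \<le> (32 * \<tau>) powr (p + \<epsilon>)"
            using cl[OF b] b1 pq \<epsilon> by (intro powr_mono2) (auto simp: \<tau>_def)
          show "norm (b - e) powr (- r) \<le> (8 * l) powr (- r)"
            using cl[OF b] pq l by (intro powr_mono2') (auto simp: l_def)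
        qed (use z b1 in auto)
        finally show "wt b \<le> ((32 * \<tau>) powr (p + \<epsilon>) * (8 * l) powr (- r)) * (of_int (zorder f b) * (1 - norm b))"
          by (simp add: mult_ac)
      qed
      also have "\<dots> \<le> ((32 * \<tau>) powr (p + \<epsilon>) * (8 * l) powr (- r)) *
          (16 * \<tau> powr (- (\<epsilon> / 4)) * (K * (4 / c) powr p * \<tau> powr (- p) * l powr r *
          ((3072 / \<delta>) powr q * (Cl * \<tau> powr (- (\<epsilon> / 4))))))"
        unfolding sum_distrib_left[symmetric] using sum by (intro mult_left_mono) auto
      also have "\<dots> = C1 * K * ((\<tau> powr (p + \<epsilon>) * \<tau> powr (- p) * (\<tau> powr (- (\<epsilon> / 4)) * \<tau> powr (- (\<epsilon> / 4)))) * (l powr (- r) * l powr r))"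
        unfolding C1_def powr_mult by (simp only: mult_ac)
      also have "l powr (- r) * l powr r = 1" using l by (simp add: powr_minus)
      also have "\<tau> powr (p + \<epsilon>) * \<tau> powr (- p) * (\<tau> powr (- (\<epsilon> / 4)) * \<tau> powr (- (\<epsilon> / 4))) = \<tau> powr (\<epsilon> / 4) * \<tau> powr (\<epsilon> / 4)"
        by (simp add: powr_add[symmetric])
      also have "C1 * K * (\<tau> powr (\<epsilon> / 4) * \<tau> powr (\<epsilon> / 4) * 1) \<le> C1 * K * (\<tau> powr (\<epsilon> / 4) * l powr (\<epsilon> / 4))"
        using C1 K \<tau> \<epsilon> unfolding mult_1_right by (intro mult_left_mono powr_mono2) auto
      finally show "sum wt B' \<le> C1 * K * (((1/2) ^ m) powr (\<epsilon> / 4) * ((1/2) ^ k) powr (\<epsilon> / 4))"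
        by (simp add: \<tau>_def l_def)
    qed
    also have "\<dots> = C * K" by (simp add: C_def)
    finally show ?thesis by (simp add: wt_def)
  qed
  moreover have "\<delta> / 2 > 0" using \<delta> by simp
  ultimately show ?thesis using C that[of C "\<delta> / 2"] by blast
qed

section \<open>Combination of the estimates near and away from E\<close>

lemma infdist_finite_attained:
  assumes "finite E" "E \<noteq> {}"
  shows "\<exists>e\<in>E. infdist z E = dist z e"
proof -
  have "infdist z E = Min (dist z ` E)" using assms by (simp add: infdist_def cInf_eq_Min)
  moreover have "Min (dist z ` E) \<in> dist z ` E" using assms by (intro Min_in) auto
  ultimately show ?thesis by auto
qed

text \<open>Multiplicity enters as the factor \<open>zorder f \<zeta>\<close> over distinct zeros.
  The majorant is imposed only where f is not 0, since \<open>ln 0\<close> does not represent minus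
  infinity; summability is asserted separately because \<open>infsum\<close> of a family that is not
  summable is 0 by convention.\<close>

theorem theorem0p3:
  fixes E F :: "complex set" and p q r :: real
  assumes "finite E" and "E \<noteq> {}" and "E \<subseteq> sphere 0 1"
    and "closed F" and "F \<noteq> {}" and "F \<subseteq> sphere 0 1"
    and "E \<inter> F = {}"
    and "p \<ge> 0" and "q \<ge> 0" and "r \<ge> 0"
  shows "\<forall>\<epsilon>>0. \<exists>C4>0. \<forall>(f :: complex \<Rightarrow> complex) K.
           K > 0 \<and> f holomorphic_on ball 0 1 \<and> norm (f 0) = 1 \<and>
           (\<forall>z\<in>ball 0 1. f z \<noteq> 0 \<longrightarrow>
              ln (norm (f z)) \<le> K / (1 - norm z) powr p
                 * infdist z E powr r / infdist z F powr q)
           \<longrightarrow>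
           (let w = (\<lambda>\<zeta>. of_int (zorder f \<zeta>) * (1 - norm \<zeta>) powr (p + 1 + \<epsilon>)
                      * infdist \<zeta> F powr (max (q - ahern_clark_type F + \<epsilon>) 0)
                      / infdist \<zeta> E powr (min p r));
                Z = {\<zeta> \<in> ball 0 1. f \<zeta> = 0}
            in w summable_on Z \<and> infsum w Z \<le> C4 * K)"
proof (intro allI impI)
  fix \<epsilon> :: real assume \<epsilon>: "\<epsilon> > 0"
  note E = assms(1-3) and F = assms(4-6)
  define s where "s = max (q - ahern_clark_type F + \<epsilon>) 0"
  define r0 where "r0 = min p r"
  have r0: "0 \<le> r0" "r0 \<le> p" "r0 \<le> r" using assms by (auto simp: r0_def)
  obtain CF where CF: "CF > 0"
    "\<And>f K B. K > 0 \<Longrightarrow> f holomorphic_on ball 0 1 \<Longrightarrow> norm (f 0) = 1 \<Longrightarrow>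
      (\<And>z. z \<in> ball 0 1 \<Longrightarrow> f z \<noteq> 0 \<Longrightarrow> ln (norm (f z)) \<le> K / (1 - norm z) powr p / infdist z F powr q) \<Longrightarrow>
      finite B \<Longrightarrow> B \<subseteq> ball 0 1 \<Longrightarrow>
      (\<Sum>b\<in>B. of_int (zorder f b) * (1 - norm b) powr (p + 1 + \<epsilon>) * infdist b F powr s) \<le> CF * K"
    by (rule zeros_sum_F[OF F(2,3) assms(8,9) \<epsilon>, folded s_def]) blast
  \<comment> \<open>The local estimate is packaged as a predicate so that the constant and the
    radius can be chosen as functions of e.\<close>
  define PE where "PE e C d0 \<longleftrightarrow> C > 0 \<and> d0 > 0 \<and>
    (\<forall>f K B. K > 0 \<longrightarrow> f holomorphic_on ball 0 1 \<longrightarrow> norm (f 0) = 1 \<longrightarrow>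
      (\<forall>z. z \<in> ball 0 1 \<longrightarrow> f z \<noteq> 0 \<longrightarrow>
        ln (norm (f z)) \<le> K / (1 - norm z) powr p * norm (z - e) powr r0 / infdist z F powr q) \<longrightarrow>
      finite B \<longrightarrow> B \<subseteq> ball 0 1 \<inter> ball e d0 \<longrightarrow>
      (\<Sum>b\<in>B. of_int (zorder f b) * (1 - norm b) powr (p + 1 + \<epsilon>) / norm (b - e) powr r0) \<le> C * K)"
    for e :: complex and C d0 :: real
  have "\<exists>C d0. PE e C d0" if "e \<in> E" for e
  proof -
    have e: "norm e = 1" "e \<notin> F" using that E assms(7) by auto
    show ?thesis
      by (rule zeros_sum_E[OF F r0(1,2) assms(9) \<epsilon> e]) (unfold PE_def, blast)
  qed
  then obtain CE dE where PE: "\<And>e. e \<in> E \<Longrightarrow> PE e (CE e) (dE e)" by metis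
  define d where "d = Min (dE ` E)"
  have dE: "d \<le> dE e" if "e \<in> E" for e using that E by (simp add: d_def)
  have d0: "d > 0" using E PE by (auto simp: d_def PE_def)
  define C4 where "C4 = 2 powr r * (d powr (- r0) * CF + 2 powr s * (\<Sum>e\<in>E. CE e))"
  have "C4 > 0"
  proof -
    have "(\<Sum>e\<in>E. CE e) > 0" using E PE by (intro sum_pos) (auto simp: PE_def)
    then show ?thesis unfolding C4_def using d0 CF(1) by (intro mult_pos_pos add_pos_pos) auto
  qed
  moreover have "w summable_on Z \<and> infsum w Z \<le> C4 * K"
    if K: "K > 0" and f: "f holomorphic_on ball 0 1" "norm (f 0) = 1"
      and bd: "\<forall>z\<in>ball 0 1. f z \<noteq> 0 \<longrightarrow>
              ln (norm (f z)) \<le> K / (1 - norm z) powr p * infdist z E powr r / infdist z F powr q"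
      and w: "w = (\<lambda>\<zeta>. of_int (zorder f \<zeta>) * (1 - norm \<zeta>) powr (p + 1 + \<epsilon>) * infdist \<zeta> F powr s
                      / infdist \<zeta> E powr r0)"
      and Z: "Z = {\<zeta> \<in> ball 0 1. f \<zeta> = 0}" for f K w Z
  proof -
    \<comment> \<open>Distances in the disc are at most 2, so \<open>2 powr r\<close> pays for
      discarding the factor at E in the estimate away from E, and for lowering its exponent to
      \<open>r0\<close> in the estimate near a point of E.\<close>
    define K' where "K' = 2 powr r * K"
    have K': "K' > 0" using K by (simp add: K'_def)
    have Ez: "0 < infdist z E" "infdist z E \<le> 2" if "z \<in> ball 0 1" for z
      using infdist_ge_one_minus_norm[OF E(2,3), of z] infdist_le_2[OF E(2,3), of z] that by auto
    have bdF: "ln (norm (f z)) \<le> K' / (1 - norm z) powr p / infdist z F powr q"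
      if z: "z \<in> ball 0 1" "f z \<noteq> 0" for z
    proof -
      have "ln (norm (f z)) \<le> K / (1 - norm z) powr p * infdist z E powr r / infdist z F powr q"
        using bd z by blast
      also have "\<dots> \<le> K / (1 - norm z) powr p * 2 powr r / infdist z F powr q"
        using Ez[OF z(1)] assms(10) K by (intro divide_right_mono mult_left_mono powr_mono2) auto
      finally show ?thesis by (simp add: K'_def mult_ac)
    qed
    have bdE: "ln (norm (f z)) \<le> K' / (1 - norm z) powr p * norm (z - e) powr r0 / infdist z F powr q"
      if e: "e \<in> E" and z: "z \<in> ball 0 1" "f z \<noteq> 0" for z e
    proof -
      have "infdist z E powr r = infdist z E powr (r - r0) * infdist z E powr r0"
        by (simp add: powr_add[symmetric])
      also have "\<dots> \<le> 2 powr r * norm (z - e) powr r0"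
      proof (intro mult_mono)
        have "infdist z E powr (r - r0) \<le> 2 powr (r - r0)" using Ez[OF z(1)] r0 by (intro powr_mono2) auto
        also have "\<dots> \<le> 2 powr r" using r0 by (intro powr_mono) auto
        finally show "infdist z E powr (r - r0) \<le> 2 powr r" .
        show "infdist z E powr r0 \<le> norm (z - e) powr r0"
          using Ez[OF z(1)] infdist_le[OF e, of z] r0 by (intro powr_mono2) (auto simp: dist_norm)
      qed auto
      finally have "K / (1 - norm z) powr p * infdist z E powr r / infdist z F powr q
          \<le> K / (1 - norm z) powr p * (2 powr r * norm (z - e) powr r0) / infdist z F powr q"
        using K by (intro divide_right_mono mult_left_mono) auto
      moreover have "ln (norm (f z)) \<le> K / (1 - norm z) powr p * infdist z E powr r / infdist z F powr q"
        using bd z by blast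
      ultimately show ?thesis by (simp add: K'_def mult_ac)
    qed
    have zo: "0 \<le> zorder f b" if "b \<in> ball 0 1" for b by (rule zorder_nonneg_ball[OF f that])
    have w0: "0 \<le> w b" if "b \<in> Z" for b using zo[of b] that by (simp add: w Z)
    have fin: "sum w B \<le> C4 * K" if B: "finite B" "B \<subseteq> Z" for B
    proof -
      have B1: "B \<subseteq> ball 0 1" using B Z by auto
      define wF where "wF b = of_int (zorder f b) * (1 - norm b) powr (p + 1 + \<epsilon>) * infdist b F powr s" for b
      define wE where "wE e b = of_int (zorder f b) * (1 - norm b) powr (p + 1 + \<epsilon>) / norm (b - e) powr r0" for e b
      define BE where "BE e = {b \<in> B. b \<in> ball e (dE e)}" for e
      have wF0: "0 \<le> wF b" if "b \<in> B" for b using zo[of b] B1 that by (auto simp: wF_def)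
      have wE0: "0 \<le> wE e b" if "b \<in> B" for e b using zo[of b] B1 that by (auto simp: wE_def)
      define g where "g e b = (if b \<in> ball e (dE e) then 2 powr s * wE e b else 0)" for e b
      have g0: "0 \<le> g e b" if "b \<in> B" for e b using wE0[OF that] by (simp add: g_def)
      \<comment> \<open>At distance at least \<open>d\<close> from E the factor at E is bounded.
        Otherwise the nearest point of E carries the term, and the factor at F is at most
        \<open>2 powr s\<close>. Cutting \<open>g\<close> off outside the balls lets all points of E
        be added without selecting one for each zero.\<close>
      have pt: "w b \<le> d powr (- r0) * wF b + (\<Sum>e\<in>E. g e b)" if b: "b \<in> B" for b
      proof -
        have bb: "b \<in> ball 0 1" using b B1 by auto
        have gs: "0 \<le> (\<Sum>e\<in>E. g e b)" using g0[OF b] by (intro sum_nonneg) auto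
        show ?thesis
        proof (cases "d \<le> infdist b E")
          case True
          have "w b = wF b * infdist b E powr (- r0)" by (simp add: w wF_def powr_minus divide_inverse)
          also have "\<dots> \<le> wF b * d powr (- r0)"
            using True d0 r0 wF0[OF b] by (intro mult_left_mono powr_mono2') auto
          finally show ?thesis using gs by (simp add: mult.commute)
        next
          case False
          obtain e where e: "e \<in> E" "infdist b E = dist b e"
            using infdist_finite_attained[OF E(1,2)] by blast
          have be: "b \<in> ball e (dE e)" using False dE[OF e(1)] e(2) by (simp add: dist_commute)
          have "infdist b F powr s \<le> 2 powr s"
            using infdist_le_2[OF F(2,3), of b] bb infdist_nonneg[of b F] by (intro powr_mono2) (auto simp: s_def)
          then have "infdist b F powr s * wE e b \<le> 2 powr s * wE e b"
            using wE0[OF b] by (intro mult_right_mono) auto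
          moreover have "w b = infdist b F powr s * wE e b" by (simp add: w wE_def e(2) dist_norm)
          ultimately have "w b \<le> g e b" using be by (simp add: g_def)
          also have "\<dots> \<le> (\<Sum>e\<in>E. g e b)" using e E g0[OF b] by (intro member_le_sum) auto
          finally show ?thesis using wF0[OF b] by (smt (verit) mult_nonneg_nonneg powr_ge_zero)
        qed
      qed
      have sF: "sum wF B \<le> CF * K'" unfolding wF_def by (rule CF(2)[OF K' f bdF B(1) B1])
      have sE: "(\<Sum>b\<in>B. g e b) \<le> 2 powr s * (CE e * K')" if e: "e \<in> E" for e
      proof -
        have "(\<Sum>b\<in>B. g e b) = (\<Sum>b\<in>BE e. 2 powr s * wE e b)"
          unfolding g_def BE_def by (simp only: sum.inter_filter[OF B(1)])
        also have "\<dots> = 2 powr s * (\<Sum>b\<in>BE e. wE e b)" by (simp only: sum_distrib_left)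
        also have "\<dots> \<le> 2 powr s * (CE e * K')"
        proof (rule mult_left_mono)
          have "finite (BE e)" "BE e \<subseteq> ball 0 1 \<inter> ball e (dE e)" using B B1 by (auto simp: BE_def)
          then show "(\<Sum>b\<in>BE e. wE e b) \<le> CE e * K'"
            using PE[OF e] K' f bdE[OF e] unfolding PE_def wE_def by blast
        qed simp
        finally show ?thesis .
      qed
      have "sum w B \<le> (\<Sum>b\<in>B. d powr (- r0) * wF b + (\<Sum>e\<in>E. g e b))" by (intro sum_mono pt)
      also have "\<dots> = d powr (- r0) * sum wF B + (\<Sum>e\<in>E. \<Sum>b\<in>B. g e b)"
        by (simp add: sum.distrib sum_distrib_left sum.swap[of _ E B])
      also have "\<dots> \<le> d powr (- r0) * (CF * K') + (\<Sum>e\<in>E. 2 powr s * (CE e * K'))"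
        using sF sE by (intro add_mono mult_left_mono sum_mono) auto
      also have "\<dots> = C4 * K"
        by (simp add: C4_def K'_def sum_distrib_left[symmetric] sum_distrib_right[symmetric] algebra_simps)
      finally show ?thesis .
    qed
    \<comment> \<open>The bound on finite subsets is uniform and the terms are nonnegative, so
      summability and the estimate of the full sum follow together.\<close>
    have "w summable_on Z"
      using w0 fin by (intro nonneg_bdd_above_summable_on bdd_aboveI[of _ "C4 * K"]) auto
    then show ?thesis using fin by (intro conjI infsum_le_finite_sums) auto
  qed
  ultimately show "\<exists>C4>0. \<forall>(f :: complex \<Rightarrow> complex) K.
           K > 0 \<and> f holomorphic_on ball 0 1 \<and> norm (f 0) = 1 \<and>
           (\<forall>z\<in>ball 0 1. f z \<noteq> 0 \<longrightarrow>
              ln (norm (f z)) \<le> K / (1 - norm z) powr p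
                 * infdist z E powr r / infdist z F powr q)
           \<longrightarrow>
           (let w = (\<lambda>\<zeta>. of_int (zorder f \<zeta>) * (1 - norm \<zeta>) powr (p + 1 + \<epsilon>)
                      * infdist \<zeta> F powr (max (q - ahern_clark_type F + \<epsilon>) 0)
                      / infdist \<zeta> E powr (min p r));
                Z = {\<zeta> \<in> ball 0 1. f \<zeta> = 0}
            in w summable_on Z \<and> infsum w Z \<le> C4 * K)"
    unfolding Let_def s_def r0_def by (intro exI[of _ C4]) auto
qed

end
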